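(* $(1+\varepsilon)$-Approximate Min-Plus Convolution can be solved in strongly polynomial time $\tilde{\mathcal{O}}(n^{3/2}/\sqrt{\varepsilon})$.
   Context: $\mathbb{R}_+=\{a\in\mathbb{R}:a\ge1\}\cup\{\infty\}$. Given sequences $(A[i])_{i=0}^{n-1},(B[i])_{i=0}^{n-1}\in\mathbb{R}_+^n$, their Min-Plus Convolution is $C[k]=\min_{i+j=k}(A[i]+B[j])$ for $0\le k<n$; a $(1+\varepsilon)$-approximation is a sequence $\tilde C$ with $C[k]\le\tilde C[k]\le(1+\varepsilon)C[k]$ for all $k$. Inputs are in floating-point representation with unit-cost arithmetic. "Strongly polynomial time $T$" means at most $T$ arithmetic operations, independent of the largest input value $W$. $\tilde{\mathcal{O}}$ hides polylogarithmic factors in $n$ and $1/\varepsilon$, never $\log W$. $0<\varepsilon<1/10$. *)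

theory Defs
  imports Complex_Main "HOL-Library.Extended_Real"
begin

section \<open>The problem\<close>

definition Rplus :: "ereal set" where
  "Rplus = {ereal a |a. a \<ge> 1} \<union> {\<infinity>}"

text \<open>Only the entries with index below \<open>n\<close> matter; for \<open>k < n\<close>, \<open>i + j = k\<close> keeps both
  indices below \<open>n\<close>.\<close>

definition min_plus_conv :: "(nat \<Rightarrow> ereal) \<Rightarrow> (nat \<Rightarrow> ereal) \<Rightarrow> nat \<Rightarrow> ereal" where
  "min_plus_conv A B k = Min {A i + B j |i j. i + j = k}"

definition approx_min_plus_conv ::
  "nat \<Rightarrow> real \<Rightarrow> (nat \<Rightarrow> ereal) \<Rightarrow> (nat \<Rightarrow> ereal) \<Rightarrow> (nat \<Rightarrow> ereal) \<Rightarrow> bool" where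
  "approx_min_plus_conv n \<epsilon> A B C' \<longleftrightarrow>
     (\<forall>k<n. min_plus_conv A B k \<le> C' k \<and> C' k \<le> ereal (1 + \<epsilon>) * min_plus_conv A B k)"

section \<open>The machine model\<close>

text \<open>
  A deterministic word RAM, programmed in a structured language. A program mentions finitely many
  registers and finitely many arrays; all cells hold integers. Every operation, memory access,
  assignment and test costs one unit. The word length \<open>L\<close> is a parameter of the semantics: a run
  that would produce an integer of absolute value at least \<open>2 ^ L\<close>, divide by zero, or use a
  negative shift amount or array index is stuck and has no final state. The bound on the size of
  integers is what makes the unit-cost measure meaningful, since it excludes packing long vectors
  into one integer.
\<close>

datatype binop = Add | Sub | Mul | Div | Shl | Shr | Less | Equal

datatype expr =
    Const int
  | Reg string
  | Arr string expr
  | Bin binop expr expr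

datatype com =
    Skip
  | Assign string expr
  | Store string expr expr
  | Seq com com
  | Cond expr com com
  | While expr com

record state =
  reg :: "string \<Rightarrow> int"
  arr :: "string \<Rightarrow> nat \<Rightarrow> int"

definition is_word :: "nat \<Rightarrow> int \<Rightarrow> bool" where
  "is_word L x \<longleftrightarrow> \<bar>x\<bar> < 2 ^ L"

fun binop_val :: "binop \<Rightarrow> int \<Rightarrow> int \<Rightarrow> int" where
  "binop_val Add x y = x + y"
| "binop_val Sub x y = x - y"
| "binop_val Mul x y = x * y"
| "binop_val Div x y = x div y"
| "binop_val Shl x y = x * 2 ^ nat y"
| "binop_val Shr x y = x div 2 ^ nat y"
| "binop_val Less x y = (if x < y then 1 else 0)"
| "binop_val Equal x y = (if x = y then 1 else 0)"

fun binop_defined :: "binop \<Rightarrow> int \<Rightarrow> int \<Rightarrow> bool" where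
  "binop_defined Div x y \<longleftrightarrow> y \<noteq> 0"
| "binop_defined Shl x y \<longleftrightarrow> y \<ge> 0"
| "binop_defined Shr x y \<longleftrightarrow> y \<ge> 0"
| "binop_defined _ x y \<longleftrightarrow> True"

fun expr_val :: "expr \<Rightarrow> state \<Rightarrow> int" where
  "expr_val (Const c) s = c"
| "expr_val (Reg x) s = reg s x"
| "expr_val (Arr a e) s = arr s a (nat (expr_val e s))"
| "expr_val (Bin f e1 e2) s = binop_val f (expr_val e1 s) (expr_val e2 s)"

fun expr_safe :: "nat \<Rightarrow> expr \<Rightarrow> state \<Rightarrow> bool" where
  "expr_safe L (Const c) s \<longleftrightarrow> is_word L c"
| "expr_safe L (Reg x) s \<longleftrightarrow> is_word L (reg s x)"
| "expr_safe L (Arr a e) s \<longleftrightarrow>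
     expr_safe L e s \<and> expr_val e s \<ge> 0 \<and> is_word L (expr_val (Arr a e) s)"
| "expr_safe L (Bin f e1 e2) s \<longleftrightarrow>
     expr_safe L e1 s \<and> expr_safe L e2 s \<and>
     binop_defined f (expr_val e1 s) (expr_val e2 s) \<and> is_word L (expr_val (Bin f e1 e2) s)"

fun expr_cost :: "expr \<Rightarrow> nat" where
  "expr_cost (Const c) = 1"
| "expr_cost (Reg x) = 1"
| "expr_cost (Arr a e) = expr_cost e + 1"
| "expr_cost (Bin f e1 e2) = expr_cost e1 + expr_cost e2 + 1"

text \<open>\<open>exec L c s t s'\<close>: with words of length \<open>L\<close>, command \<open>c\<close> started in \<open>s\<close> terminates in \<open>s'\<close>
  after exactly \<open>t\<close> unit-cost operations. A test succeeds iff its value is nonzero.\<close>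

inductive exec :: "nat \<Rightarrow> com \<Rightarrow> state \<Rightarrow> nat \<Rightarrow> state \<Rightarrow> bool" for L where
  Skip: "exec L Skip s 1 s"
| Assign: "expr_safe L e s \<Longrightarrow>
    exec L (Assign x e) s (expr_cost e + 1) (s\<lparr>reg := (reg s)(x := expr_val e s)\<rparr>)"
| Store: "expr_safe L i s \<Longrightarrow> expr_val i s \<ge> 0 \<Longrightarrow> expr_safe L e s \<Longrightarrow>
    exec L (Store a i e) s (expr_cost i + expr_cost e + 1)
      (s\<lparr>arr := (arr s)(a := (arr s a)(nat (expr_val i s) := expr_val e s))\<rparr>)"
| Seq: "exec L c1 s t1 s1 \<Longrightarrow> exec L c2 s1 t2 s2 \<Longrightarrow> exec L (Seq c1 c2) s (t1 + t2) s2"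
| CondTrue: "expr_safe L b s \<Longrightarrow> expr_val b s \<noteq> 0 \<Longrightarrow> exec L c1 s t s' \<Longrightarrow>
    exec L (Cond b c1 c2) s (expr_cost b + 1 + t) s'"
| CondFalse: "expr_safe L b s \<Longrightarrow> expr_val b s = 0 \<Longrightarrow> exec L c2 s t s' \<Longrightarrow>
    exec L (Cond b c1 c2) s (expr_cost b + 1 + t) s'"
| WhileFalse: "expr_safe L b s \<Longrightarrow> expr_val b s = 0 \<Longrightarrow>
    exec L (While b c) s (expr_cost b + 1) s"
| WhileTrue: "expr_safe L b s \<Longrightarrow> expr_val b s \<noteq> 0 \<Longrightarrow> exec L c s t1 s1 \<Longrightarrow>
    exec L (While b c) s1 t2 s2 \<Longrightarrow> exec L (While b c) s (expr_cost b + 1 + t1 + t2) s2"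

inductive_cases SkipE: "exec L Skip s t s'"
inductive_cases AssignE: "exec L (Assign x e) s t s'"
inductive_cases StoreE: "exec L (Store a i e) s t s'"
inductive_cases SeqE: "exec L (Seq c1 c2) s t s'"
inductive_cases CondE: "exec L (Cond b c1 c2) s t s'"
inductive_cases WhileE: "exec L (While b c) s t s'"

lemma exec_deterministic:
  "exec L c s t s' \<Longrightarrow> exec L c s u s'' \<Longrightarrow> t = u \<and> s' = s''"
proof (induction arbitrary: u s'' rule: exec.induct)
  case (Skip s)
  then show ?case by (rule SkipE) simp
next
  case (Assign e s x)
  from Assign.prems show ?case by (rule AssignE) simp
next
  case (Store i s e a)
  from Store.prems show ?case by (rule StoreE) simp
next
  case (Seq c1 s t1 s1 c2 t2 s2)
  from Seq.prems obtain u1 r u2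
    where "exec L c1 s u1 r" "exec L c2 r u2 s''" "u = u1 + u2" by (rule SeqE)
  with Seq.IH show ?case by metis
next
  case (CondTrue b s c1 t s' c2)
  from CondTrue.prems obtain v where "exec L c1 s v s''" "u = expr_cost b + 1 + v"
    by (rule CondE) (use CondTrue.hyps in simp_all)
  with CondTrue.IH show ?case by metis
next
  case (CondFalse b s c2 t s' c1)
  from CondFalse.prems obtain v where "exec L c2 s v s''" "u = expr_cost b + 1 + v"
    by (rule CondE) (use CondFalse.hyps in simp_all)
  with CondFalse.IH show ?case by metis
next
  case (WhileFalse b s c)
  from WhileFalse.prems show ?case by (rule WhileE) (use WhileFalse.hyps in simp_all)
next
  case (WhileTrue b s c t1 s1 t2 s2)
  from WhileTrue.prems obtain u1 r u2
    where "exec L c s u1 r" "exec L (While b c) r u2 s''" "u = expr_cost b + 1 + u1 + u2"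
    by (rule WhileE) (use WhileTrue.hyps in simp_all)
  with WhileTrue.IH show ?case by metis
qed

section \<open>Floating-point input and output\<close>

text \<open>The pair of mantissa \<open>m\<close> and exponent \<open>e\<close>. Since all finite values in question are
  positive, mantissa \<open>0\<close> is free to encode \<open>\<infinity>\<close>.\<close>

definition float_val :: "int \<Rightarrow> int \<Rightarrow> ereal" where
  "float_val m e = (if m = 0 then \<infinity> else ereal (real_of_int m * 2 powi e))"

definition normalized :: "nat \<Rightarrow> int \<Rightarrow> bool" where
  "normalized p m \<longleftrightarrow> p \<ge> 1 \<and> 2 ^ (p - 1) \<le> m \<and> m < 2 ^ p"

text \<open>
  The initial memory for the instance \<open>(n, \<epsilon>, A, B)\<close> in floating-point format with \<open>p\<close>-bit
  mantissas, where \<open>w\<close> is a length such that every input integer is a \<open>w\<close>-bit word and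
  \<open>w \<ge> log\<^sub>2 (1/\<epsilon>)\<close>. The exponents of \<open>A\<close> and \<open>B\<close> being words means that \<open>w\<close> must be at least about
  \<open>log log W\<close> for the largest finite input \<open>W\<close>. As an arbitrary real \<open>\<epsilon>\<close> has no finite
  representation, the program receives a floating-point lower approximation of it up to a factor
  of \<open>2\<close> (possibly \<open>\<epsilon>\<close> itself).
\<close>

definition input_state ::
  "nat \<Rightarrow> nat \<Rightarrow> nat \<Rightarrow> real \<Rightarrow> (nat \<Rightarrow> ereal) \<Rightarrow> (nat \<Rightarrow> ereal) \<Rightarrow> state \<Rightarrow> bool" where
  "input_state w p n \<epsilon> A B s \<longleftrightarrow>
     1 / \<epsilon> \<le> 2 ^ w \<and>
     (\<forall>x. is_word w (reg s x)) \<and> (\<forall>a i. is_word w (arr s a i)) \<and>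
     reg s ''n'' = int n \<and>
     reg s ''p'' = int p \<and>
     normalized p (reg s ''eps_man'') \<and>
     ereal (\<epsilon> / 2) \<le> float_val (reg s ''eps_man'') (reg s ''eps_exp'') \<and>
     float_val (reg s ''eps_man'') (reg s ''eps_exp'') \<le> ereal \<epsilon> \<and>
     (\<forall>i<n. arr s ''A_man'' i = 0 \<or> normalized p (arr s ''A_man'' i)) \<and>
     (\<forall>i<n. float_val (arr s ''A_man'' i) (arr s ''A_exp'' i) = A i) \<and>
     (\<forall>i<n. arr s ''B_man'' i = 0 \<or> normalized p (arr s ''B_man'' i)) \<and>
     (\<forall>i<n. float_val (arr s ''B_man'' i) (arr s ''B_exp'' i) = B i) \<and>
     (\<forall>x. x \<notin> {''n'', ''p'', ''eps_man'', ''eps_exp''} \<longrightarrow> reg s x = 0) \<and>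
     (\<forall>a i. a \<notin> {''A_man'', ''A_exp'', ''B_man'', ''B_exp''} \<or> i \<ge> n \<longrightarrow> arr s a i = 0)"

definition output_seq :: "state \<Rightarrow> nat \<Rightarrow> ereal" where
  "output_seq s k = float_val (arr s ''C_man'' k) (arr s ''C_exp'' k)"

section \<open>Running time\<close>

text \<open>
  One program \<open>P\<close> works for all instances and input formats. It may use words longer than those
  of the input by a constant factor \<open>\<kappa>\<close>, and the number of operations is bounded in terms of \<open>n\<close>
  and \<open>\<epsilon>\<close> only, whatever the magnitudes \<open>A\<close> and \<open>B\<close>, the precision \<open>p\<close> and the word length \<open>w\<close>.
\<close>

definition approx_min_plus_conv_strongly_poly_time :: "(nat \<Rightarrow> real \<Rightarrow> real) \<Rightarrow> bool" where
  "approx_min_plus_conv_strongly_poly_time T \<longleftrightarrow>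
     (\<exists>P \<kappa>. \<forall>n \<epsilon> A B w p s.
        n \<ge> 1 \<and> 0 < \<epsilon> \<and> \<epsilon> < 1 / 10 \<and>
        (\<forall>i<n. A i \<in> Rplus \<and> B i \<in> Rplus) \<and>
        input_state w p n \<epsilon> A B s \<longrightarrow>
        (\<exists>t s'. exec (\<kappa> * w) P s t s' \<and> real t \<le> T n \<epsilon> \<and>
           approx_min_plus_conv n \<epsilon> A B (output_seq s')))"

text \<open>Soft-O: \<open>ln (n / \<epsilon>) = ln n + ln (1 / \<epsilon>) > 1\<close> in the range considered, so its powers
  dominate all polylogarithmic factors in \<open>n\<close> and \<open>1 / \<epsilon>\<close>.\<close>

definition soft_O :: "(nat \<Rightarrow> real \<Rightarrow> real) \<Rightarrow> (nat \<Rightarrow> real \<Rightarrow> real) set" where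
  "soft_O f = {T. \<exists>c d. \<forall>n \<epsilon>. n \<ge> 1 \<and> 0 < \<epsilon> \<and> \<epsilon> < 1 / 10 \<longrightarrow>
     T n \<epsilon> \<le> c * f n \<epsilon> * ln (real n / \<epsilon>) ^ (d :: nat)}"

end

theory Submission imports Defs begin

text \<open>
  Order the finite entries of \<open>A\<close> by exponent, cut this order into groups of about \<open>sqrt (n / \<epsilon>)\<close>
  consecutive elements, and treat the pairs in which the exponent of \<open>A i\<close> is at least that of \<open>B j\<close>
  (the others are obtained by exchanging the sequences). Relative to the largest exponent of a
  group, all values of the group, and all smaller values of \<open>B\<close>, are rounded down to one of
  \<open>O(1 / \<epsilon>)\<close> multiples of a common unit. A single Boolean convolution of length \<open>O(n / \<epsilon>)\<close> then yields the smallest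
  rounded sum for every output position \<open>k\<close>, which is accurate for the elements having the top exponent of
  their group. For the remaining elements let \<open>f\<close> be the top exponent of the first group that reaches \<open>k\<close>.
  That group bounds the output by \<open>2 ^ (p + f + 1)\<close>, so an element of exponent at least \<open>f + 2\<close> is
  irrelevant; and an element of exponent \<open>f\<close> or \<open>f + 1\<close> below the top of its group lies in one of at most
  three groups (the first one, and the one where the class \<open>f\<close>, respectively \<open>f + 1\<close>, ends), which
  are searched exhaustively for this \<open>k\<close>. If a single group contains everything, that search is all
  that is done, so the total cost is always \<open>O(n * sqrt (n / \<epsilon>))\<close> up to logarithms.

  The convolutions use a complex Fourier transform in fixed-point arithmetic. All errors are
  polynomial in the length \<open>N\<close> of the transform, hence \<open>16 * log2 N\<close> fractional bits suffice.
\<close>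

section \<open>Reasoning about programs\<close>

text \<open>The obstacle is that the cost may not depend on the spread of the exponents, which rules
  out one convolution per scale. Fixing the number of elements of a group, instead of its range of
  exponents, bounds the number of convolutions by about \<open>n / S\<close>. The price is that a
  group may mix arbitrarily distant scales. Sortedness pays it back: equal exponents form an
  interval of the order, so a class that ends strictly inside a group does so in one group only, and
  one recorded position per class suffices. The group size comes from a balance:
  \<open>n / S\<close> transforms of length \<open>N\<close>, each costing about \<open>N\<close> up
  to logarithms, against \<open>S\<close> candidates per recorded group and output position. With
  \<open>N\<close> about \<open>n / \<epsilon>\<close> and \<open>S * S\<close> about
  \<open>N\<close>, both sides are about \<open>n * S\<close>. Two further constraints shape the
  arithmetic. Gaps between exponents are bounded only by about \<open>2 ^ w\<close>, so numbers
  cannot be aligned by left shifts and every comparison is done with right shifts. Roots of unity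
  are available only approximately, so the convolution counts are recovered by a threshold at one
  half.\<close>

notation Seq (infixr ";;" 60)

abbreviation plus_expr (infixl "\<oplus>" 65) where "e \<oplus> e' \<equiv> Bin Add e e'"
abbreviation minus_expr (infixl "\<ominus>" 65) where "e \<ominus> e' \<equiv> Bin Sub e e'"
abbreviation times_expr (infixl "\<otimes>" 70) where "e \<otimes> e' \<equiv> Bin Mul e e'"
abbreviation div_expr (infixl "\<oslash>" 70) where "e \<oslash> e' \<equiv> Bin Div e e'"
abbreviation shl_expr (infixl "\<lless>" 55) where "e \<lless> e' \<equiv> Bin Shl e e'"
abbreviation shr_expr (infixl "\<ggreater>" 55) where "e \<ggreater> e' \<equiv> Bin Shr e e'"
abbreviation less_expr (infix "\<prec>" 50) where "e \<prec> e' \<equiv> Bin Less e e'"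
abbreviation equal_expr (infix "\<doteq>" 50) where "e \<doteq> e' \<equiv> Bin Equal e e'"

text \<open>A weakest precondition for total correctness. The step count is an argument of the
  postcondition, so time and result are established together, and since a stuck run has no final
  state, word-size safety is part of every such claim. The equivalences per command let
  \<open>simp\<close> execute straight-line code symbolically.\<close>

definition runs :: "nat \<Rightarrow> com \<Rightarrow> state \<Rightarrow> (nat \<Rightarrow> state \<Rightarrow> bool) \<Rightarrow> bool" where
  "runs L c s Q \<longleftrightarrow> (\<exists>t s'. exec L c s t s' \<and> Q t s')"

lemma runsI: "exec L c s t s' \<Longrightarrow> Q t s' \<Longrightarrow> runs L c s Q"
  unfolding runs_def by blast

lemma runs_Skip [simp]: "runs L Skip s Q \<longleftrightarrow> Q 1 s"
  by (rule iffI) (auto simp: runs_def elim: SkipE, use exec.Skip in fastforce)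

lemma runs_Assign [simp]:
  "runs L (Assign x e) s Q \<longleftrightarrow>
     expr_safe L e s \<and> Q (expr_cost e + 1) (s\<lparr>reg := (reg s)(x := expr_val e s)\<rparr>)"
  by (rule iffI) (auto simp: runs_def elim!: AssignE, use exec.Assign in fastforce)

lemma runs_Store [simp]:
  "runs L (Store a i e) s Q \<longleftrightarrow>
     expr_safe L i s \<and> expr_val i s \<ge> 0 \<and> expr_safe L e s \<and>
     Q (expr_cost i + expr_cost e + 1)
       (s\<lparr>arr := (arr s)(a := (arr s a)(nat (expr_val i s) := expr_val e s))\<rparr>)"
  by (rule iffI) (auto simp: runs_def elim!: StoreE, use exec.Store in fastforce)

lemma runs_Seq [simp]:
  "runs L (c1 ;; c2) s Q \<longleftrightarrow> runs L c1 s (\<lambda>t1 s1. runs L c2 s1 (\<lambda>t2. Q (t1 + t2)))"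
proof
  assume "runs L (c1 ;; c2) s Q"
  then show "runs L c1 s (\<lambda>t1 s1. runs L c2 s1 (\<lambda>t2. Q (t1 + t2)))"
    unfolding runs_def by (blast elim: SeqE)
next
  assume "runs L c1 s (\<lambda>t1 s1. runs L c2 s1 (\<lambda>t2. Q (t1 + t2)))"
  then show "runs L (c1 ;; c2) s Q"
    unfolding runs_def by (blast intro: exec.Seq)
qed

lemma runs_Cond [simp]:
  "runs L (Cond b c1 c2) s Q \<longleftrightarrow>
     expr_safe L b s \<and>
     (if expr_val b s \<noteq> 0 then runs L c1 s (\<lambda>t. Q (expr_cost b + 1 + t))
      else runs L c2 s (\<lambda>t. Q (expr_cost b + 1 + t)))" (is "?l \<longleftrightarrow> ?r")
proof
  assume ?l
  then obtain t s' where "exec L (Cond b c1 c2) s t s'" "Q t s'" unfolding runs_def by blast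
  then show ?r unfolding runs_def by (cases rule: CondE) auto
next
  assume ?r
  then show ?l
    by (cases "expr_val b s = 0")
      (auto simp: runs_def[of _ c1] runs_def[of _ c2]
        intro: runsI[OF exec.CondTrue] runsI[OF exec.CondFalse])
qed

fun written_regs :: "com \<Rightarrow> string set" where
  "written_regs (Assign x e) = {x}"
| "written_regs (c1 ;; c2) = written_regs c1 \<union> written_regs c2"
| "written_regs (Cond b c1 c2) = written_regs c1 \<union> written_regs c2"
| "written_regs (While b c) = written_regs c"
| "written_regs _ = {}"

fun written_arrs :: "com \<Rightarrow> string set" where
  "written_arrs (Store a i e) = {a}"
| "written_arrs (c1 ;; c2) = written_arrs c1 \<union> written_arrs c2"
| "written_arrs (Cond b c1 c2) = written_arrs c1 \<union> written_arrs c2"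
| "written_arrs (While b c) = written_arrs c"
| "written_arrs _ = {}"

definition unchanged :: "string set \<Rightarrow> string set \<Rightarrow> state \<Rightarrow> state \<Rightarrow> bool" where
  "unchanged X Y s s' \<longleftrightarrow> (\<forall>x. x \<notin> X \<longrightarrow> reg s' x = reg s x) \<and> (\<forall>a. a \<notin> Y \<longrightarrow> arr s' a = arr s a)"

lemma unchanged_refl [simp]: "unchanged X Y s s"
  by (simp add: unchanged_def)

lemma unchanged_trans:
  "unchanged X Y s s' \<Longrightarrow> unchanged X' Y' s' s'' \<Longrightarrow> unchanged (X \<union> X') (Y \<union> Y') s s''"
  by (simp add: unchanged_def)

lemma unchanged_reg: "unchanged X Y s s' \<Longrightarrow> x \<notin> X \<Longrightarrow> reg s' x = reg s x"
  by (simp add: unchanged_def)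

lemma unchanged_arr: "unchanged X Y s s' \<Longrightarrow> a \<notin> Y \<Longrightarrow> arr s' a = arr s a"
  by (simp add: unchanged_def)

lemma exec_unchanged: "exec L c s t s' \<Longrightarrow> unchanged (written_regs c) (written_arrs c) s s'"
  by (induction rule: exec.induct) (auto simp: unchanged_def)

text \<open>Consequence and frame rule in one: what a program leaves alone is read off its syntax,
  so postconditions need to mention only what changes.\<close>

lemma runs_conseq:
  assumes "runs L c s Q'"
    and "\<And>t s'. Q' t s' \<Longrightarrow> unchanged (written_regs c) (written_arrs c) s s' \<Longrightarrow> Q t s'"
  shows "runs L c s Q"
  using assms exec_unchanged unfolding runs_def by blast

definition For :: "string \<Rightarrow> string \<Rightarrow> com \<Rightarrow> com" where
  "For i b c =
     Assign i (Const 0) ;;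
     While (Reg i \<prec> Reg b) (c ;; Assign i (Reg i \<oplus> Const 1))"

lemma written_For [simp]:
  "written_regs (For i b c) = insert i (written_regs c)"
  "written_arrs (For i b c) = written_arrs c"
  by (auto simp: For_def)

lemma is_word_mono: "is_word L x \<Longrightarrow> \<bar>y\<bar> \<le> \<bar>x\<bar> \<Longrightarrow> is_word L y"
  by (simp add: is_word_def)

text \<open>Each iteration pays 4 for the test and 4 for the increment; the trailing 6 is the
  initial assignment and the final failing test. \<open>indep\<close> is required because the
  counter is written outside the body, where the invariant has to survive.\<close>

lemma runs_For:
  assumes regs: "i \<notin> written_regs c" "b \<notin> written_regs c" "i \<noteq> b"
    and b: "reg s b = int m" and word: "is_word L (int m)" and "L > 0"
    and indep: "\<And>k s v. I k s \<Longrightarrow> I k (s\<lparr>reg := (reg s)(i := v)\<rparr>)"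
    and init: "I 0 s"
    and step: "\<And>k s'. k < m \<Longrightarrow> reg s' i = int k \<Longrightarrow> I k s' \<Longrightarrow>
      unchanged (insert i (written_regs c)) (written_arrs c) s s' \<Longrightarrow>
      runs L c s' (\<lambda>t s''. t \<le> T \<and> I (Suc k) s'')"
    and fin: "\<And>t s'. t \<le> m * (T + 8) + 6 \<Longrightarrow> I m s' \<Longrightarrow>
      unchanged (insert i (written_regs c)) (written_arrs c) s s' \<Longrightarrow> Q t s'"
  shows "runs L (For i b c) s Q"
proof -
  let ?b = "Reg i \<prec> Reg b" and ?c = "c ;; Assign i (Reg i \<oplus> Const 1)"
  let ?U = "unchanged (insert i (written_regs c)) (written_arrs c)"
  have one: "is_word L 1" "is_word L 0"
    using \<open>L > 0\<close> by (simp_all add: is_word_def)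
  have loop: "runs L (While ?b ?c) s' (\<lambda>t s''. t \<le> (m - k) * (T + 8) + 4 \<and> I m s'' \<and> ?U s s'')"
    if "k \<le> m" "reg s' i = int k" "I k s'" "?U s s'" for k s'
    using that
  proof (induction "m - k" arbitrary: k s')
    case 0
    then have "k = m" by simp
    have rb: "reg s' b = int m" using 0 regs b by (simp add: unchanged_def)
    have "expr_safe L ?b s'" "expr_val ?b s' = 0"
      using 0 rb word one \<open>k = m\<close> by simp_all
    then have "exec L (While ?b ?c) s' (expr_cost ?b + 1) s'" by (rule exec.WhileFalse)
    then show ?case unfolding runs_def using 0 \<open>k = m\<close> by fastforce
  next
    case (Suc d)
    then have km: "k < m" by simp
    have rb: "reg s' b = int m" using Suc regs b by (simp add: unchanged_def)
    have wk: "is_word L (int k)" "is_word L (int k + 1)"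
      using word km by (auto elim: is_word_mono)
    have safe: "expr_safe L ?b s'" and true: "expr_val ?b s' \<noteq> 0"
      using Suc.prems rb word one wk km by simp_all
    obtain t1 s1 where ex1: "exec L c s' t1 s1" and t1: "t1 \<le> T" and I1: "I (Suc k) s1"
      using step[OF km Suc.prems(2,3,4)] unfolding runs_def by blast
    have i1: "reg s1 i = int k"
      using exec_unchanged[OF ex1] regs Suc.prems(2) by (simp add: unchanged_def)
    let ?s2 = "s1\<lparr>reg := (reg s1)(i := int (Suc k))\<rparr>"
    have "exec L (Assign i (Reg i \<oplus> Const 1)) s1 (expr_cost (Reg i \<oplus> Const 1) + 1)
        (s1\<lparr>reg := (reg s1)(i := expr_val (Reg i \<oplus> Const 1) s1)\<rparr>)"
      by (rule exec.Assign) (use i1 wk one in simp)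
    then have ex2: "exec L ?c s' (t1 + 4) ?s2"
      using exec.Seq[OF ex1, of "Assign i (Reg i \<oplus> Const 1)" 4 ?s2] i1
      by (simp add: add.commute numeral_eq_Suc)
    have "?U s1 ?s2" by (simp add: unchanged_def)
    moreover have "?U s s1"
      using exec_unchanged[OF ex1] Suc.prems(4) by (simp add: unchanged_def)
    ultimately have "?U s ?s2" by (simp add: unchanged_def)
    moreover have "d = m - Suc k" using Suc.hyps(2) by simp
    ultimately have "runs L (While ?b ?c) ?s2
        (\<lambda>t s''. t \<le> (m - Suc k) * (T + 8) + 4 \<and> I m s'' \<and> ?U s s'')"
      using Suc.hyps(1)[of "Suc k" ?s2] km indep[OF I1] by simp
    then obtain t2 s3 where ex3: "exec L (While ?b ?c) ?s2 t2 s3"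
      and t2: "t2 \<le> (m - Suc k) * (T + 8) + 4" and I3: "I m s3" "?U s s3"
      unfolding runs_def by blast
    have "exec L (While ?b ?c) s' (expr_cost ?b + 1 + (t1 + 4) + t2) s3"
      by (rule exec.WhileTrue[OF safe true ex2 ex3])
    moreover have "expr_cost ?b + 1 + (t1 + 4) + t2 \<le> (m - k) * (T + 8) + 4"
    proof -
      have "m - k = Suc (m - Suc k)" using km by simp
      then show ?thesis using t1 t2 by simp
    qed
    ultimately show ?case unfolding runs_def using I3 by blast
  qed
  let ?s0 = "s\<lparr>reg := (reg s)(i := 0)\<rparr>"
  have "?U s ?s0" by (simp add: unchanged_def)
  then have "runs L (While ?b ?c) ?s0 (\<lambda>t s''. t \<le> m * (T + 8) + 4 \<and> I m s'' \<and> ?U s s'')"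
    using loop[of 0 ?s0] indep[OF init] by simp
  then obtain t2 s3 where ex3: "exec L (While ?b ?c) ?s0 t2 s3"
    and t2: "t2 \<le> m * (T + 8) + 4" and I3: "I m s3" "?U s s3"
    unfolding runs_def by blast
  have "exec L (Assign i (Const 0)) s (expr_cost (Const 0) + 1)
     (s\<lparr>reg := (reg s)(i := expr_val (Const 0) s)\<rparr>)"
    by (rule exec.Assign) (simp add: one)
  then have "exec L (For i b c) s (2 + t2) s3"
    unfolding For_def using exec.Seq[of L "Assign i (Const 0)" s 2 ?s0] ex3 by (simp add: numeral_2_eq_2)
  moreover have "Q (2 + t2) s3" by (rule fin) (use t2 I3 in simp_all)
  ultimately show ?thesis unfolding runs_def by blast
qed

section \<open>Word lengths\<close>

lemma abs_div_le_pos: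
  assumes "y > 0" shows "\<bar>x div y\<bar> \<le> \<bar>x :: int\<bar>"
proof (cases "x div y \<ge> 0")
  case True
  then have "x div y * 1 \<le> x div y * y" using assms by (intro mult_left_mono) auto
  then have "x div y \<le> x div y * y" by simp
  also have "\<dots> \<le> x" using assms by (simp add: minus_mod_eq_div_mult [symmetric])
  finally show ?thesis using True by simp
next
  case False
  have "x = x div y * y + x mod y" by simp
  also have "\<dots> \<le> (x div y + 1) * y - 1"
    using pos_mod_bound[OF assms, of x] unfolding distrib_right by linarith
  also have "\<dots> \<le> (x div y + 1) * 1 - 1"
    using False assms by (intro diff_right_mono mult_left_mono_neg) auto
  finally show ?thesis using False by simp
qed

lemma abs_div_le: "\<bar>x div y\<bar> \<le> \<bar>x :: int\<bar>"
proof -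
  consider "y = 0" | "y > 0" | "y < 0" by linarith
  then show ?thesis
  proof cases
    case 3
    then show ?thesis using abs_div_le_pos[of "- y" "- x"] by simp
  qed (simp_all add: abs_div_le_pos)
qed

text \<open>\<open>4 \<le> w\<close> costs nothing: \<open>1 / \<epsilon> > 10\<close> together with
  \<open>1 / \<epsilon> \<le> 2 ^ w\<close> forces it. It makes the numerals below 16 words on every
  level.\<close>

locale words =
  fixes w L :: nat
  assumes w4: "4 \<le> w" and L: "L = 1024 * w"
begin

text \<open>Level \<open>k\<close> contains the words of \<open>2 ^ k * w\<close> bits, so an operation on level \<open>k\<close> ends in
  level \<open>k + 1\<close>; the machine word is level 10.\<close>

definition wd :: "nat \<Rightarrow> int \<Rightarrow> bool" where
  "wd k x \<longleftrightarrow> is_word (2 ^ k * w) x"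

lemma is_word_L [simp]: "is_word L x \<longleftrightarrow> wd 10 x"
  by (simp add: wd_def L)

lemma L_pos [simp]: "0 < L"
  using w4 L by simp

lemma wd_mono: "wd j x \<Longrightarrow> j \<le> k \<Longrightarrow> wd k x"
proof -
  assume "wd j x" "j \<le> k"
  then have "(2::nat) ^ j * w \<le> 2 ^ k * w" by (intro mult_right_mono power_increasing) auto
  then have "(2::int) ^ (2 ^ j * w) \<le> 2 ^ (2 ^ k * w)" by (rule power_increasing) auto
  then show ?thesis using \<open>wd j x\<close> unfolding wd_def is_word_def by linarith
qed

lemma two_pow_wd:
  assumes "0 < k" shows "(2::int) ^ (2 ^ k * w) = 2 ^ (2 ^ (k - 1) * w) * 2 ^ (2 ^ (k - 1) * w)"
proof -
  obtain j where "k = Suc j" using assms by (cases k) auto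
  then show ?thesis by (simp flip: power_add)
qed

lemma two_pow_wd_ge: "(2::int) \<le> 2 ^ (2 ^ k * w)"
proof -
  have "1 \<le> (2::nat) ^ k * w" using w4 by simp
  then have "(2::int) ^ 1 \<le> 2 ^ (2 ^ k * w)" by (intro power_increasing) auto
  then show ?thesis by simp
qed

lemma wd_mult:
  assumes "0 < k" "wd (k - 1) x" "wd (k - 1) y" shows "wd k (x * y)"
proof -
  have "\<bar>x\<bar> * \<bar>y\<bar> < 2 ^ (2 ^ (k - 1) * w) * 2 ^ (2 ^ (k - 1) * w)"
    using assms by (intro mult_strict_mono) (auto simp: wd_def is_word_def)
  then show ?thesis using two_pow_wd[OF assms(1)] by (simp add: wd_def is_word_def abs_mult)
qed

text \<open>Sums are charged a whole level like products, using \<open>2 * t \<le> t * t\<close>.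
  This is wasteful, but the nesting depth of an expression then bounds its level uniformly.\<close>

lemma wd_abs_sum:
  assumes "0 < k" "wd (k - 1) x" "wd (k - 1) y" "\<bar>z\<bar> \<le> \<bar>x\<bar> + \<bar>y\<bar>" shows "wd k z"
proof -
  let ?t = "(2::int) ^ (2 ^ (k - 1) * w)"
  have "\<bar>z\<bar> < ?t + ?t" using assms by (auto simp: wd_def is_word_def)
  also have "\<dots> = 2 * ?t" by simp
  also have "\<dots> \<le> ?t * ?t" using two_pow_wd_ge[of "k - 1"] by (intro mult_right_mono) auto
  finally show ?thesis using two_pow_wd[OF assms(1)] by (simp add: wd_def is_word_def)
qed

lemma wd_add: "0 < k \<Longrightarrow> wd (k - 1) x \<Longrightarrow> wd (k - 1) y \<Longrightarrow> wd k (x + y)"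
  using wd_abs_sum[of k x y "x + y"] by simp

lemma wd_diff: "0 < k \<Longrightarrow> wd (k - 1) x \<Longrightarrow> wd (k - 1) y \<Longrightarrow> wd k (x - y)"
  using wd_abs_sum[of k x y "x - y"] by simp

lemma wd_uminus: "wd k x \<Longrightarrow> wd k (- x)"
  by (simp add: wd_def is_word_def)

lemma wd_div: "wd k x \<Longrightarrow> wd k (x div y)"
  using abs_div_le by (auto simp: wd_def elim: is_word_mono)

lemma wd_const:
  assumes "\<bar>c\<bar> < 16" shows "wd k c"
proof -
  have "(2::int) ^ 4 \<le> 2 ^ (2 ^ k * w)"
    using w4 by (intro power_increasing) (auto intro: order_trans[of _ "1 * w"])
  then show ?thesis using assms by (simp add: wd_def is_word_def)
qed

lemma wd_01 [simp]: "wd k 0" "wd k 1" "wd k (if b then 1 else 0)"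
  by (auto intro: wd_const)

lemma wd_numeral [simp]: "numeral m < (16::int) \<Longrightarrow> wd k (numeral m)"
  by (rule wd_const) simp

lemmas wd_arith = wd_mult wd_add wd_diff wd_uminus wd_div

lemma wd_le: "wd k y \<Longrightarrow> 0 \<le> x \<Longrightarrow> x \<le> y \<Longrightarrow> wd k x"
  by (auto simp: wd_def elim: is_word_mono)

end

section \<open>The discrete Fourier transform\<close>

text \<open>Decimation in time: level \<open>l\<close> holds the transforms of length \<open>2 ^ l\<close> of the residue classes
  modulo \<open>2 ^ (q - l)\<close> of the input.\<close>

definition dft_level :: "complex \<Rightarrow> nat \<Rightarrow> (nat \<Rightarrow> complex) \<Rightarrow> nat \<Rightarrow> nat \<Rightarrow> nat \<Rightarrow> complex" where
  "dft_level \<omega> q x l r k = (\<Sum>m<2 ^ l. x (r + m * 2 ^ (q - l)) * \<omega> ^ (m * k * 2 ^ (q - l)))"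

lemma dft_level_0 [simp]: "dft_level \<omega> q x 0 r k = x r"
  by (simp add: dft_level_def)

lemma dft_level_top: "dft_level \<omega> q x q 0 k = (\<Sum>m<2 ^ q. x m * \<omega> ^ (m * k))"
  by (simp add: dft_level_def)

lemma sum_even_odd: "sum f {..<2 * h} = (\<Sum>m<h. f (2 * m) + f (Suc (2 * m)))"
  for f :: "nat \<Rightarrow> 'a :: comm_monoid_add"
  by (induction h) (simp_all add: add.assoc)

text \<open>On level \<open>l\<close> only powers of \<open>\<omega> ^ 2 ^ (q - l)\<close> occur, a
  root of unity of order dividing \<open>2 ^ l\<close>, so the frequency matters modulo
  \<open>2 ^ l\<close> only.\<close>

lemma dft_level_mod:
  assumes "\<omega> ^ (2 ^ q) = 1" "l \<le> q"
  shows "dft_level \<omega> q x l r (k mod 2 ^ l) = dft_level \<omega> q x l r k"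
  unfolding dft_level_def
proof (rule sum.cong[OF refl])
  fix m
  have e: "(2::nat) ^ l * 2 ^ (q - l) = 2 ^ q" using assms by (simp flip: power_add)
  have "m * k * 2 ^ (q - l) = m * ((k div 2 ^ l) * 2 ^ l + k mod 2 ^ l) * 2 ^ (q - l)"
    by (simp only: div_mult_mod_eq)
  also have "\<dots> = 2 ^ q * (m * (k div 2 ^ l)) + m * (k mod 2 ^ l) * 2 ^ (q - l)"
    unfolding e[symmetric] by (simp only: algebra_simps)
  finally have "\<omega> ^ (m * k * 2 ^ (q - l)) = \<omega> ^ (m * (k mod 2 ^ l) * 2 ^ (q - l))"
    using assms by (simp only: power_add power_mult power_one mult_1)
  then show "x (r + m * 2 ^ (q - l)) * \<omega> ^ (m * (k mod 2 ^ l) * 2 ^ (q - l)) =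
      x (r + m * 2 ^ (q - l)) * \<omega> ^ (m * k * 2 ^ (q - l))" by simp
qed

text \<open>Splitting the summation index by parity gives the transforms of the two residue classes
  into which class \<open>r\<close> splits. The twiddle factor uses the unreduced \<open>k\<close>,
  so the sign change in the second half of a butterfly is already contained in the power of
  \<open>\<omega>\<close> and needs no separate formula.\<close>

lemma dft_level_Suc:
  assumes "\<omega> ^ (2 ^ q) = 1" "l < q"
  shows "dft_level \<omega> q x (Suc l) r k =
    dft_level \<omega> q x l r (k mod 2 ^ l) +
    \<omega> ^ (k * 2 ^ (q - 1 - l)) * dft_level \<omega> q x l (r + 2 ^ (q - 1 - l)) (k mod 2 ^ l)"
proof -
  let ?D = "2 ^ (q - 1 - l) :: nat"
  have D: "q - Suc l = q - 1 - l" "(2::nat) ^ (q - l) = 2 * ?D"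
  proof -
    have "q - l = Suc (q - 1 - l)" using assms(2) by simp
    then show "(2::nat) ^ (q - l) = 2 * ?D" by (simp only: power_Suc)
  qed simp
  have "dft_level \<omega> q x (Suc l) r k = (\<Sum>m<2 * 2 ^ l. x (r + m * ?D) * \<omega> ^ (m * k * ?D))"
    by (simp only: dft_level_def D(1) power_Suc)
  also have "\<dots> = (\<Sum>m<2 ^ l. x (r + (2 * m) * ?D) * \<omega> ^ ((2 * m) * k * ?D)
      + x (r + Suc (2 * m) * ?D) * \<omega> ^ (Suc (2 * m) * k * ?D))"
    by (rule sum_even_odd)
  also have "\<dots> = (\<Sum>m<2 ^ l. x (r + m * (2 * ?D)) * \<omega> ^ (m * k * (2 * ?D)))
      + \<omega> ^ (k * ?D) * (\<Sum>m<2 ^ l. x (r + ?D + m * (2 * ?D)) * \<omega> ^ (m * k * (2 * ?D)))"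
    unfolding sum.distrib sum_distrib_left
  proof (intro arg_cong2[where f = "(+)"] sum.cong refl)
    fix m
    show "x (r + (2 * m) * ?D) * \<omega> ^ ((2 * m) * k * ?D) = x (r + m * (2 * ?D)) * \<omega> ^ (m * k * (2 * ?D))"
      by (simp only: mult_ac)
    have "r + Suc (2 * m) * ?D = r + ?D + m * (2 * ?D)" by simp
    moreover have "Suc (2 * m) * k * ?D = k * ?D + m * k * (2 * ?D)" by (simp add: algebra_simps)
    ultimately show "x (r + Suc (2 * m) * ?D) * \<omega> ^ (Suc (2 * m) * k * ?D) =
        \<omega> ^ (k * ?D) * (x (r + ?D + m * (2 * ?D)) * \<omega> ^ (m * k * (2 * ?D)))"
      by (simp only: power_add mult_ac)
  qed
  finally show ?thesis
    using assms by (simp only: dft_level_mod less_imp_le) (simp only: dft_level_def D(2))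
qed

lemma norm_dft_level_le:
  assumes "norm \<omega> = 1" "\<And>j. norm (x j) \<le> B" "0 \<le> B" "l \<le> q"
  shows "norm (dft_level \<omega> q x l r k) \<le> 2 ^ q * B"
proof -
  have "norm (dft_level \<omega> q x l r k) \<le> (\<Sum>m<(2::nat) ^ l. B)"
    unfolding dft_level_def using assms
    by (intro order_trans[OF norm_sum] sum_mono) (simp add: norm_mult norm_power)
  also have "\<dots> = 2 ^ l * B" by simp
  also have "\<dots> \<le> 2 ^ q * B" using assms by (intro mult_right_mono power_increasing) auto
  finally show ?thesis .
qed

abbreviation unity_root :: "nat \<Rightarrow> complex" where
  "unity_root N \<equiv> cis (2 * pi / real N)"

lemma unity_root_power: "unity_root N ^ j = cis (2 * pi * real j / real N)"
  by (simp add: DeMoivre mult_ac)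

lemma unity_root_power_N: "0 < N \<Longrightarrow> unity_root N ^ N = 1"
  by (simp add: unity_root_power)

lemma unity_root_power_eq_1:
  assumes "0 < N" "unity_root N ^ j = 1" shows "N dvd j"
proof -
  have "cos (2 * pi * real j / real N) = 1"
    using assms(2) unfolding unity_root_power by (metis cis.simps(1) one_complex.simps(1))
  then obtain m :: int where "2 * pi * real j / real N = of_int m * 2 * pi"
    unfolding cos_one_2pi_int by blast
  then have "real j = of_int m * real N" using assms(1) by (simp add: field_simps)
  then have "int j = m * int N"
    by (metis of_int_eq_iff of_int_mult of_int_of_nat_eq)
  then show ?thesis by (metis dvd_triv_right int_dvd_int_iff)
qed

text \<open>Orthogonality of characters: off the multiples of \<open>N\<close> this is a geometric
  sum whose ratio differs from 1 but has \<open>N\<close>-th power 1.\<close>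

lemma sum_unity_root:
  assumes "0 < N"
  shows "(\<Sum>m<N. unity_root N ^ (m * j)) = (if N dvd j then of_nat N else 0)"
proof (cases "N dvd j")
  case True
  then obtain c where "j = N * c" by blast
  then have "unity_root N ^ (m * j) = 1" for m
    using unity_root_power_N[OF assms] by (simp add: power_mult mult.commute[of m] del: DeMoivre)
  with True show ?thesis by simp
next
  case False
  let ?z = "unity_root N ^ j"
  have "?z \<noteq> 1" using unity_root_power_eq_1[OF assms] False by blast
  moreover have "?z ^ N = 1"
    using unity_root_power_N[OF assms] by (metis mult.commute power_mult power_one)
  ultimately have "(\<Sum>m<N. ?z ^ m) = 0" by (simp add: geometric_sum)
  then show ?thesis using False by (simp add: power_mult mult.commute[of _ j] del: DeMoivre)
qed

text \<open>Transforming the product of two transforms yields, up to a factor of \<open>N\<close>, the cyclic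
  convolution in reverse order, so that no inverse transform is needed.\<close>

lemma dft_convolution:
  assumes "0 < N" "X \<subseteq> {..<N}" "Y \<subseteq> {..<N}" "\<And>i j. i \<in> X \<Longrightarrow> j \<in> Y \<Longrightarrow> i + j < N" "t < N"
  shows "(\<Sum>m<N. ((\<Sum>i<N. (if i \<in> X then 1 else 0) * unity_root N ^ (i * m)) *
      (\<Sum>j<N. (if j \<in> Y then 1 else 0) * unity_root N ^ (j * m))) *
      unity_root N ^ (m * ((N - t) mod N))) =
    of_nat (N * card {(i, j). i \<in> X \<and> j \<in> Y \<and> i + j = t})"
proof -
  let ?w = "unity_root N" and ?u = "(N - t) mod N"
  have fin: "finite X" "finite Y" using assms finite_subset by blast+
  have ind: "(\<Sum>i<N. (if i \<in> Z then 1 else 0) * f i) = sum f Z" if "Z \<subseteq> {..<N}"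
    for Z and f :: "nat \<Rightarrow> complex"
  proof -
    have "(\<Sum>i<N. (if i \<in> Z then 1 else 0) * f i) = (\<Sum>i<N. if i \<in> Z then f i else 0)"
      by (rule sum.cong) auto
    also have "\<dots> = sum f ({..<N} \<inter> Z)" by (simp add: sum.inter_restrict)
    finally show ?thesis using that by (simp add: inf.absorb2)
  qed
  \<comment> \<open>Absence of wrap-around enters here: \<open>i + j + (N - t)\<close> lies strictly
    between 0 and \<open>2 * N\<close>, so the only multiple of \<open>N\<close> it can equal is
    \<open>N\<close> itself.\<close>
  have dvd: "N dvd i + j + ?u \<longleftrightarrow> i + j = t" if "i \<in> X" "j \<in> Y" for i j
  proof -
    have lt: "i + j < N" using assms that by blast
    have "N dvd i + j + ?u \<longleftrightarrow> N dvd i + j + (N - t)"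
      by (simp add: dvd_eq_mod_eq_0 mod_add_right_eq)
    also have "\<dots> \<longleftrightarrow> i + j = t"
    proof
      assume "N dvd i + j + (N - t)"
      then obtain c where c: "i + j + (N - t) = N * c" by blast
      have "0 < N * c" "N * c < N * 2" using c lt \<open>t < N\<close> by linarith+
      then have "c = 1" using assms(1) by simp
      then show "i + j = t" using c \<open>t < N\<close> by simp
    qed (use \<open>t < N\<close> in simp)
    finally show ?thesis .
  qed
  have "(\<Sum>m<N. ((\<Sum>i<N. (if i \<in> X then 1 else 0) * ?w ^ (i * m)) *
      (\<Sum>j<N. (if j \<in> Y then 1 else 0) * ?w ^ (j * m))) * ?w ^ (m * ?u)) =
    (\<Sum>m<N. (\<Sum>i\<in>X. \<Sum>j\<in>Y. ?w ^ (m * (i + j + ?u))))"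
  proof (rule sum.cong[OF refl])
    fix m
    have "((\<Sum>i\<in>X. ?w ^ (i * m)) * (\<Sum>j\<in>Y. ?w ^ (j * m))) * ?w ^ (m * ?u)
      = (\<Sum>i\<in>X. \<Sum>j\<in>Y. ?w ^ (i * m) * ?w ^ (j * m) * ?w ^ (m * ?u))"
      by (subst sum_product) (simp only: sum_distrib_right)
    also have "\<dots> = (\<Sum>i\<in>X. \<Sum>j\<in>Y. ?w ^ (m * (i + j + ?u)))"
      by (intro sum.cong refl) (simp only: power_add[symmetric] algebra_simps)
    finally show "((\<Sum>i<N. (if i \<in> X then 1 else 0) * ?w ^ (i * m)) *
      (\<Sum>j<N. (if j \<in> Y then 1 else 0) * ?w ^ (j * m))) * ?w ^ (m * ?u) =
      (\<Sum>i\<in>X. \<Sum>j\<in>Y. ?w ^ (m * (i + j + ?u)))"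
      using assms by (simp only: ind)
  qed
  also have "\<dots> = (\<Sum>i\<in>X. \<Sum>j\<in>Y. \<Sum>m<N. ?w ^ (m * (i + j + ?u)))"
    by (subst sum.swap) (intro sum.cong refl sum.swap)
  also have "\<dots> = (\<Sum>i\<in>X. \<Sum>j\<in>Y. if i + j = t then of_nat N else 0)"
    unfolding sum_unity_root[OF assms(1)] by (intro sum.cong refl) (simp add: dvd)
  also have "\<dots> = (\<Sum>(i,j)\<in>X \<times> Y. if i + j = t then of_nat N else 0)"
    by (rule sum.cartesian_product)
  also have "\<dots> = (\<Sum>(i,j)\<in>{z \<in> X \<times> Y. fst z + snd z = t}. of_nat N)"
    using fin by (subst sum.inter_filter) (auto intro!: sum.cong)
  also have "\<dots> = of_nat (N * card {z \<in> X \<times> Y. fst z + snd z = t})"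
    by (simp add: mult.commute case_prod_unfold)
  also have "{z \<in> X \<times> Y. fst z + snd z = t} = {(i, j). i \<in> X \<and> j \<in> Y \<and> i + j = t}"
    by auto
  finally show ?thesis .
qed

section \<open>Fixed-point arithmetic\<close>

definition cint :: "int \<Rightarrow> int \<Rightarrow> complex" where
  "cint x y = Complex (of_int x) (of_int y)"

lemma cint_add: "cint (x + x') (y + y') = cint x y + cint x' y'"
  by (simp add: cint_def complex_eq_iff)

lemma cint_mult: "cint (a * c - b * d) (a * d + b * c) = cint a b * cint c d"
  by (simp add: cint_def complex_eq_iff)

lemma abs_le_norm_cint: "\<bar>real_of_int x\<bar> \<le> norm (cint x y)" "\<bar>real_of_int y\<bar> \<le> norm (cint x y)"
  using abs_Re_le_cmod[of "cint x y"] abs_Im_le_cmod[of "cint x y"] by (simp_all add: cint_def)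

lemma of_int_div_bounds:
  assumes "0 < Q"
  shows "of_int (x div Q) \<le> of_int x / (of_int Q :: real)" "of_int x / (of_int Q :: real) < of_int (x div Q) + 1"
proof -
  have "of_int (x div Q) = (of_int \<lfloor>of_int x / (of_int Q :: real)\<rfloor> :: real)"
    by (simp add: floor_divide_of_int_eq)
  then show "of_int (x div Q) \<le> of_int x / (of_int Q :: real)" "of_int x / (of_int Q :: real) < of_int (x div Q) + 1"
    by linarith+
qed

lemma norm_cint_div:
  assumes "0 < Q" shows "norm (cint (x div Q) (y div Q) - cint x y / of_int Q) \<le> 2"
proof -
  let ?z = "cint (x div Q) (y div Q) - cint x y / of_int Q"
  have "norm ?z \<le> \<bar>Re ?z\<bar> + \<bar>Im ?z\<bar>" by (rule cmod_le)
  moreover have "Re (cint x y / of_int Q) = of_int x / of_int Q" "Im (cint x y / of_int Q) = of_int y / of_int Q"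
    by (simp_all add: cint_def Re_divide_of_real[of _ "of_int Q", simplified] Im_divide_of_real[of _ "of_int Q", simplified])
  ultimately show ?thesis
    using of_int_div_bounds[OF assms, of x] of_int_div_bounds[OF assms, of y] by (simp add: cint_def)
qed

text \<open>Writing \<open>u\<close> and \<open>v\<close> as exact value plus error, the product
  divided by \<open>Q\<close> deviates by the product of the errors over \<open>Q\<close>, by each
  error times the other exact factor, and by the final rounding (at most 2). The hypothesis
  \<open>d \<le> D * Q\<close> turns the quadratic term into \<open>D * e\<close>.\<close>

lemma approx_mult:
  fixes u v U V :: complex and Q :: real
  assumes "0 < Q" "norm (u - of_real Q * U) \<le> d" "norm (v - of_real Q * V) \<le> e"
    "norm U \<le> A" "norm V \<le> B" "d \<le> D * Q"
    "norm (z - u * v / of_real Q) \<le> 2" "0 \<le> D"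
  shows "norm (z - of_real Q * (U * V)) \<le> D * e + d * B + A * e + 2"
proof -
  let ?Q = "of_real Q :: complex"
  have e0: "0 \<le> e" "0 \<le> d" "0 \<le> A"
    using assms norm_ge_zero order_trans by blast+
  have eq: "z - ?Q * (U * V) = (z - u * v / ?Q) + (u - ?Q * U) * (v - ?Q * V) / ?Q + (u - ?Q * U) * V + U * (v - ?Q * V)"
  proof -
    have "?Q \<noteq> 0" using assms(1) by simp
    have "(u - ?Q * U) * (v - ?Q * V) = u * v - ?Q * (u * V + U * v) + ?Q * (?Q * U * V)" by algebra
    then have "(u - ?Q * U) * (v - ?Q * V) / ?Q = u * v / ?Q - (u * V + U * v) + ?Q * U * V"
      using \<open>?Q \<noteq> 0\<close> by (simp add: add_divide_distrib diff_divide_distrib)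
    then show ?thesis by (simp add: algebra_simps)
  qed
  have "norm ((u - ?Q * U) * (v - ?Q * V) / ?Q) \<le> d * e / Q"
    using assms e0 by (simp add: norm_mult norm_divide divide_right_mono mult_mono)
  also have "\<dots> \<le> (D * Q) * e / Q"
    using assms e0 by (intro divide_right_mono mult_right_mono) auto
  finally have 1: "norm ((u - ?Q * U) * (v - ?Q * V) / ?Q) \<le> D * e" using assms by simp
  have 2: "norm ((u - ?Q * U) * V) \<le> d * B"
    using assms e0 by (simp add: norm_mult mult_mono)
  have 3: "norm (U * (v - ?Q * V)) \<le> A * e"
    using assms e0 by (simp add: norm_mult mult_mono)
  have "norm (a + b + c + g) \<le> norm a + norm b + norm c + norm g" for a b c g :: complex
    using norm_triangle_ineq[of "a + b + c" g] norm_triangle_ineq[of "a + b" c]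
      norm_triangle_ineq[of a b] by linarith
  from this[of "z - u * v / ?Q" "(u - ?Q * U) * (v - ?Q * V) / ?Q" "(u - ?Q * U) * V" "U * (v - ?Q * V)"]
  show ?thesis unfolding eq using assms(7) 1 2 3 by linarith
qed

text \<open>Because \<open>C\<close> is at least \<open>7/10 * R\<close>, a root that is off by more
  than 20 has a square off by at least about \<open>38 * C\<close>, more than \<open>26 * R\<close>,
  whereas \<open>y\<close> is off by at most about \<open>10 * R\<close>.\<close>

lemma approx_sqrt:
  fixes C R r y :: real
  assumes "1000 \<le> R" "7/10 * R \<le> C" "\<bar>y - C * C\<bar> \<le> 10 * R + 1"
    "0 \<le> r" "r * r \<le> y" "y < (r + 1) * (r + 1)"
  shows "\<bar>r - C\<bar> \<le> 20"
proof (rule ccontr)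
  assume "\<not> \<bar>r - C\<bar> \<le> 20"
  then consider "r > C + 20" | "r < C - 20" by linarith
  then show False
  proof cases
    case 1
    have "(C + 20) * (C + 20) \<le> r * r"
      using 1 assms(1,2,4) by (intro mult_mono) linarith+
    moreover have "(C + 20) * (C + 20) = C * C + 40 * C + 400" by (simp add: algebra_simps)
    ultimately show False using assms(1-3,5,6) unfolding abs_le_iff by linarith
  next
    case 2
    have "(r + 1) * (r + 1) \<le> (C - 19) * (C - 19)"
      using 2 assms(1,2,4) by (intro mult_mono) linarith+
    moreover have "(C - 19) * (C - 19) = C * C - 38 * C + 361" by (simp add: algebra_simps)
    ultimately show False using assms(1-3,5,6) unfolding abs_le_iff by linarith
  qed
qed

text \<open>The half-angle formula takes the square root of \<open>(1 + cos \<theta>) / 2\<close>.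
  An error of 20 in \<open>c\<close> shifts the radicand by \<open>10 * Q\<close>, and the root
  divides this by roughly \<open>2 * 7/10 * Q\<close>, so the error again stays below 20 and does
  not accumulate over repeated halving. The range of \<open>\<theta>\<close> keeps the new cosine
  above \<open>7/10\<close>; subtracting the error 20 leaves \<open>68/100\<close>, since
  \<open>Q \<ge> 1000\<close>.\<close>

lemma half_angle_cos:
  fixes Q c r :: int
  assumes "1000 \<le> Q" "\<bar>c - Q * cos \<theta>\<bar> \<le> 20" "0 \<le> \<theta>" "\<theta> \<le> pi / 2"
    "0 \<le> r" "r * r \<le> (Q * Q + Q * c) div 2" "(Q * Q + Q * c) div 2 < (r + 1) * (r + 1)"
  shows "\<bar>r - Q * cos (\<theta> / 2)\<bar> \<le> 20" "68/100 * Q \<le> r"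
proof -
  let ?C = "Q * cos (\<theta> / 2)"
  define y where "y = (Q * Q + Q * c) div 2"
  have Q: "real_of_int Q \<ge> 1000" using assms(1) by simp
  have "cos (pi / 4) \<le> cos (\<theta> / 2)" using assms by (intro cos_monotone_0_pi_le) auto
  moreover have "(7/10 :: real) \<le> sqrt 2 / 2"
    using real_le_rsqrt[of "14/10" 2] by (simp add: power2_eq_square)
  ultimately have "7/10 \<le> cos (\<theta> / 2)" by (simp add: cos_45)
  then have C7: "7/10 * real_of_int Q \<le> ?C" using Q by simp
  have "cos \<theta> = 2 * (cos (\<theta> / 2))\<^sup>2 - 1" using cos_double_cos[of "\<theta> / 2"] by simp
  then have CC: "?C * ?C = (real_of_int Q * Q + Q * (Q * cos \<theta>)) / 2"
    by (simp only: power2_eq_square) (simp add: field_simps)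
  have y: "of_int y \<le> (real_of_int Q * Q + real_of_int Q * c) / 2"
    "(real_of_int Q * Q + real_of_int Q * c) / 2 < of_int y + 1"
    using of_int_div_bounds[of 2 "Q * Q + Q * c"] by (simp_all add: y_def)
  have "\<bar>Q * (c - Q * cos \<theta>)\<bar> \<le> real_of_int Q * 20"
    unfolding abs_mult using assms Q by (intro mult_mono) auto
  note e = this
  have d: "\<bar>of_int y - ?C * ?C\<bar> \<le> 10 * real_of_int Q + 1"
  proof -
    have "\<bar>y - (a + b) / 2\<bar> \<le> 10 * R + 1"
      if "\<bar>c - b\<bar> \<le> R * 20" "y \<le> (a + c) / 2" "(a + c) / 2 < y + 1" for a b c y R :: real
      using that by (simp add: abs_le_iff field_simps)
    then show ?thesis using y e unfolding CC right_diff_distrib by blast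
  qed
  have "real_of_int (r * r) \<le> of_int y" "of_int y < real_of_int ((r + 1) * (r + 1))"
    using assms(6,7) unfolding y_def of_int_le_iff of_int_less_iff by auto
  then have r1: "real_of_int r * r \<le> of_int y" and r2: "of_int y < (real_of_int r + 1) * (real_of_int r + 1)"
    by simp_all
  show 1: "\<bar>r - ?C\<bar> \<le> 20"
    by (rule approx_sqrt[OF Q C7 d _ r1 r2]) (use assms(5) in simp)
  show "68/100 * Q \<le> r" using 1 C7 Q by linarith
qed

text \<open>Here \<open>sin (\<theta> / 2)\<close> is
  \<open>sin \<theta> / (2 * cos (\<theta> / 2))\<close>. The errors 150 of the sine and 20 of the
  cosine contribute at most \<open>150 * Q + 40 * Q\<close>; division by
  \<open>2 * r \<ge> 136/100 * Q\<close> leaves less than 149, and rounding adds 1. So 150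
  reproduces itself as well.\<close>

lemma half_angle_sin:
  fixes Q s r :: int
  assumes "1000 \<le> Q" "\<bar>s - Q * sin \<theta>\<bar> \<le> 150" "0 \<le> \<theta>" "\<theta> \<le> pi / 2"
    "\<bar>r - Q * cos (\<theta> / 2)\<bar> \<le> 20" "68/100 * Q \<le> r"
  shows "\<bar>(s * Q) div (2 * r) - Q * sin (\<theta> / 2)\<bar> \<le> 150"
proof -
  let ?X = "Q * sin (\<theta> / 2)" and ?C = "Q * cos (\<theta> / 2)"
  have Q: "real_of_int Q \<ge> 1000" using assms(1) by simp
  then have r0: "0 < real_of_int r" using assms(6) by simp
  then have r0': "0 < 2 * r" by simp
  have X: "\<bar>?X\<bar> \<le> real_of_int Q" using Q abs_sin_le_one[of "\<theta> / 2"] by (simp add: abs_mult)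
  have "sin \<theta> = 2 * sin (\<theta> / 2) * cos (\<theta> / 2)" using sin_double[of "\<theta> / 2"] by simp
  then have "?X * (2 * ?C) = Q * (Q * sin \<theta>)" by (simp only: mult_ac)
  moreover have "s * R - 2 * r * X = R * (s - R * sn) - 2 * (r - C) * X"
    if "X * (2 * C) = R * (R * sn)" for s R r X C sn :: real
    using that by (simp add: algebra_simps)
  ultimately have eq: "real_of_int s * Q - 2 * real_of_int r * ?X = Q * (s - Q * sin \<theta>) - 2 * (r - ?C) * ?X"
    by blast
  have 1: "\<bar>Q * (s - Q * sin \<theta>)\<bar> \<le> real_of_int Q * 150"
    unfolding abs_mult using assms Q by (intro mult_mono) auto
  have 2: "\<bar>2 * (r - ?C) * ?X\<bar> \<le> (2 * 20) * real_of_int Q"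
    unfolding abs_mult[of "_ * _" ?X] using assms Q X by (intro mult_mono) (auto simp: abs_mult)
  have "\<bar>real_of_int s * Q - 2 * real_of_int r * ?X\<bar> \<le> 190 * real_of_int Q" unfolding eq using 1 2 by linarith
  also have "\<dots> \<le> 149 * (2 * real_of_int r)" using assms(6) Q by linarith
  finally have "\<bar>real_of_int s * Q - 2 * real_of_int r * ?X\<bar> / (2 * real_of_int r) \<le> 149" using r0 by (simp add: divide_le_eq)
  moreover have "real_of_int s * Q / (2 * real_of_int r) - ?X = (real_of_int s * Q - 2 * real_of_int r * ?X) / (2 * real_of_int r)"
    using r0 by (simp add: field_simps)
  ultimately have "\<bar>real_of_int s * Q / (2 * real_of_int r) - ?X\<bar> \<le> 149" using r0 by (simp add: abs_divide)
  moreover have "\<bar>d - X\<bar> \<le> 150" if "\<bar>z - X\<bar> \<le> 149" "d \<le> z" "z < d + 1" for d z X :: real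
    using that by linarith
  ultimately show ?thesis using of_int_div_bounds[OF r0', of "s * Q"]
    by (simp only: of_int_mult of_int_numeral)
qed

section \<open>The roots of unity\<close>

text \<open>\<open>2 ^ K\<close> is the number of rounding levels, and \<open>6 \<le> K\<close>
  reflects \<open>\<epsilon> < 1 / 10\<close>. \<open>2 ^ qP\<close> is the length padded to a power
  of two. The summand \<open>K + 2\<close> in \<open>q\<close> makes room for
  \<open>M = 2 * 2 ^ K\<close> digit values per index and for doubling the length, so that a cyclic
  convolution of length \<open>2 ^ q\<close> does not wrap.\<close>

locale params = words +
  fixes n p K q qP :: nat
  assumes n1: "1 \<le> n" and nw: "n < 2 ^ w" and pw: "p < 2 ^ w" and K6: "6 \<le> K"
    and qw: "q \<le> 4 * w" and q_eq: "q = qP + K + 2" and nP: "n \<le> 2 ^ qP"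
begin

text \<open>\<open>M\<close> is twice the number of digits, so the sum of two digits never carries
  into the index part. \<open>S\<close>, the group size, is the square root of \<open>N\<close> up
  to a factor of at most \<open>sqrt 2\<close>. \<open>Q\<close> is the scale of the fixed-point
  numbers and equals \<open>N ^ 16\<close>.\<close>

definition "M = (2 * 2 ^ K :: nat)"
definition "N = (2 ^ q :: nat)"
definition "P = (2 ^ qP :: nat)"
definition "S = (2 ^ (q div 2) :: nat)"
definition "Q = (2 ^ (16 * q) :: int)"

definition env :: "state \<Rightarrow> bool" where
  "env s \<longleftrightarrow> reg s ''n'' = int n \<and> reg s ''p'' = int p \<and> reg s ''K'' = int K \<and>
     reg s ''M'' = int M \<and> reg s ''N'' = int N \<and> reg s ''q'' = int q \<and> reg s ''S'' = int S \<and>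
     reg s ''Q'' = Q \<and> reg s ''P'' = int P \<and> reg s ''qP'' = int qP"

definition "env_regs = {''n'', ''p'', ''K'', ''M'', ''N'', ''q'', ''S'', ''Q'', ''P'', ''qP''}"

lemma env_unchanged: "env s \<Longrightarrow> unchanged X Y s s' \<Longrightarrow> X \<inter> env_regs = {} \<Longrightarrow> env s'"
  by (auto simp: env_def env_regs_def unchanged_def)

lemma NPM: "N = 2 * P * M"
  unfolding N_def P_def M_def by (simp add: q_eq power_add)

lemma q8: "8 \<le> q" using K6 q_eq by simp

lemma N256: "256 \<le> N"
proof -
  have "(2::nat) ^ 8 \<le> 2 ^ q" using q8 by (intro power_increasing) auto
  then show ?thesis by (simp add: N_def)
qed

lemma pos [simp]: "0 < N" "0 < M" "0 < P" "0 < S" "0 < Q"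
  by (simp_all add: N_def M_def P_def S_def Q_def)

lemma Q_nonneg [simp]: "0 \<le> Q" "Q \<noteq> 0"
  by (simp_all add: Q_def)

lemma nMN: "2 * (n * M) \<le> N"
  using nP by (simp add: NPM P_def mult_right_mono)

lemma le_N: "n \<le> N" "M \<le> N" "P \<le> N" "S \<le> N" "q \<le> N" "K \<le> N" "qP \<le> N" "2 ^ K \<le> N" "16 * q + 1 \<le> N"
proof -
  have "16 * m + 1 \<le> (2::nat) ^ m" if "8 \<le> m" for m
    using that by (induction m rule: nat_induct_at_least) auto
  then show "16 * q + 1 \<le> N" using q8 by (simp only: N_def)
  have "1 * P \<le> 2 * P * M" "1 * M \<le> 2 * P * M"
    using pos(2,3) by (auto simp del: pos)
  then show P: "P \<le> N" and M: "M \<le> N" by (simp_all add: NPM)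
  show "n \<le> N" using P nP by (simp add: P_def)
  show "S \<le> N" by (simp add: S_def N_def)
  show q: "q \<le> N" by (simp add: N_def less_imp_le)
  show "K \<le> N" "qP \<le> N" using q q_eq by simp_all
  show "2 ^ K \<le> N" using M by (simp add: M_def)
qed

text \<open>With \<open>q \<le> 4 * w\<close> this is \<open>30 * 4 < 2 ^ 7\<close>. All magnitudes
  inside the transforms are kept below \<open>N ^ 20\<close>, so they are words of level 7, which
  leaves three further levels for the operations applied to them.\<close>

lemma pow_q_wd:
  assumes "a \<le> 30" shows "(2::int) ^ (a * q) < 2 ^ (2 ^ 7 * w)"
proof -
  have "a * q \<le> 30 * (4 * w)" using assms qw by (intro mult_mono) auto
  then have "a * q < 2 ^ 7 * w" using w4 by simp
  then show ?thesis by (rule power_strict_increasing) simp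
qed

lemma wd_pow_q:
  assumes "\<bar>x\<bar> \<le> 2 ^ (30 * q)" "7 \<le> k" shows "wd k x"
proof (rule wd_mono[of 7])
  show "wd 7 x" using assms(1) pow_q_wd[of 30] unfolding wd_def is_word_def by linarith
qed fact

lemma wd_Q: "7 \<le> k \<Longrightarrow> wd k Q"
  by (rule wd_pow_q) (auto simp: Q_def intro: power_increasing)

lemma wd_N: assumes "\<bar>x\<bar> \<le> int N" "3 \<le> k" shows "wd k x"
proof (rule wd_mono[of 3])
  have "q < 2 ^ 3 * w" using qw w4 by simp
  then have "(2::int) ^ q < 2 ^ (2 ^ 3 * w)" by (rule power_strict_increasing) simp
  then show "wd 3 x" using assms(1) unfolding wd_def is_word_def N_def
    by (simp only: of_nat_power of_nat_numeral)
qed fact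

lemma wd_nat: "x \<le> N \<Longrightarrow> 3 \<le> k \<Longrightarrow> wd k (int x)"
  by (rule wd_N) auto

lemma wd_p: "wd k (int p)"
proof (rule wd_mono[of 0])
  show "wd 0 (int p)" using pw unfolding wd_def is_word_def
    by (metis abs_of_nat mult_1 numeral_power_eq_of_nat_cancel_iff of_nat_less_iff power_0)
qed simp

lemmas wd_leaves = wd_Q wd_p wd_nat[OF le_N(1)] wd_nat[OF le_N(2)] wd_nat[OF le_N(3)] wd_nat[OF le_N(4)]
  wd_nat[OF le_N(5)] wd_nat[OF le_N(6)] wd_nat[OF le_N(7)] wd_nat[OF order_refl] wd_nat

lemmas wd_rules = wd_arith wd_leaves

lemma Q_ge: "1000 \<le> Q"
proof -
  have "(2::int) ^ 10 \<le> 2 ^ (16 * q)" using q8 by (intro power_increasing) auto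
  then show ?thesis by (simp add: Q_def)
qed

lemma Q_N: "real_of_int Q = real N ^ 16"
  by (simp add: Q_def N_def mult.commute flip: power_mult)

text \<open>The root is determined bit by bit from the top. Since \<open>y \<le> 2 * Q * Q\<close>,
  the root is below \<open>2 * Q = 2 ^ (F + 1)\<close> with \<open>F = 16 * q\<close>, hence the
  \<open>F + 1\<close> rounds. After \<open>b\<close> rounds the root lies between \<open>r\<close>
  and \<open>r + 2 ^ (F + 1 - b)\<close>.\<close>

definition isqrt_prog :: com where
  "isqrt_prog =
     Assign ''r'' (Const 0) ;;
     For ''b'' ''F1''
       (Assign ''t'' (Reg ''r'' \<oplus> (Const 1 \<lless> (Reg ''F'' \<ominus> Reg ''b''))) ;;
        Cond (Reg ''y'' \<prec> Reg ''t'' \<otimes> Reg ''t'') Skip (Assign ''r'' (Reg ''t'')))"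

lemma isqrt_prog:
  assumes F: "reg s ''F'' = int (16 * q)" "reg s ''F1'' = int (16 * q + 1)"
    and y: "reg s ''y'' = y" "0 \<le> y" "y \<le> 2 * Q * Q" "wd 10 y"
  shows "runs L isqrt_prog s (\<lambda>t s'. t \<le> (16 * q + 1) * 25 + 8 \<and> 0 \<le> reg s' ''r'' \<and>
     reg s' ''r'' * reg s' ''r'' \<le> y \<and> y < (reg s' ''r'' + 1) * (reg s' ''r'' + 1))"
proof -
  define Fn where "Fn = 16 * q"
  have QF: "Q = 2 ^ Fn" by (simp add: Q_def Fn_def)
  let ?I = "\<lambda>b s'. 0 \<le> reg s' ''r'' \<and> reg s' ''r'' * reg s' ''r'' \<le> y \<and>
     y < (reg s' ''r'' + 2 ^ (Fn + 1 - b)) * (reg s' ''r'' + 2 ^ (Fn + 1 - b))"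
  have FnN: "Fn \<le> N" "Fn + 1 \<le> N" using le_N(9) by (simp_all add: Fn_def)
  have loop: "runs L (For ''b'' ''F1''
       (Assign ''t'' (Reg ''r'' \<oplus> (Const 1 \<lless> (Reg ''F'' \<ominus> Reg ''b''))) ;;
        Cond (Reg ''y'' \<prec> Reg ''t'' \<otimes> Reg ''t'') Skip (Assign ''r'' (Reg ''t'')))) s1
     (\<lambda>t s'. t \<le> (Fn + 1) * 25 + 6 \<and> 0 \<le> reg s' ''r'' \<and>
     reg s' ''r'' * reg s' ''r'' \<le> y \<and> y < (reg s' ''r'' + 1) * (reg s' ''r'' + 1))"
    if s1: "reg s1 ''r'' = 0" "reg s1 ''F'' = int Fn" "reg s1 ''F1'' = int (Fn + 1)" "reg s1 ''y'' = y" for s1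
  proof (rule runs_For[where m = "Fn + 1" and T = 17 and I = ?I], goal_cases)
    case 8
    have "0 < Q * Q" using pos(5) by simp
    then have "y < 2 * Q * (2 * Q)" using y(3) by linarith
    then show ?case using s1 y by (simp add: QF)
  next
    case (9 b s')
    have b: "b \<le> Fn" using 9 by simp
    have e: "nat (int Fn - int b) = Fn - b" by simp
    have e2: "Suc Fn - b = Suc (Fn - b)" using b by simp
    have "2 ^ (Fn - b) \<le> Q" unfolding QF by (rule power_increasing) auto
    then have w2: "wd k (2 ^ (Fn - b))" if "7 \<le> k" for k
      using that by (intro wd_le[OF wd_Q]) auto
    have "reg s' ''r'' \<le> 2 * Q"
    proof (rule ccontr)
      assume "\<not> reg s' ''r'' \<le> 2 * Q"
      then have "(2 * Q) * (2 * Q) \<le> reg s' ''r'' * reg s' ''r''"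
        using 9 by (intro mult_mono) auto
      moreover have "reg s' ''r'' * reg s' ''r'' \<le> 2 * Q * Q" using 9 y by linarith
      moreover have "0 < Q * Q" using pos(5) by simp
      ultimately show False by linarith
    qed
    then have wr: "wd k (reg s' ''r'')" if "8 \<le> k" for k
      by - (rule wd_le[of k "2 * Q"]; use that 9 in \<open>simp add: wd_rules\<close>)
    have regs: "reg s' ''F'' = int Fn" "reg s' ''y'' = y"
      using 9 s1 by (auto simp: unchanged_def)
    have e3: "reg s' ''r'' + 2 * 2 ^ (Fn - b) = reg s' ''r'' + 2 ^ (Fn - b) + 2 ^ (Fn - b)" by simp
    have I: "0 \<le> reg s' ''r''" "reg s' ''r'' * reg s' ''r'' \<le> y"
      "y < (reg s' ''r'' + 2 ^ (Fn - b) + 2 ^ (Fn - b)) * (reg s' ''r'' + 2 ^ (Fn - b) + 2 ^ (Fn - b))"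
      using 9 e2 e3 by simp_all
    show ?case
      using 9(1,2) I y(4) regs b wr w2 FnN e e2
      by (simp add: wd_rules not_less)
  next
    case (10 t s')
    then show ?case by simp
  qed (use s1 wd_nat[OF FnN(2), of 10] in simp_all)
  show ?thesis
    unfolding isqrt_prog_def
    apply (simp only: runs_Seq runs_Assign)
    apply (intro conjI, simp)
    apply (rule runs_conseq[OF loop])
    using assms by (auto simp: Fn_def)
qed

definition half_angle_step :: com where
  "half_angle_step =
     Assign ''y'' ((Reg ''Q'' \<otimes> Reg ''Q'' \<oplus> Reg ''Q'' \<otimes> Reg ''c'') \<oslash> Const 2) ;;
     isqrt_prog ;;
     Assign ''s'' ((Reg ''s'' \<otimes> Reg ''Q'') \<oslash> (Const 2 \<otimes> Reg ''r'')) ;;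
     Assign ''c'' (Reg ''r'')"

text \<open>Halving starts at the right angle, whose cosine and sine \<open>0\<close> and
  \<open>Q\<close> are exact; \<open>q - 2\<close> halvings lead from \<open>pi / 2\<close> to
  \<open>2 * pi / 2 ^ q\<close>.\<close>

definition first_root_prog :: com where
  "first_root_prog =
     Assign ''F'' (Const 2 \<otimes> (Const 8 \<otimes> Reg ''q'')) ;;
     Assign ''F1'' (Reg ''F'' \<oplus> Const 1) ;;
     Assign ''q2'' (Reg ''q'' \<ominus> Const 2) ;;
     Assign ''c'' (Const 0) ;;
     Assign ''s'' (Reg ''Q'') ;;
     For ''h'' ''q2'' half_angle_step"

definition root_table_prog :: com where
  "root_table_prog =
     Store ''Wr'' (Const 0) (Reg ''Q'') ;;
     Store ''Wi'' (Const 0) (Const 0) ;;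
     For ''x'' ''N''
       (Store ''Wr'' (Reg ''x'' \<oplus> Const 1)
          ((Arr ''Wr'' (Reg ''x'') \<otimes> Reg ''c'' \<ominus> Arr ''Wi'' (Reg ''x'') \<otimes> Reg ''s'') \<oslash> Reg ''Q'') ;;
        Store ''Wi'' (Reg ''x'' \<oplus> Const 1)
          ((Arr ''Wr'' (Reg ''x'') \<otimes> Reg ''s'' \<oplus> Arr ''Wi'' (Reg ''x'') \<otimes> Reg ''c'') \<oslash> Reg ''Q''))"

lemma written_isqrt [simp]:
  "written_regs isqrt_prog = {''r'', ''b'', ''t''}" "written_arrs isqrt_prog = {}"
  by (auto simp: isqrt_prog_def)

lemma written_half_angle_step [simp]:
  "written_regs half_angle_step = {''y'', ''r'', ''b'', ''t'', ''s'', ''c''}"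
  "written_arrs half_angle_step = {}"
  by (auto simp: half_angle_step_def)

lemma wd_near:
  assumes "\<bar>real_of_int x\<bar> \<le> 2 ^ (20 * q)" "7 \<le> k" shows "wd k x"
proof (rule wd_pow_q)
  have "\<bar>x\<bar> \<le> 2 ^ (20 * q)"
    using assms(1) by (metis of_int_abs of_int_le_numeral_power_cancel_iff)
  also have "(2::int) ^ (20 * q) \<le> 2 ^ (30 * q)" by (rule power_increasing) auto
  finally show "\<bar>x\<bar> \<le> 2 ^ (30 * q)" .
qed fact

lemma real_pow_q: "2 ^ (a * q) = real N ^ a"
  by (simp add: N_def mult.commute flip: power_mult)

lemma two_Q_le: "2 * real_of_int Q \<le> 2 ^ (20 * q)"
proof -
  have "2 * real N ^ 16 \<le> real N * real N ^ 16"
    using N256 by (intro mult_right_mono) auto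
  also have "\<dots> = real N ^ 17" by (simp flip: power_Suc)
  also have "\<dots> \<le> real N ^ 20" using N256 by (intro power_increasing) auto
  finally show ?thesis by (simp add: Q_N real_pow_q)
qed

lemma wd_2Q: "\<bar>x\<bar> \<le> 2 * Q \<Longrightarrow> 7 \<le> k \<Longrightarrow> wd k x"
proof (rule wd_near)
  assume "\<bar>x\<bar> \<le> 2 * Q"
  then have "real_of_int \<bar>x\<bar> \<le> real_of_int (2 * Q)" by (rule of_int_le_iff[THEN iffD2])
  then show "\<bar>real_of_int x\<bar> \<le> 2 ^ (20 * q)" using two_Q_le by simp
qed

lemma half_angle_step:
  assumes "reg s ''Q'' = Q" "reg s ''F'' = int (16 * q)" "reg s ''F1'' = int (16 * q + 1)"
    and cs: "\<bar>reg s ''c'' - Q * cos \<theta>\<bar> \<le> 20" "\<bar>reg s ''s'' - Q * sin \<theta>\<bar> \<le> 150" "0 \<le> \<theta>" "\<theta> \<le> pi / 2"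
  shows "runs L half_angle_step s (\<lambda>t s'. t \<le> 400 * q + 70 \<and>
     \<bar>reg s' ''c'' - Q * cos (\<theta> / 2)\<bar> \<le> 20 \<and> \<bar>reg s' ''s'' - Q * sin (\<theta> / 2)\<bar> \<le> 150)"
proof -
  let ?c = "reg s ''c''" and ?s = "reg s ''s''"
  define y where "y = (Q * Q + Q * ?c) div 2"
  have Q: "1000 \<le> real_of_int Q" using Q_ge by simp
  have "0 \<le> cos \<theta>" using cs by (intro cos_ge_zero) auto
  then have "0 \<le> Q * cos \<theta>" "Q * cos \<theta> \<le> real_of_int Q" using Q by (auto simp: mult_le_cancel_left1)
  then have "-20 \<le> real_of_int ?c" "real_of_int ?c \<le> real_of_int (Q + 20)" using cs(1) unfolding abs_le_iff by (simp, simp, linarith)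
  then have c: "-20 \<le> ?c" "?c \<le> Q + 20" by linarith+
  have "\<bar>Q * sin \<theta>\<bar> \<le> real_of_int Q" using Q abs_sin_le_one[of \<theta>] by (simp add: abs_mult)
  then have "\<bar>real_of_int ?s\<bar> \<le> real_of_int (Q + 150)" using cs(2) by simp
  then have s: "\<bar>?s\<bar> \<le> Q + 150" by linarith
  have wc: "wd k ?c" "wd k ?s" if "7 \<le> k" for k
    using c s Q_ge that by (auto intro!: wd_2Q)
  have "Q * (-20) \<le> Q * ?c" "Q * ?c \<le> Q * (Q + 20)" "Q * 1000 \<le> Q * Q"
    using c Q_ge by (intro mult_left_mono; simp)+
  then have "0 \<le> Q * Q + Q * ?c" "Q * Q + Q * ?c \<le> 2 * (2 * Q * Q)"
    unfolding distrib_left by - linarith+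
  then have y: "0 \<le> y" "y \<le> 2 * Q * Q" unfolding y_def by linarith+
  have wy: "wd 10 y" unfolding y_def using wc by (simp add: wd_rules)
  show ?thesis
    unfolding half_angle_step_def
    apply (simp only: runs_Seq runs_Assign)
    apply (intro conjI)
    using assms wc apply (simp add: wd_rules)
    apply (rule runs_conseq[OF isqrt_prog[where y = y]])
    using assms y wy apply (simp_all add: y_def)[6]
    subgoal premises prems for t s'
    proof -
      let ?r = "reg s' ''r''"
      have regs: "reg s' ''Q'' = Q" "reg s' ''s'' = ?s" using prems(2) assms by (auto simp: unchanged_def)
      have r: "0 \<le> ?r" "?r * ?r \<le> (Q * Q + Q * ?c) div 2" "(Q * Q + Q * ?c) div 2 < (?r + 1) * (?r + 1)"
        using prems(1) by (simp_all add: y_def)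
      note hc = half_angle_cos[OF Q_ge cs(1,3,4) r]
      note hs = half_angle_sin[OF Q_ge cs(2-4) hc]
      have "0 < real_of_int ?r" using hc(2) Q by linarith
      then have r0: "?r \<noteq> 0" by simp
      have "Q * cos (\<theta> / 2) \<le> real_of_int Q" using Q by (simp add: mult_le_cancel_left1)
      then have "real_of_int ?r \<le> 2 * real_of_int Q" using hc(1) Q by linarith
      then have "?r \<le> 2 * Q" by linarith
      then have wr: "wd k ?r" if "7 \<le> k" for k
        using r(1) that by (intro wd_2Q) auto
      show ?thesis using prems(1) regs r0 wr wc hc(1) hs
        by (simp add: wd_rules)
    qed
    done
qed


text \<open>The table is in fact accurate up to \<open>402 * N\<close>; the cruder
  \<open>N ^ 3\<close> keeps all later error estimates in pure powers of \<open>N\<close>.\<close>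

definition roots :: "state \<Rightarrow> bool" where
  "roots s \<longleftrightarrow> (\<forall>x<N. norm (cint (arr s ''Wr'' x) (arr s ''Wi'' x) - of_int Q * unity_root N ^ x) \<le> real N ^ 3)"

lemma written_root_progs [simp]:
  "written_regs first_root_prog = {''F'', ''F1'', ''q2'', ''h'', ''y'', ''r'', ''b'', ''t'', ''s'', ''c''}"
  "written_arrs first_root_prog = {}"
  "written_regs root_table_prog = {''x''}"
  "written_arrs root_table_prog = {''Wr'', ''Wi''}"
  by (auto simp: first_root_prog_def root_table_prog_def)

lemma first_root_prog:
  assumes "env s"
  shows "runs L first_root_prog s (\<lambda>t s'. t \<le> q * (400 * q + 78) + 40 \<and>
     norm (cint (reg s' ''c'') (reg s' ''s'') - of_int Q * unity_root N) \<le> 200)"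
proof -
  let ?\<theta> = "\<lambda>h. pi / 2 / 2 ^ h"
  let ?I = "\<lambda>h s'. \<bar>reg s' ''c'' - Q * cos (?\<theta> h)\<bar> \<le> 20 \<and> \<bar>reg s' ''s'' - Q * sin (?\<theta> h)\<bar> \<le> 150"
  have loop: "runs L (For ''h'' ''q2'' half_angle_step) s1
     (\<lambda>t s'. t \<le> (q - 2) * (400 * q + 78) + 6 \<and> ?I (q - 2) s')"
    if s1: "env s1" "reg s1 ''c'' = 0" "reg s1 ''s'' = Q" "reg s1 ''F'' = int (16 * q)"
      "reg s1 ''F1'' = int (16 * q + 1)" "reg s1 ''q2'' = int (q - 2)" for s1
  proof (rule runs_For[where m = "q - 2" and T = "400 * q + 70" and I = ?I], goal_cases)
    case (9 h s')
    have th: "0 \<le> ?\<theta> h" "?\<theta> h \<le> pi / 2" by (auto simp: field_simps)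
    have half: "?\<theta> (Suc h) = ?\<theta> h / 2" by (simp add: field_simps)
    have regs: "reg s' ''Q'' = Q" "reg s' ''F'' = int (16 * q)" "reg s' ''F1'' = int (16 * q + 1)"
      using 9 s1 by (auto simp: unchanged_def env_def)
    show ?case unfolding half
      by (rule runs_conseq[OF half_angle_step[OF regs _ _ th]]) (use 9 in auto)
  next
    case 8
    show ?case using s1 by simp
  next
    case (10 t s')
    then show ?case by (simp add: algebra_simps)
  qed (use s1 le_N(5) in \<open>auto simp: wd_nat\<close>)
  have e: "q - 2 + 2 = q" using q8 by simp
  have "(2::real) ^ q = 2 ^ (q - 2 + 2)" unfolding e ..
  also have "\<dots> = 2 ^ (q - 2) * 4" by (simp only: power_add) simp
  finally have th: "?\<theta> (q - 2) = 2 * pi / real N" by (simp add: N_def)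
  have fin: "norm (cint c s - of_int Q * unity_root N) \<le> 200"
    if "\<bar>c - Q * cos (2 * pi / real N)\<bar> \<le> 20" "\<bar>s - Q * sin (2 * pi / real N)\<bar> \<le> 150" for c s
    using cmod_le[of "cint c s - of_int Q * unity_root N"] that by (simp add: cint_def)
  have le: "(q - 2) * (400 * q + 78) \<le> q * (400 * q + 78)" by (rule mult_right_mono) auto
  have wq: "wd k (int (16 * q + 1))" if "3 \<le> k" for k using wd_nat[OF le_N(9) that] .
  have wq': "wd k (16 * int q)" "wd k (8 * int q)" if "3 \<le> k" for k
    by (rule wd_le[OF wq]; use that in simp)+
  show ?thesis
    unfolding first_root_prog_def
    apply (simp only: runs_Seq runs_Assign)
    using assms wq wq' q8 apply (simp add: wd_rules env_def)
    apply (rule runs_conseq[OF loop])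
    using assms apply (simp_all add: env_def of_nat_diff)[6]
    subgoal premises prems for t s'
    proof -
      have "t \<le> (q - 2) * (400 * q + 78) + 6" using prems by blast
      then have "t \<le> q * (400 * q + 78) + 6" using le by linarith
      moreover have "norm (cint (reg s' ''c'') (reg s' ''s'') - of_int Q * unity_root N) \<le> 200"
        by (rule fin) (use prems th in simp_all)
      ultimately show ?thesis by simp
    qed
    done
qed

text \<open>Powers are formed by repeated multiplication with the first root. As both factors have
  modulus 1, the error grows only linearly: each step adds \<open>200 + 200\<close> from the error
  200 of the root and 2 from rounding.\<close>

lemma root_table_prog:
  assumes "env s" and cs: "norm (cint (reg s ''c'') (reg s ''s'') - of_int Q * unity_root N) \<le> 200"
  shows "runs L root_table_prog s (\<lambda>t s'. t \<le> N * 42 + 20 \<and> roots s')"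
proof -
  let ?w = "unity_root N" and ?c = "reg s ''c''" and ?s = "reg s ''s''"
  let ?E = "\<lambda>s' x. norm (cint (arr s' ''Wr'' x) (arr s' ''Wi'' x) - of_int Q * ?w ^ x)"
  let ?I = "\<lambda>k s'. \<forall>x\<le>k. ?E s' x \<le> 402 * real x"
  let ?body = "(Store ''Wr'' (Reg ''x'' \<oplus> Const 1)
          ((Arr ''Wr'' (Reg ''x'') \<otimes> Reg ''c'' \<ominus> Arr ''Wi'' (Reg ''x'') \<otimes> Reg ''s'') \<oslash> Reg ''Q'') ;;
        Store ''Wi'' (Reg ''x'' \<oplus> Const 1)
          ((Arr ''Wr'' (Reg ''x'') \<otimes> Reg ''s'' \<oplus> Arr ''Wi'' (Reg ''x'') \<otimes> Reg ''c'') \<oslash> Reg ''Q''))"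
  have QN: "402 * real N \<le> real N ^ 3" "real N ^ 3 \<le> real_of_int Q"
  proof -
    have "402 * real N \<le> (real N * real N) * real N"
      using mult_mono[of 256 "real N" 256 "real N"] N256 by (intro mult_right_mono) auto
    then show "402 * real N \<le> real N ^ 3" by (simp add: power3_eq_cube)
    show "real N ^ 3 \<le> real_of_int Q" unfolding Q_N using N256 by (intro power_increasing) auto
  qed
  have norm_w: "norm (?w ^ x) = 1" for x by (simp add: norm_power)
  have word: "wd k a" "wd k b" if "norm (cint a b - of_int Q * ?w ^ x) \<le> real_of_int Q" "7 \<le> k" for a b x k
  proof -
    have "norm (cint a b) \<le> norm (cint a b - of_int Q * ?w ^ x) + norm (of_int Q * ?w ^ x)"
      using norm_triangle_ineq[of "cint a b - of_int Q * ?w ^ x" "of_int Q * ?w ^ x"] by simp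
    also have "norm (of_int Q * ?w ^ x) = real_of_int Q" by (simp add: norm_mult norm_w)
    finally have "norm (cint a b) \<le> 2 * real_of_int Q" using that by simp
    then have "\<bar>real_of_int a\<bar> \<le> 2 ^ (20 * q)" "\<bar>real_of_int b\<bar> \<le> 2 ^ (20 * q)"
      using abs_le_norm_cint(1)[of a b] abs_le_norm_cint(2)[of b a] two_Q_le by - linarith+
    then show "wd k a" "wd k b" using that(2) by (auto intro: wd_near)
  qed
  have wcs: "wd k ?c" "wd k ?s" if "7 \<le> k" for k
    using word[of ?c ?s 1] cs Q_ge that by auto
  have loop: "runs L (For ''x'' ''N'' ?body) s1 (\<lambda>t s'. t \<le> N * 42 + 6 \<and> ?I N s')"
    if s1: "env s1" "reg s1 ''c'' = ?c" "reg s1 ''s'' = ?s" "arr s1 ''Wr'' 0 = Q" "arr s1 ''Wi'' 0 = 0" for s1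
  proof (rule runs_For[where m = N and T = 34 and I = ?I], goal_cases)
    case 8
    show ?case using s1 by (simp add: cint_def complex_eq_iff)
  next
    case (9 x s')
    let ?a = "arr s' ''Wr'' x" and ?b = "arr s' ''Wi'' x"
    have Ex: "?E s' x \<le> 402 * real x" using 9 by simp
    also have "\<dots> \<le> 402 * real N" using 9 by simp
    finally have Ex': "?E s' x \<le> real_of_int Q" using QN by linarith
    note wab = word[OF Ex']
    have regs: "reg s' ''c'' = ?c" "reg s' ''s'' = ?s" "reg s' ''Q'' = Q"
      using 9 s1 by (auto simp: unchanged_def env_def)
    have e: "nat (int x + 1) = Suc x" "nat (1 + int x) = Suc x" by simp_all
    let ?a' = "(?a * ?c - ?b * ?s) div Q" and ?b' = "(?a * ?s + ?b * ?c) div Q"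
    have "norm (cint ?a' ?b' - cint ?a ?b * cint ?c ?s / of_int Q) \<le> 2"
      using norm_cint_div[OF pos(5), of "?a * ?c - ?b * ?s" "?a * ?s + ?b * ?c"] by (simp only: cint_mult)
    then have "norm (cint ?a' ?b' - of_int Q * (?w ^ x * ?w)) \<le> 1 * 200 + (402 * real x) * 1 + 1 * 200 + 2"
      using approx_mult[of "real_of_int Q" "cint ?a ?b" "?w ^ x" "402 * real x" "cint ?c ?s" ?w 200 1 1 1 "cint ?a' ?b'"]
        Ex cs QN 9 \<open>norm (cint ?a' ?b' - cint ?a ?b * cint ?c ?s / of_int Q) \<le> 2\<close>
      by (simp add: norm_w)
    then have new: "norm (cint ?a' ?b' - of_int Q * ?w ^ Suc x) \<le> 402 * real (Suc x)"
      by (simp add: mult.commute algebra_simps)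
    show ?case
      using 9 regs wab wcs new
      by (auto simp: wd_rules e le_Suc_eq)
  next
    case (10 t s')
    then show ?case by simp
  qed (use s1 in \<open>auto simp: env_def wd_rules\<close>)
  show ?thesis
    unfolding root_table_prog_def
    apply (simp only: runs_Seq runs_Store)
    using assms apply (simp add: wd_rules env_def)
    apply (rule runs_conseq[OF loop])
    using assms apply (simp_all add: env_def)[5]
    subgoal premises prems for t s'
    proof -
      have "?E s' x \<le> real N ^ 3" if "x < N" for x
      proof -
        have "?E s' x \<le> 402 * real x" using prems that less_imp_le by blast
        also have "\<dots> \<le> 402 * real N" using that by simp
        finally show ?thesis using QN(1) by linarith
      qed
      then show ?thesis using prems by (simp add: roots_def)
    qed
    done
qed

end

section \<open>The fast Fourier transform\<close>

context params
begin

lemma runs_Assign_val: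
  "expr_safe L e s \<Longrightarrow> expr_val e s = v \<Longrightarrow> R (expr_cost e + 1) (s\<lparr>reg := (reg s)(x := v)\<rparr>) \<Longrightarrow>
   runs L (Assign x e) s R"
  by simp

text \<open>All levels are kept in memory: level \<open>l\<close> occupies the block starting at
  \<open>l * N\<close>, and inside it frequency \<open>k\<close> of residue class \<open>r\<close>
  has offset \<open>r * 2 ^ l + k\<close>. Thus a position \<open>x\<close> of level
  \<open>l + 1\<close> decodes to \<open>r\<close> and \<open>k\<close> by division by
  \<open>2 * h\<close>, with \<open>h = 2 ^ l\<close>, and its operands are the classes
  \<open>r\<close> and \<open>r + D\<close> at frequency \<open>k mod h\<close>. Remainders are
  spelled out because only division is an operation.\<close>

definition fft_index :: com where
  "fft_index =
     Assign ''r'' (Reg ''x'' \<oslash> (Const 2 \<otimes> Reg ''h'')) ;;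
     Assign ''k'' (Reg ''x'' \<ominus> Reg ''r'' \<otimes> (Const 2 \<otimes> Reg ''h'')) ;;
     Assign ''o'' (Reg ''l'' \<otimes> Reg ''N'' \<oplus> (Reg ''k'' \<ominus> (Reg ''k'' \<oslash> Reg ''h'') \<otimes> Reg ''h'')) ;;
     Assign ''u'' (Reg ''o'' \<oplus> Reg ''r'' \<otimes> Reg ''h'') ;;
     Assign ''v'' (Reg ''o'' \<oplus> (Reg ''r'' \<oplus> Reg ''D'') \<otimes> Reg ''h'') ;;
     Assign ''z'' (Reg ''k'' \<otimes> Reg ''D'') ;;
     Assign ''j'' ((Reg ''l'' \<oplus> Const 1) \<otimes> Reg ''N'' \<oplus> Reg ''x'')"

definition butterfly :: "string \<Rightarrow> string \<Rightarrow> com" where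
  "butterfly re im =
     Store re (Reg ''j'') (Arr re (Reg ''u'') \<oplus>
       ((Arr ''Wr'' (Reg ''z'') \<otimes> Arr re (Reg ''v'') \<ominus> Arr ''Wi'' (Reg ''z'') \<otimes> Arr im (Reg ''v'')) \<oslash> Reg ''Q'')) ;;
     Store im (Reg ''j'') (Arr im (Reg ''u'') \<oplus>
       ((Arr ''Wr'' (Reg ''z'') \<otimes> Arr im (Reg ''v'') \<oplus> Arr ''Wi'' (Reg ''z'') \<otimes> Arr re (Reg ''v'')) \<oslash> Reg ''Q''))"

definition fft_prog :: "string \<Rightarrow> string \<Rightarrow> com" where
  "fft_prog re im =
     For ''l'' ''q''
       (Assign ''h'' (Const 1 \<lless> Reg ''l'') ;;
        Assign ''D'' (Const 1 \<lless> (Reg ''q'' \<ominus> Const 1 \<ominus> Reg ''l'')) ;;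
        For ''x'' ''N'' (fft_index ;; butterfly re im))"

definition "fft_regs = {''l'', ''h'', ''D'', ''x'', ''r'', ''k'', ''o'', ''u'', ''v'', ''z'', ''j''}"

lemma written_fft [simp]:
  "written_regs fft_index = {''r'', ''k'', ''o'', ''u'', ''v'', ''z'', ''j''}"
  "written_arrs fft_index = {}"
  "written_regs (butterfly re im) = {}"
  "written_arrs (butterfly re im) = {re, im}"
  "written_regs (fft_prog re im) = fft_regs"
  "written_arrs (fft_prog re im) = {re, im}"
  by (auto simp: fft_index_def butterfly_def fft_prog_def fft_regs_def)

lemma fft_index:
  assumes "reg s ''N'' = int N" "reg s ''x'' = int x" "reg s ''l'' = int l" "reg s ''h'' = int h"
    "reg s ''D'' = int D" and x: "x < N" and l: "l < q" and h: "h = 2 ^ l" and D: "D = 2 ^ (q - 1 - l)"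
  defines "r \<equiv> x div (2 * h)" and "k \<equiv> x mod (2 * h)"
  shows "runs L fft_index s (\<lambda>t s'. t \<le> 70 \<and> reg s' ''u'' = int (l * N + (r * h + k mod h)) \<and>
    reg s' ''v'' = int (l * N + ((r + D) * h + k mod h)) \<and> reg s' ''z'' = int (k * D) \<and>
    reg s' ''j'' = int (Suc l * N + x))"
    and "r * h + k mod h < N" "(r + D) * h + k mod h < N" "k * D < N"
proof -
  have hD: "N = 2 * h * D"
  proof -
    have "q = Suc (l + (q - 1 - l))" using l by simp
    then have "(2::nat) ^ q = 2 ^ Suc (l + (q - 1 - l))" by simp
    then show ?thesis by (simp add: N_def h D power_add)
  qed
  have h0: "0 < h" by (simp add: h)
  have "r < D" using x h0 unfolding r_def hD by (simp add: less_mult_imp_div_less mult.commute)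
  have kh: "k mod h < h" "k < 2 * h" using h0 by (simp_all add: k_def)
  have "(r + D) * h + k mod h < (r + D) * h + h" using kh by simp
  also have "\<dots> = (r + D + 1) * h" by simp
  also have "\<dots> \<le> (2 * D) * h" using \<open>r < D\<close> by (intro mult_right_mono) auto
  finally show v: "(r + D) * h + k mod h < N" by (simp add: hD mult_ac)
  then show "r * h + k mod h < N" by (simp add: algebra_simps)
  show "k * D < N" using kh D by (simp add: hD)
  have le: "h \<le> N" "D \<le> N" "r \<le> N" "k \<le> N" "k mod h \<le> N" "x \<le> N" "l \<le> N"
  proof -
    show "h \<le> N" "D \<le> N" using h0 by (auto simp: hD D)
    then show "r \<le> N" using \<open>r < D\<close> by simp
    show "k \<le> N" "x \<le> N" using x by (auto simp: k_def intro: order_trans[OF mod_less_eq_dividend])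
    then show "k mod h \<le> N" by (meson mod_less_eq_dividend order_trans)
    show "l \<le> N" using l le_N(5) by simp
  qed
  have e1: "int x div (2 * int h) = int r" by (simp add: r_def zdiv_int)
  have e2: "int x - int r * (2 * int h) = int k"
    unfolding r_def k_def by (simp add: minus_div_mult_eq_mod zdiv_int zmod_int)
  have e3: "int k - int k div int h * int h = int (k mod h)"
    by (simp add: minus_div_mult_eq_mod zmod_int)
  have w: "wd a (int h)" "wd a (int D)" "wd a (int r)" "wd a (int k)" "wd a (int (k mod h))" "wd a (int x)" "wd a (int l)"
    if "3 \<le> a" for a using that le by (auto intro!: wd_nat)
  show "runs L fft_index s (\<lambda>t s'. t \<le> 70 \<and> reg s' ''u'' = int (l * N + (r * h + k mod h)) \<and>
    reg s' ''v'' = int (l * N + ((r + D) * h + k mod h)) \<and> reg s' ''z'' = int (k * D) \<and>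
    reg s' ''j'' = int (Suc l * N + x))"
    unfolding fft_index_def runs_Seq
    apply (rule runs_Assign_val[where v = "int r"])
      apply (use h0 in \<open>simp add: assms(1-5) w wd_rules\<close>)
     apply (simp add: assms(1-5) e1)
    apply (rule runs_Assign_val[where v = "int k"])
      apply (simp add: assms(1-5) w wd_rules)
     apply (simp add: assms(1-5) e2[simplified])
    apply (rule runs_Assign_val[where v = "int (l * N + k mod h)"])
      apply (use h0 in \<open>simp add: assms(1-5) w wd_rules\<close>)
     apply (simp add: assms(1-5) e3[simplified])
    apply (rule runs_Assign_val[where v = "int (l * N + (r * h + k mod h))"])
      apply (use w in \<open>simp add: assms(1-5) wd_rules\<close>)
     apply (simp add: assms(1-5))
    apply (rule runs_Assign_val[where v = "int (l * N + ((r + D) * h + k mod h))"])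
      apply (use w in \<open>simp add: assms(1-5) wd_rules\<close>)
     apply (simp add: assms(1-5))
    apply (rule runs_Assign_val[where v = "int (k * D)"])
      apply (use w in \<open>simp add: assms(1-5) wd_rules\<close>)
     apply (simp add: assms(1-5))
    apply (rule runs_Assign_val[where v = "int (Suc l * N + x)"])
      apply (use w in \<open>simp add: assms(1-5) wd_rules\<close>)
     apply (simp add: assms(1-5) algebra_simps)
    by simp
qed

text \<open>A butterfly takes an error \<open>E\<close> to at most
  \<open>3 * E + N ^ 4 * B + 2\<close>, where \<open>N ^ 4 * B\<close> comes from the error
  \<open>N ^ 3\<close> of the twiddle factor times a value of size \<open>N * B\<close>. With
  \<open>X = e + N ^ 4 * B + 2\<close> this stays below \<open>4 ^ l * X\<close> on level
  \<open>l\<close>, and \<open>4 ^ q = N ^ 2\<close>. The hypothesis \<open>size\<close> ensures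
  that all intermediate values remain words.\<close>

lemma fft_prog:
  assumes env: "env s" and roots: "roots s"
    and names: "re \<noteq> im" "re \<notin> {''Wr'', ''Wi''}" "im \<notin> {''Wr'', ''Wi''}"
    and inp: "\<And>x. x < N \<Longrightarrow> norm (cint (arr s re x) (arr s im x) - of_int Q * f x) \<le> e"
    and f: "\<And>j. norm (f j) \<le> B" and B: "0 \<le> B" and e: "0 \<le> e"
    and size: "real_of_int Q * (real N * B) + real N ^ 2 * (e + real N ^ 4 * B + 2) \<le> 2 ^ (20 * q)"
  shows "runs L (fft_prog re im) s (\<lambda>t s'. t \<le> q * (N * 120 + 40) + 6 \<and>
     (\<forall>x<N. norm (cint (arr s' re (q * N + x)) (arr s' im (q * N + x)) -
        of_int Q * (\<Sum>m<N. f m * unity_root N ^ (m * x))) \<le> real N ^ 2 * (e + real N ^ 4 * B + 2)))"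
proof -
  let ?w = "unity_root N"
  have names': "im \<noteq> re" "''Wr'' \<noteq> re" "''Wi'' \<noteq> re" "''Wr'' \<noteq> im" "''Wi'' \<noteq> im" using names by auto
  define X where "X = e + real N ^ 4 * B + 2"
  have X0: "0 \<le> X" using B e by (simp add: X_def)
  define E where "E l s' x \<longleftrightarrow> norm (cint (arr s' re (l * N + x)) (arr s' im (l * N + x)) -
     of_int Q * dft_level ?w q f l (x div 2 ^ l) (x mod 2 ^ l)) \<le> 4 ^ l * X" for l x and s' :: state
  have wN: "?w ^ (2 ^ q) = 1" using unity_root_power_N[OF pos(1)] by (simp only: N_def)
  have dft_le: "norm (dft_level ?w q f l a b) \<le> real N * B" if "l \<le> q" for l a b
    using norm_dft_level_le[of ?w f B l q a b] f B that by (simp add: N_def)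
  have four: "4 ^ l * X \<le> real N ^ 2 * X" if "l \<le> q" for l
  proof -
    have "(4::real) ^ l \<le> 4 ^ q" using that by (rule power_increasing) simp
    also have "\<dots> = (2 ^ 2) ^ q" by simp
    also have "\<dots> = real N ^ 2" unfolding N_def of_nat_power of_nat_numeral
      by (simp only: mult.commute flip: power_mult)
    finally show ?thesis using X0 by (rule mult_right_mono)
  qed
  have word: "wd a (arr s' re (l * N + x))" "wd a (arr s' im (l * N + x))"
    if "E l s' x" "l \<le> q" "7 \<le> a" for l s' x a
  proof -
    let ?z = "cint (arr s' re (l * N + x)) (arr s' im (l * N + x))"
    let ?d = "of_int Q * dft_level ?w q f l (x div 2 ^ l) (x mod 2 ^ l)"
    have "norm ?z \<le> norm ?d + norm (?z - ?d)"
      using norm_triangle_ineq[of ?d "?z - ?d"] by simp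
    also have "norm ?d \<le> real_of_int Q * (real N * B)"
      using dft_le[OF that(2)] by (simp add: norm_mult mult_left_mono)
    also have "norm (?z - ?d) \<le> real N ^ 2 * X"
      using that(1) four[OF that(2)] unfolding E_def by linarith
    finally have "norm ?z \<le> 2 ^ (20 * q)" using size unfolding X_def by linarith
    then have "\<bar>real_of_int (arr s' re (l * N + x))\<bar> \<le> 2 ^ (20 * q)" "\<bar>real_of_int (arr s' im (l * N + x))\<bar> \<le> 2 ^ (20 * q)"
      using abs_le_norm_cint[of "arr s' re (l * N + x)"] abs_le_norm_cint[of "arr s' im (l * N + x)"] order_trans by blast+
    then show "wd a (arr s' re (l * N + x))" "wd a (arr s' im (l * N + x))"
      using that(3) by (auto intro: wd_near)
  qed
  have N3: "real N ^ 3 \<le> real_of_int Q" unfolding Q_N using N256 by (intro power_increasing) auto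
  have norm_w: "norm (?w ^ x) = 1" for x by (simp add: norm_power)
  have W: "norm (cint (arr s ''Wr'' z) (arr s ''Wi'' z) - of_int Q * ?w ^ z) \<le> real N ^ 3" if "z < N" for z
    using roots that unfolding roots_def by blast
  have wW: "wd a (arr s ''Wr'' z)" "wd a (arr s ''Wi'' z)" if "z < N" "7 \<le> a" for z a
  proof -
    let ?z = "cint (arr s ''Wr'' z) (arr s ''Wi'' z)" and ?d = "of_int Q * ?w ^ z"
    have "norm ?z \<le> norm ?d + norm (?z - ?d)"
      using norm_triangle_ineq[of ?d "?z - ?d"] by simp
    also have "\<dots> \<le> 2 * real_of_int Q" using W[OF that(1)] N3 by (simp add: norm_mult norm_w)
    finally have "norm ?z \<le> 2 ^ (20 * q)" using two_Q_le by linarith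
    then have "\<bar>real_of_int (arr s ''Wr'' z)\<bar> \<le> 2 ^ (20 * q)" "\<bar>real_of_int (arr s ''Wi'' z)\<bar> \<le> 2 ^ (20 * q)"
      using abs_le_norm_cint[of "arr s ''Wr'' z"] abs_le_norm_cint[of "arr s ''Wi'' z"] order_trans by blast+
    then show "wd a (arr s ''Wr'' z)" "wd a (arr s ''Wi'' z)" using that(2) by (auto intro: wd_near)
  qed
  have inner: "runs L (For ''x'' ''N'' (fft_index ;; butterfly re im)) s1
      (\<lambda>t s'. t \<le> N * 120 + 6 \<and> (\<forall>x<N. E (Suc l) s' x))"
    if s1: "env s1" "reg s1 ''l'' = int l" "reg s1 ''h'' = int h" "reg s1 ''D'' = int D"
      "arr s1 ''Wr'' = arr s ''Wr''" "arr s1 ''Wi'' = arr s ''Wi''" "\<forall>x<N. E l s1 x"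
      and l: "l < q" and h: "h = 2 ^ l" and D: "D = 2 ^ (q - 1 - l)" for s1 l h D
  proof (rule runs_For[where m = N and T = 112 and I = "\<lambda>m s'. (\<forall>x<N. E l s' x) \<and> (\<forall>x<m. E (Suc l) s' x)"], goal_cases)
    case 8
    show ?case using s1 by simp
  next
    case 7
    then show ?case by (simp add: E_def)
  next
    case (9 x s')
    define r k where "r = x div (2 * h)" and "k = x mod (2 * h)"
    define u v where "u = r * h + k mod h" and "v = (r + D) * h + k mod h"
    have regs: "reg s' ''N'' = int N" "reg s' ''x'' = int x" "reg s' ''l'' = int l" "reg s' ''h'' = int h"
      "reg s' ''D'' = int D" "reg s' ''Q'' = Q"
      using 9(2) unchanged_reg[OF 9(4)] s1(1-4) by (simp_all add: env_def)
    have WW: "arr s' ''Wr'' = arr s ''Wr''" "arr s' ''Wi'' = arr s ''Wi''"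
      using unchanged_arr[OF 9(4), of "''Wr''"] unchanged_arr[OF 9(4), of "''Wi''"] names s1(5,6) by auto
    note idx = fft_index[OF regs(1-5) 9(1) l h D, folded r_def k_def, folded u_def v_def]
    have h0: "0 < h" by (simp add: h)
    let ?c = "cint (arr s' re (l * N + v)) (arr s' im (l * N + v))"
    let ?b = "cint (arr s' re (l * N + u)) (arr s' im (l * N + u))"
    let ?W = "cint (arr s ''Wr'' (k * D)) (arr s ''Wi'' (k * D))"
    let ?dre = "(arr s ''Wr'' (k * D) * arr s' re (l * N + v) - arr s ''Wi'' (k * D) * arr s' im (l * N + v)) div Q"
    let ?dim = "(arr s ''Wr'' (k * D) * arr s' im (l * N + v) + arr s ''Wi'' (k * D) * arr s' re (l * N + v)) div Q"
    have Eu: "E l s' u" and Ev: "E l s' v" using 9 idx by auto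
    have um: "u div 2 ^ l = r" "u mod 2 ^ l = k mod h" "v div 2 ^ l = r + D" "v mod 2 ^ l = k mod h"
      using h0 by (simp_all add: u_def v_def h)
    have "norm (cint ?dre ?dim - ?W * ?c / of_int Q) \<le> 2"
      unfolding cint_mult[symmetric] by (rule norm_cint_div[OF pos(5)])
    then have n1: "norm (cint ?dre ?dim - of_int Q * (?w ^ (k * D) * dft_level ?w q f l (r + D) (k mod h)))
        \<le> 1 * (4 ^ l * X) + real N ^ 3 * (real N * B) + 1 * (4 ^ l * X) + 2"
      using approx_mult[of "real_of_int Q" ?W "?w ^ (k * D)" "real N ^ 3" ?c "dft_level ?w q f l (r + D) (k mod h)" "4 ^ l * X"
        1 "real N * B" 1 "cint ?dre ?dim"] W[OF idx(4)] Ev[unfolded E_def um] dft_le[of l] l N3 norm_w[of "k * D"]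
      by simp
    have n2: "norm (?b - of_int Q * dft_level ?w q f l r (k mod h)) \<le> 4 ^ l * X"
      using Eu[unfolded E_def um] .
    have tri: "norm (a + c - of_int Q * (a' + c')) \<le> norm (a - of_int Q * a') + norm (c - of_int Q * c')"
      for a a' c c' :: complex
      using norm_triangle_ineq[of "a - of_int Q * a'" "c - of_int Q * c'"] by (simp add: algebra_simps)
    have "norm (?b + cint ?dre ?dim - of_int Q * (dft_level ?w q f l r (k mod h) + ?w ^ (k * D) * dft_level ?w q f l (r + D) (k mod h)))
       \<le> 4 ^ l * X + (4 ^ l * X + real N ^ 3 * (real N * B) + 4 ^ l * X + 2)"
      using n1 n2 tri[of ?b "cint ?dre ?dim" "dft_level ?w q f l r (k mod h)"
        "?w ^ (k * D) * dft_level ?w q f l (r + D) (k mod h)"] by linarith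
    also have "dft_level ?w q f l r (k mod h) + ?w ^ (k * D) * dft_level ?w q f l (r + D) (k mod h) =
        dft_level ?w q f (Suc l) r k"
      using dft_level_Suc[OF wN l, of f r k] by (simp only: h D)
    also have "4 ^ l * X + (4 ^ l * X + real N ^ 3 * (real N * B) + 4 ^ l * X + 2) \<le> 4 ^ Suc l * X"
    proof -
      have "1 * X \<le> 4 ^ l * X" using X0 by (intro mult_right_mono) auto
      moreover have "real N ^ 3 * (real N * B) + 2 \<le> X" using e by (simp add: X_def power_numeral_reduce)
      ultimately show ?thesis unfolding power_Suc by linarith
    qed
    finally have new: "norm (cint (arr s' re (l * N + u) + ?dre) (arr s' im (l * N + u) + ?dim)
       - of_int Q * dft_level ?w q f (Suc l) r k) \<le> 4 ^ Suc l * X"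
      by (simp only: cint_add)
    have rk: "x div 2 ^ Suc l = r" "x mod 2 ^ Suc l = k" by (simp_all add: r_def k_def h)
    \<comment> \<open>Different levels live in disjoint blocks, so filling level
      \<open>Suc l\<close> never destroys an operand on level \<open>l\<close>.\<close>
    have neq: "l * N + y \<noteq> Suc l * N + x" if "y < N" for y using that by simp
    note wv = word[OF Ev less_imp_le[OF l]] word[OF Eu less_imp_le[OF l]] wW[OF idx(4)]
    have ww: "wd 10 (int (l * N + u))" "wd 10 (int (l * N + v))" "wd 10 (int (k * D))" "wd 10 (int (Suc l * N + x))"
    proof -
      show "wd 10 (int (k * D))" using idx(4) by (intro wd_nat) auto
    qed (use idx(2,3) 9(1) l le_N(5) in \<open>simp_all add: wd_rules\<close>)
    show ?case
      unfolding runs_Seq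
    proof (rule runs_conseq[OF idx(1)])
      fix t1 :: nat and s2 :: state
      assume a: "t1 \<le> 70 \<and> reg s2 ''u'' = int (l * N + u) \<and>
         reg s2 ''v'' = int (l * N + v) \<and> reg s2 ''z'' = int (k * D) \<and>
         reg s2 ''j'' = int (Suc l * N + x)"
        and un: "unchanged (written_regs fft_index) (written_arrs fft_index) s' s2"
      have ar: "arr s2 = arr s'" and Q2: "reg s2 ''Q'' = Q" using un regs by (auto simp: unchanged_def)
      let ?s3 = "s2\<lparr>arr := (arr s')(re := (arr s' re)(Suc l * N + x := arr s' re (l * N + u) + ?dre),
           im := (arr s' im)(Suc l * N + x := arr s' im (l * N + u) + ?dim))\<rparr>"
      have bf: "runs L (butterfly re im) s2 (\<lambda>t s''. t = 36 \<and> s'' = ?s3)"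
        unfolding butterfly_def using a names names' neq[OF idx(2)] neq[OF idx(3)]
        by (simp add: ar Q2 WW wv ww wd_rules del: of_nat_add of_nat_mult mult_Suc of_nat_Suc)
      show "runs L (butterfly re im) s2 (\<lambda>t2 s''. t1 + t2 \<le> 112 \<and>
          (\<forall>x<N. E l s'' x) \<and> (\<forall>x'<Suc x. E (Suc l) s'' x'))"
      proof (rule runs_conseq[OF bf])
        fix t2 :: nat and s'' :: state
        assume "t2 = 36 \<and> s'' = ?s3"
        then have t2: "t2 = 36" and s'': "s'' = ?s3" by auto
        have "E l s'' y" if "y < N" for y
          using 9(3) that neq[OF that] names unfolding s'' E_def by simp
        moreover have "E (Suc l) s'' y" if "y < Suc x" for y
        proof (cases "y = x")
          case True
          then show ?thesis using new names unfolding s'' E_def rk[symmetric] by simp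
        next
          case False
          then show ?thesis using 9(3) that names unfolding s'' E_def by simp
        qed
        ultimately show "t1 + t2 \<le> 112 \<and> (\<forall>x<N. E l s'' x) \<and> (\<forall>x'<Suc x. E (Suc l) s'' x')"
          using a t2 by simp
      qed
    qed
  next
    case (10 t s')
    then show ?case by simp
  qed (use s1 in \<open>auto simp: env_def wd_rules\<close>)
  have outer: "runs L (fft_prog re im) s (\<lambda>t s'. t \<le> q * (N * 120 + 40) + 6 \<and> (\<forall>x<N. E q s' x))"
    unfolding fft_prog_def
  proof (rule runs_For[where m = q and T = "N * 120 + 32" and I = "\<lambda>l s'. \<forall>x<N. E l s' x"], goal_cases)
    case 7
    then show ?case by (simp add: E_def)
  next
    case 8
    have "e \<le> X" using B by (simp add: X_def)
    then show ?case using inp by (auto simp: E_def intro: order_trans)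
  next
    case (9 l s')
    have l: "l < q" using 9 by simp
    have env': "env s'" by (rule env_unchanged[OF env 9(4)]) (auto simp: env_regs_def fft_regs_def)
    have ex: "nat (int q - 1 - int l) = q - 1 - l" using l by linarith
    have pw: "2 ^ l \<le> N" "2 ^ (q - 1 - l) \<le> N" using l unfolding N_def by (auto intro!: power_increasing)
    have wpw: "wd a (2 ^ l)" "wd a (2 ^ (q - 1 - l))" "wd a (int l)" if "3 \<le> a" for a
      using wd_nat[OF pw(1) that] wd_nat[OF pw(2) that] wd_nat[of l a] l le_N(5) that by simp_all
    have arrs: "arr s' ''Wr'' = arr s ''Wr''" "arr s' ''Wi'' = arr s ''Wi''"
      using unchanged_arr[OF 9(4), of "''Wr''"] unchanged_arr[OF 9(4), of "''Wi''"] names by auto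
    let ?s2 = "s'\<lparr>reg := (reg s')(''h'' := int (2 ^ l), ''D'' := int (2 ^ (q - 1 - l)))\<rparr>"
    have "runs L (For ''x'' ''N'' (fft_index ;; butterfly re im)) ?s2
      (\<lambda>t s'. t \<le> N * 120 + 6 \<and> (\<forall>x<N. E (Suc l) s' x))"
      by (rule inner[OF _ _ _ _ _ _ _ l refl refl]) (use 9 env' arrs in \<open>auto simp: env_def E_def\<close>)
    note in2 = this
    show ?case
      unfolding runs_Seq runs_Assign
      using env' 9(2) l wpw
      apply (simp add: env_def wd_rules ex)
      apply (rule runs_conseq[OF in2[simplified]])
      apply simp
      done
  next
    case (10 t s')
    then show ?case by (simp add: algebra_simps)
  qed (use env in \<open>auto simp: env_def wd_rules\<close>)
  show ?thesis
  proof (rule runs_conseq[OF outer], goal_cases)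
    case (1 t s')
    have "norm (cint (arr s' re (q * N + x)) (arr s' im (q * N + x)) -
        of_int Q * (\<Sum>m<N. f m * ?w ^ (m * x))) \<le> real N ^ 2 * X" if "x < N" for x
    proof -
      have "x div 2 ^ q = 0" "x mod 2 ^ q = x" using that by (simp_all add: N_def)
      then have "norm (cint (arr s' re (q * N + x)) (arr s' im (q * N + x)) -
         of_int Q * dft_level ?w q f q 0 x) \<le> 4 ^ q * X"
        using 1(1) that unfolding E_def by metis
      also have "dft_level ?w q f q 0 x = (\<Sum>m<N. f m * ?w ^ (m * x))"
        unfolding dft_level_top N_def ..
      finally show ?thesis using four[of q] by linarith
    qed
    then show ?case using 1(1) unfolding X_def by blast
  qed
qed

end

section \<open>Boolean convolution by three transforms\<close>

context params
begin

text \<open>The error budget behind \<open>Q = N ^ 16\<close>. The bounds concern, in this order: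
  magnitudes in the transform of a 0/1 vector, its error, the error after pointwise multiplication,
  magnitudes in the last transform (whose input is bounded by \<open>N ^ 2\<close>), its error
  staying below half of \<open>Q * N\<close>, and the side condition of \<open>approx_mult\<close>
  for the product.\<close>

lemma power_N_bounds:
  defines "x \<equiv> real N"
  shows "x ^ 16 * (x * 1) + x ^ 2 * (0 + x ^ 4 * 1 + 2) \<le> 2 ^ (20 * q)"
    "x ^ 2 * (0 + x ^ 4 * 1 + 2) \<le> x ^ 7"
    "1 * x ^ 7 + x ^ 7 * x + x * x ^ 7 + 2 \<le> x ^ 9"
    "x ^ 16 * (x * x ^ 2) + x ^ 2 * (x ^ 9 + x ^ 4 * x ^ 2 + 2) \<le> 2 ^ (20 * q)"
    "2 * (x ^ 2 * (x ^ 9 + x ^ 4 * x ^ 2 + 2)) < x ^ 16 * x"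
    "x ^ 7 \<le> 1 * x ^ 16"
proof -
  have x: "256 \<le> x" using N256 by (simp add: x_def)
  have up: "256 * x ^ a \<le> x ^ b" if "a < b" for a b
  proof -
    have "256 * x ^ a \<le> x * x ^ a" using x by (intro mult_right_mono) auto
    also have "\<dots> = x ^ Suc a" by simp
    also have "\<dots> \<le> x ^ b" using x that by (intro power_increasing) auto
    finally show ?thesis .
  qed
  have nn: "0 \<le> x ^ a" for a using x by simp
  have sq: "256 * 1 \<le> x ^ 2" using up[of 0 2] by simp
  have 20: "2 ^ (20 * q) = x ^ 20" by (simp only: real_pow_q x_def)
  have m1: "x ^ 16 * (x * 1) = x ^ 17" "x ^ 2 * (0 + x ^ 4 * 1 + 2) = x ^ 6 + 2 * x ^ 2"
    "x ^ 7 * x = x ^ 8" "x * x ^ 7 = x ^ 8" "x ^ 16 * (x * x ^ 2) = x ^ 19" "x ^ 16 * x = x ^ 17"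
    "x ^ 2 * (x ^ 9 + x ^ 4 * x ^ 2 + 2) = x ^ 11 + x ^ 8 + 2 * x ^ 2"
    by (simp_all add: distrib_left power_numeral_reduce)
  show "x ^ 16 * (x * 1) + x ^ 2 * (0 + x ^ 4 * 1 + 2) \<le> 2 ^ (20 * q)"
    unfolding 20 m1 using up[of 17 20] up[of 6 20] up[of 2 20] nn[of 20] by linarith
  show "x ^ 2 * (0 + x ^ 4 * 1 + 2) \<le> x ^ 7"
    unfolding m1 using up[of 6 7] up[of 2 7] nn[of 7] by linarith
  show "1 * x ^ 7 + x ^ 7 * x + x * x ^ 7 + 2 \<le> x ^ 9"
    unfolding m1 using up[of 7 9] up[of 8 9] up[of 2 9] sq nn[of 9] by linarith
  show "x ^ 16 * (x * x ^ 2) + x ^ 2 * (x ^ 9 + x ^ 4 * x ^ 2 + 2) \<le> 2 ^ (20 * q)"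
    unfolding 20 m1 using up[of 19 20] up[of 11 20] up[of 8 20] up[of 2 20] nn[of 20] by linarith
  show "2 * (x ^ 2 * (x ^ 9 + x ^ 4 * x ^ 2 + 2)) < x ^ 16 * x"
  proof -
    have "256 * x ^ 11 \<le> x ^ 17" "256 * x ^ 8 \<le> x ^ 17" "256 * x ^ 2 \<le> x ^ 17" "256 * x ^ 0 \<le> x ^ 17"
      by (rule up; simp)+
    moreover have "2 * (a + b + 2 * c) < d" if "256 * a \<le> d" "256 * b \<le> d" "256 * c \<le> d" "256 * 1 \<le> d"
      for a b c d :: real using that by argo
    ultimately show ?thesis unfolding m1 power_0 by blast
  qed
  show "x ^ 7 \<le> 1 * x ^ 16" using up[of 7 16] nn[of 7] by linarith
qed

definition product_prog :: com where
  "product_prog =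
     For ''x'' ''N''
       (Assign ''u'' (Reg ''q'' \<otimes> Reg ''N'' \<oplus> Reg ''x'') ;;
        Store ''cr'' (Reg ''x'') ((Arr ''ar'' (Reg ''u'') \<otimes> Arr ''br'' (Reg ''u'') \<ominus>
          Arr ''ai'' (Reg ''u'') \<otimes> Arr ''bi'' (Reg ''u'')) \<oslash> Reg ''Q'') ;;
        Store ''ci'' (Reg ''x'') ((Arr ''ar'' (Reg ''u'') \<otimes> Arr ''bi'' (Reg ''u'') \<oplus>
          Arr ''ai'' (Reg ''u'') \<otimes> Arr ''br'' (Reg ''u'')) \<oslash> Reg ''Q''))"

definition conv_prog :: com where
  "conv_prog = fft_prog ''ar'' ''ai'' ;; fft_prog ''br'' ''bi'' ;; product_prog ;; fft_prog ''cr'' ''ci''"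

lemma written_conv [simp]:
  "written_regs product_prog = {''x'', ''u''}"
  "written_arrs product_prog = {''cr'', ''ci''}"
  "written_regs conv_prog = fft_regs"
  "written_arrs conv_prog = {''ar'', ''ai'', ''br'', ''bi'', ''cr'', ''ci''}"
  by (auto simp: product_prog_def conv_prog_def fft_regs_def)

lemma product_prog:
  assumes env: "env s"
    and wds: "\<And>x. x < N \<Longrightarrow> wd 7 (arr s ''ar'' (q * N + x)) \<and> wd 7 (arr s ''ai'' (q * N + x)) \<and>
      wd 7 (arr s ''br'' (q * N + x)) \<and> wd 7 (arr s ''bi'' (q * N + x))"
  shows "runs L product_prog s (\<lambda>t s'. t \<le> N * 60 + 6 \<and>
    (\<forall>x<N. norm (cint (arr s' ''cr'' x) (arr s' ''ci'' x) -
      cint (arr s ''ar'' (q * N + x)) (arr s ''ai'' (q * N + x)) *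
      cint (arr s ''br'' (q * N + x)) (arr s ''bi'' (q * N + x)) / of_int Q) \<le> 2))"
  unfolding product_prog_def
proof (rule runs_For[where m = N and T = 52 and I = "\<lambda>m s'. \<forall>x<m. norm (cint (arr s' ''cr'' x) (arr s' ''ci'' x) -
      cint (arr s ''ar'' (q * N + x)) (arr s ''ai'' (q * N + x)) *
      cint (arr s ''br'' (q * N + x)) (arr s ''bi'' (q * N + x)) / of_int Q) \<le> 2"], goal_cases)
  case (9 x s')
  have regs: "reg s' ''q'' = int q" "reg s' ''N'' = int N" "reg s' ''Q'' = Q"
    using unchanged_reg[OF 9(4)] env by (simp_all add: env_def)
  have arrs: "arr s' ''ar'' = arr s ''ar''" "arr s' ''ai'' = arr s ''ai''" "arr s' ''br'' = arr s ''br''" "arr s' ''bi'' = arr s ''bi''"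
    using unchanged_arr[OF 9(4)] by simp_all
  have idx: "nat (int q * int N + int x) = q * N + x" by (simp flip: of_nat_mult of_nat_add)
  have w: "wd k (arr s ''ar'' (q * N + x))" "wd k (arr s ''ai'' (q * N + x))"
      "wd k (arr s ''br'' (q * N + x))" "wd k (arr s ''bi'' (q * N + x))" if "7 \<le> k" for k
    using wds[OF 9(1)] wd_mono[OF _ that] by auto
  have new: "norm (cint ((a * c - b * d) div Q) ((a * d + b * c) div Q) - cint a b * cint c d / of_int Q) \<le> 2" for a b c d
    unfolding cint_mult[symmetric] by (rule norm_cint_div[OF pos(5)])
  show ?case
    using 9(1-3) by (auto simp: regs arrs idx w wd_rules less_Suc_eq new)
qed (use env in \<open>auto simp: env_def wd_rules\<close>)

lemma wd_approx:
  assumes "norm (cint a b - of_int Q * z) \<le> e" "norm z \<le> B" "real_of_int Q * B + e \<le> 2 ^ (20 * q)" "7 \<le> k"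
  shows "wd k a" "wd k b"
proof -
  have "norm (cint a b) \<le> norm (of_int Q * z) + norm (cint a b - of_int Q * z)"
    using norm_triangle_ineq[of "of_int Q * z" "cint a b - of_int Q * z"] by simp
  also have "norm (of_int Q * z) \<le> real_of_int Q * B"
    using assms(2) by (simp add: norm_mult mult_left_mono)
  finally have "norm (cint a b) \<le> 2 ^ (20 * q)" using assms(1,3) by linarith
  then have "\<bar>real_of_int a\<bar> \<le> 2 ^ (20 * q)" "\<bar>real_of_int b\<bar> \<le> 2 ^ (20 * q)"
    using abs_le_norm_cint(1)[of a b] abs_le_norm_cint(2)[of b a] by - linarith+
  then show "wd k a" "wd k b" using assms(4) by (auto intro: wd_near)
qed

text \<open>Up to an error below \<open>Q * N / 2\<close>, the value read for \<open>t\<close> is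
  \<open>Q * N\<close> times the number of representations of \<open>t\<close>. Comparing twice that
  value with \<open>Q * N\<close> therefore decides exactly whether a representation exists. The
  index \<open>(N - t) mod N\<close> undoes the reversal caused by transforming forward
  twice.\<close>

lemma conv_prog:
  assumes env: "env s" and roots: "roots s"
    and XY: "X \<subseteq> {..<N}" "Y \<subseteq> {..<N}" "\<And>i j. i \<in> X \<Longrightarrow> j \<in> Y \<Longrightarrow> i + j < N"
    and a: "\<And>x. x < N \<Longrightarrow> arr s ''ar'' x = (if x \<in> X then Q else 0) \<and> arr s ''ai'' x = 0"
    and b: "\<And>x. x < N \<Longrightarrow> arr s ''br'' x = (if x \<in> Y then Q else 0) \<and> arr s ''bi'' x = 0"
  shows "runs L conv_prog s (\<lambda>t s'. t \<le> q * (N * 420 + 120) + 24 \<and>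
    (\<forall>t<N. wd 7 (arr s' ''cr'' (q * N + (N - t) mod N)) \<and>
      (Q * int N < 2 * arr s' ''cr'' (q * N + (N - t) mod N) \<longleftrightarrow> (\<exists>i\<in>X. \<exists>j\<in>Y. i + j = t))))"
proof -
  let ?w = "unity_root N" and ?x = "real N"
  let ?ind = "\<lambda>Z i. if i \<in> Z then 1 else (0::complex)"
  define fx fy where "fx x = (\<Sum>i<N. ?ind X i * ?w ^ (i * x))" and "fy x = (\<Sum>i<N. ?ind Y i * ?w ^ (i * x))" for x
  have ind: "norm (?ind Z i) \<le> 1" for Z i by simp
  have norm_f: "norm (\<Sum>i<N. ?ind Z i * ?w ^ (i * x)) \<le> ?x" for Z x
  proof -
    have "norm (\<Sum>i<N. ?ind Z i * ?w ^ (i * x)) \<le> (\<Sum>i<N. 1)"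
      by (intro order_trans[OF norm_sum] sum_mono) (simp add: norm_mult norm_power)
    then show ?thesis by simp
  qed
  note pb = power_N_bounds[folded Q_N]
  note pb' = power_N_bounds
  have Q16: "real_of_int Q = ?x ^ 16" by (rule Q_N)
  define E1 where "E1 = ?x ^ 2 * (0 + ?x ^ 4 * 1 + 2)"
  have A1: "runs L (fft_prog ''ar'' ''ai'') s (\<lambda>t s'. t \<le> q * (N * 120 + 40) + 6 \<and>
     (\<forall>x<N. norm (cint (arr s' ''ar'' (q * N + x)) (arr s' ''ai'' (q * N + x)) - of_int Q * fx x) \<le> E1))"
    unfolding fx_def E1_def
    by (rule fft_prog[OF env roots _ _ _ _ ind]) (use a pb'(1) in \<open>auto simp: cint_def complex_eq_iff Q16\<close>)
  have A2: "runs L (fft_prog ''br'' ''bi'') s1 (\<lambda>t s'. t \<le> q * (N * 120 + 40) + 6 \<and>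
     (\<forall>x<N. norm (cint (arr s' ''br'' (q * N + x)) (arr s' ''bi'' (q * N + x)) - of_int Q * fy x) \<le> E1))"
    if un: "unchanged fft_regs {''ar'', ''ai''} s s1" for s1
  proof -
    have env1: "env s1" by (rule env_unchanged[OF env un]) (auto simp: env_regs_def fft_regs_def)
    have arrs: "arr s1 ''Wr'' = arr s ''Wr''" "arr s1 ''Wi'' = arr s ''Wi''" "arr s1 ''br'' = arr s ''br''" "arr s1 ''bi'' = arr s ''bi''"
      using unchanged_arr[OF un] by simp_all
    have roots1: "roots s1" using roots by (simp add: roots_def arrs)
    show ?thesis unfolding fy_def E1_def
      by (rule fft_prog[OF env1 roots1 _ _ _ _ ind]) (use b pb'(1) in \<open>auto simp: cint_def complex_eq_iff Q16 arrs\<close>)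
  qed
  have A34: "runs L (product_prog ;; fft_prog ''cr'' ''ci'') s2 (\<lambda>t s'. t \<le> (N * 60 + 6) + (q * (N * 120 + 40) + 6) \<and>
     (\<forall>x<N. norm (cint (arr s' ''cr'' (q * N + x)) (arr s' ''ci'' (q * N + x)) -
        of_int Q * (\<Sum>m<N. (if m < N then fx m * fy m else 0) * ?w ^ (m * x))) \<le> ?x ^ 2 * (?x ^ 9 + ?x ^ 4 * ?x ^ 2 + 2)))"
    if un: "unchanged fft_regs {''ar'', ''ai'', ''br'', ''bi''} s s2"
      and sa: "\<forall>x<N. norm (cint (arr s2 ''ar'' (q * N + x)) (arr s2 ''ai'' (q * N + x)) - of_int Q * fx x) \<le> E1"
      and sb: "\<forall>x<N. norm (cint (arr s2 ''br'' (q * N + x)) (arr s2 ''bi'' (q * N + x)) - of_int Q * fy x) \<le> E1" for s2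
  proof -
    have env2: "env s2" by (rule env_unchanged[OF env un]) (auto simp: env_regs_def fft_regs_def)
    have sz: "real_of_int Q * ?x + E1 \<le> 2 ^ (20 * q)" using pb'(1) by (simp add: E1_def Q16)
    have nfx: "norm (fx x) \<le> ?x" "norm (fy x) \<le> ?x" for x unfolding fx_def fy_def by (rule norm_f)+
    have wds: "wd 7 (arr s2 ''ar'' (q * N + x)) \<and> wd 7 (arr s2 ''ai'' (q * N + x)) \<and>
      wd 7 (arr s2 ''br'' (q * N + x)) \<and> wd 7 (arr s2 ''bi'' (q * N + x))" if "x < N" for x
      using wd_approx[OF _ nfx(1) sz] wd_approx[OF _ nfx(2) sz] sa sb that by blast
    show ?thesis unfolding runs_Seq
    proof (rule runs_conseq[OF product_prog[OF env2 wds]], assumption, goal_cases)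
      case (1 t3 s3)
      note un3 = 1(2)[simplified]
      have env3: "env s3" by (rule env_unchanged[OF env2 un3]) (auto simp: env_regs_def)
      have arrs: "arr s3 ''Wr'' = arr s ''Wr''" "arr s3 ''Wi'' = arr s ''Wi''"
        using unchanged_arr[OF un3] unchanged_arr[OF un] by simp_all
      have roots3: "roots s3" using roots by (simp add: roots_def arrs)
      let ?f = "\<lambda>m. if m < N then fx m * fy m else 0"
      have in3: "norm (cint (arr s3 ''cr'' x) (arr s3 ''ci'' x) - of_int Q * ?f x) \<le> ?x ^ 9" if x: "x < N" for x
      proof -
        let ?a = "cint (arr s2 ''ar'' (q * N + x)) (arr s2 ''ai'' (q * N + x))"
        let ?b = "cint (arr s2 ''br'' (q * N + x)) (arr s2 ''bi'' (q * N + x))"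
        have ea: "norm (?a - of_int Q * fx x) \<le> ?x ^ 7" "norm (?b - of_int Q * fy x) \<le> ?x ^ 7"
          using sa sb x pb'(2) unfolding E1_def by (meson order_trans)+
        have "norm (cint (arr s3 ''cr'' x) (arr s3 ''ci'' x) - ?a * ?b / of_int Q) \<le> 2"
          using 1(1) x by blast
        then have "norm (cint (arr s3 ''cr'' x) (arr s3 ''ci'' x) - of_int Q * (fx x * fy x)) \<le> 1 * ?x ^ 7 + ?x ^ 7 * ?x + ?x * ?x ^ 7 + 2"
          using approx_mult[of "real_of_int Q" ?a "fx x" "?x ^ 7" ?b "fy x" "?x ^ 7" ?x ?x 1] ea nfx pb'(6)[folded Q16]
          by simp
        then show ?thesis using pb'(3) x by simp
      qed
      have f3: "norm (?f j) \<le> ?x ^ 2" for j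
      proof -
        have "norm (fx j * fy j) \<le> ?x * ?x" unfolding norm_mult using nfx by (intro mult_mono) auto
        then show ?thesis by (simp add: power2_eq_square)
      qed
      have "runs L (fft_prog ''cr'' ''ci'') s3 (\<lambda>t s'. t \<le> q * (N * 120 + 40) + 6 \<and>
         (\<forall>x<N. norm (cint (arr s' ''cr'' (q * N + x)) (arr s' ''ci'' (q * N + x)) -
        of_int Q * (\<Sum>m<N. ?f m * ?w ^ (m * x))) \<le> ?x ^ 2 * (?x ^ 9 + ?x ^ 4 * ?x ^ 2 + 2)))"
        by (rule fft_prog[OF env3 roots3 _ _ _ in3 f3]) (use pb'(4) in \<open>simp_all add: Q16\<close>)
      then show ?case by (rule runs_conseq) (use 1(1) in auto)
    qed
  qed
  have z: "(\<Sum>m<N. (if m < N then fx m * fy m else 0) * ?w ^ (m * ((N - t) mod N))) =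
      of_nat (N * card {(i, j). i \<in> X \<and> j \<in> Y \<and> i + j = t})" if "t < N" for t
    using dft_convolution[OF pos(1) XY that] unfolding fx_def fy_def by simp
  have fin: "finite {(i, j). i \<in> X \<and> j \<in> Y \<and> i + j = t}" for t
    by (rule finite_subset[of _ "{..t} \<times> {..t}"]) auto
  have final: "wd 7 c \<and> (Q * int N < 2 * c \<longleftrightarrow> (\<exists>i\<in>X. \<exists>j\<in>Y. i + j = t))"
    if t: "t < N" and c: "norm (cint c d - of_int Q * (\<Sum>m<N. (if m < N then fx m * fy m else 0) * ?w ^ (m * ((N - t) mod N))))
       \<le> ?x ^ 2 * (?x ^ 9 + ?x ^ 4 * ?x ^ 2 + 2)" for t c d
  proof -
    let ?C = "card {(i, j). i \<in> X \<and> j \<in> Y \<and> i + j = t}"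
    let ?e = "?x ^ 2 * (?x ^ 9 + ?x ^ 4 * ?x ^ 2 + 2)"
    have c': "norm (cint c d - of_int Q * of_nat (N * ?C)) \<le> ?e"
      using c unfolding z[OF t] .
    have "?C \<le> card ({..<N} \<times> {..<N})"
      using XY by (intro card_mono) auto
    then have "real ?C \<le> ?x * ?x" by (simp flip: of_nat_mult)
    then have "norm (of_nat (N * ?C) :: complex) \<le> ?x * ?x ^ 2"
      by (simp add: norm_mult power2_eq_square mult_left_mono)
    from wd_approx(1)[OF c' this, of 7] have "wd 7 c"
      using pb'(4) by (simp add: Q16)
    moreover have "Q * int N < 2 * c \<longleftrightarrow> ?C \<noteq> 0"
    proof -
      have "\<bar>Re (cint c d - of_int Q * of_nat (N * ?C))\<bar> \<le> ?e"
        using abs_Re_le_cmod c' order_trans by blast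
      then have r: "\<bar>real_of_int c - real_of_int Q * (?x * real ?C)\<bar> \<le> ?e"
        by (simp add: cint_def)
      have e: "2 * ?e < real_of_int Q * ?x" using pb'(5) by (simp add: Q16)
      have "Q * int N < 2 * c \<longleftrightarrow> real_of_int (Q * int N) < real_of_int (2 * c)"
        by (simp only: of_int_less_iff)
      also have "\<dots> \<longleftrightarrow> real_of_int Q * ?x < 2 * real_of_int c" by simp
      also have "\<dots> \<longleftrightarrow> ?C \<noteq> 0"
      proof (cases "?C = 0")
        case True
        then show ?thesis using r e by simp
      next
        case False
        then have "1 \<le> real ?C" by simp
        then have "(real_of_int Q * ?x) * 1 \<le> (real_of_int Q * ?x) * real ?C"
          by (intro mult_left_mono) auto
        then have "real_of_int Q * ?x \<le> real_of_int Q * (?x * real ?C)" by (simp only: mult.assoc mult_1_right)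
        moreover have "g < 2 * c" if "\<bar>c - z\<bar> \<le> e" "2 * e < g" "g \<le> z" for c z e g :: real
          using that by argo
        ultimately show ?thesis using False r e by blast
      qed
      finally show ?thesis .
    qed
    moreover have "?C \<noteq> 0 \<longleftrightarrow> (\<exists>i\<in>X. \<exists>j\<in>Y. i + j = t)"
      using fin[of t] by (auto simp: card_eq_0_iff)
    ultimately show ?thesis by blast
  qed
  have Nq: "N * 60 \<le> q * (N * 60)" using q8 by simp
  show ?thesis
    unfolding conv_prog_def
  proof (subst runs_Seq, rule runs_conseq[OF A1], goal_cases)
    case (1 t1 s1)
    note un1 = 1(2)[simplified]
    show ?case
    proof (subst runs_Seq, rule runs_conseq[OF A2[OF un1]], goal_cases)
      case (1 t2 s2)
      note un2 = 1(2)[simplified]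
      have un: "unchanged fft_regs {''ar'', ''ai'', ''br'', ''bi''} s s2"
        using unchanged_trans[OF un1 un2] by (simp add: insert_commute)
      have "arr s2 ''ar'' = arr s1 ''ar''" "arr s2 ''ai'' = arr s1 ''ai''"
        using unchanged_arr[OF un2] by simp_all
      then have sa: "\<forall>x<N. norm (cint (arr s2 ''ar'' (q * N + x)) (arr s2 ''ai'' (q * N + x)) - of_int Q * fx x) \<le> E1"
        using \<open>t1 \<le> _ \<and> _\<close> by simp
      show ?case
      proof (rule runs_conseq[OF A34[OF un sa]], goal_cases)
        case (2 t s')
        have "(N - x) mod N < N" for x by simp
        then have "\<forall>t<N. wd 7 (arr s' ''cr'' (q * N + (N - t) mod N)) \<and>
          (Q * int N < 2 * arr s' ''cr'' (q * N + (N - t) mod N) \<longleftrightarrow> (\<exists>i\<in>X. \<exists>j\<in>Y. i + j = t))"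
          using final 2(1) by blast
        moreover have "t1 + (t2 + t) \<le> q * (N * 420 + 120) + 24"
          using conjunct1[OF 2(1)] conjunct1[OF \<open>t1 \<le> _ \<and> _\<close>] conjunct1[OF 1(1)] Nq
          unfolding distrib_left by linarith
        ultimately show ?case by blast
      qed (use 1(1) in blast)
    qed
  qed
qed

end

section \<open>Sorting by exponent\<close>

text \<open>A tournament tree: node \<open>v\<close> holds the winner of its children \<open>2 * v\<close> and \<open>2 * v + 1\<close>, where
  entry \<open>i + 1\<close> stands for the index \<open>i\<close> and \<open>0\<close> for the absence of a player.\<close>

definition winner :: "(nat \<Rightarrow> int) \<Rightarrow> int \<Rightarrow> int \<Rightarrow> int" where
  "winner e a b = (if a = 0 then b else if b = 0 then a
     else if e (nat (b - 1)) < e (nat (a - 1)) then b else a)"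

definition fair :: "(nat \<Rightarrow> int) \<Rightarrow> (nat \<Rightarrow> int) \<Rightarrow> nat \<Rightarrow> bool" where
  "fair e T v \<longleftrightarrow> T v = winner e (T (2 * v)) (T (2 * v + 1))"

text \<open>Climbing from a leaf to the root by halving the node number, the key of the entry met
  never increases and the entry never becomes empty.\<close>

lemma tournament_min:
  assumes fair: "\<And>v. 1 \<le> v \<Longrightarrow> v < 2 ^ d \<Longrightarrow> fair e T v"
    and i: "i < 2 ^ d" "T (2 ^ d + i) \<noteq> 0"
  shows "T 1 \<noteq> 0 \<and> e (nat (T 1 - 1)) \<le> e (nat (T (2 ^ d + i) - 1))"
proof -
  have "T ((2 ^ d + i) div 2 ^ h) \<noteq> 0 \<and> e (nat (T ((2 ^ d + i) div 2 ^ h) - 1)) \<le> e (nat (T (2 ^ d + i) - 1))"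
    if "h \<le> d" for h using that
  proof (induction h)
    case (Suc h)
    let ?u = "(2 ^ d + i) div 2 ^ h"
    define v where "v = (2 ^ d + i) div 2 ^ Suc h"
    have vu: "v = ?u div 2" by (simp only: v_def power_Suc2 div_mult2_eq)
    have "(2::nat) ^ Suc h \<le> 2 ^ d" using Suc.prems by (intro power_increasing) auto
    then have "1 \<le> v" unfolding v_def by (metis add.commute div_greater_zero_iff less_eq_Suc_le One_nat_def trans_le_add2 zero_less_numeral zero_less_power)
    moreover have "v < 2 ^ d"
    proof -
      have "v \<le> (2 ^ d + i) div 2"
        unfolding v_def by (intro div_le_mono2) auto
      then show ?thesis using i by linarith
    qed
    ultimately have "fair e T v" by (rule fair)
    moreover have "?u = 2 * v \<or> ?u = 2 * v + 1" unfolding vu by linarith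
    ultimately show ?case using Suc unfolding v_def[symmetric] fair_def winner_def
      by (auto split: if_splits)
  qed (use i in simp)
  from this[of d] show ?thesis using i by (simp add: div_add_self1)
qed

text \<open>A winner is copied from one of the two children, so descending from any node leads to a
  leaf with the same entry.\<close>

lemma tournament_root:
  assumes fair: "\<And>v. 1 \<le> v \<Longrightarrow> v < P \<Longrightarrow> fair e T v" and "1 \<le> v" "v < 2 * P"
  shows "T v = 0 \<or> (\<exists>i<P. T (P + i) = T v)"
  using assms(2,3)
proof (induction "2 * P - v" arbitrary: v rule: less_induct)
  case less
  show ?case
  proof (cases "v < P")
    case True
    have "fair e T v" using fair less.prems True by blast
    then have "T v = T (2 * v) \<or> T v = T (2 * v + 1)" by (auto simp: fair_def winner_def split: if_splits)
    moreover have "T (2 * v) = 0 \<or> (\<exists>i<P. T (P + i) = T (2 * v))"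
      by (rule less.hyps) (use True less.prems in auto)
    moreover have "T (2 * v + 1) = 0 \<or> (\<exists>i<P. T (P + i) = T (2 * v + 1))"
      by (rule less.hyps) (use True less.prems in auto)
    ultimately show ?thesis by metis
  next
    case False
    then have "v - P < P \<and> T (P + (v - P)) = T v" using less.prems by simp
    then show ?thesis by blast
  qed
qed

context params
begin

definition match_prog :: com where
  "match_prog =
     Assign ''a'' (Arr ''T'' (Const 2 \<otimes> Reg ''v'')) ;;
     Assign ''b'' (Arr ''T'' (Const 2 \<otimes> Reg ''v'' \<oplus> Const 1)) ;;
     Cond (Reg ''a'' \<doteq> Const 0) (Store ''T'' (Reg ''v'') (Reg ''b''))
       (Cond (Reg ''b'' \<doteq> Const 0) (Store ''T'' (Reg ''v'') (Reg ''a''))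
         (Cond (Arr ''xe'' (Reg ''b'' \<ominus> Const 1) \<prec> Arr ''xe'' (Reg ''a'' \<ominus> Const 1))
           (Store ''T'' (Reg ''v'') (Reg ''b'')) (Store ''T'' (Reg ''v'') (Reg ''a''))))"

text \<open>The leaves occupy positions \<open>P\<close> to \<open>2 * P - 1\<close>. The inner
  nodes are visited from \<open>P - 1\<close> down to 1, so both children are final when their match
  is played.\<close>

definition build_prog :: com where
  "build_prog =
     For ''i'' ''P''
       (Cond (Reg ''i'' \<prec> Reg ''n'')
          (Cond (Arr ''xm'' (Reg ''i'') \<doteq> Const 0) (Store ''T'' (Reg ''P'' \<oplus> Reg ''i'') (Const 0))
            (Store ''T'' (Reg ''P'' \<oplus> Reg ''i'') (Reg ''i'' \<oplus> Const 1)))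
          (Store ''T'' (Reg ''P'' \<oplus> Reg ''i'') (Const 0))) ;;
     Assign ''P1'' (Reg ''P'' \<ominus> Const 1) ;;
     For ''i'' ''P1'' (Assign ''v'' (Reg ''P1'' \<ominus> Reg ''i'') ;; match_prog)"

text \<open>After the overall winner is erased at its leaf, only the matches on the path from this
  leaf to the root have to be replayed, which takes \<open>qP\<close> steps. An empty tree makes the
  extraction a no-op, so the sorting loop can run \<open>n\<close> times even if some entries are
  infinite.\<close>

definition extract_prog :: com where
  "extract_prog =
     Assign ''y'' (Arr ''T'' (Const 1)) ;;
     Cond (Reg ''y'' \<doteq> Const 0) Skip
       (Store ''ord'' (Reg ''cnt'') (Reg ''y'' \<ominus> Const 1) ;;
        Assign ''cnt'' (Reg ''cnt'' \<oplus> Const 1) ;;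
        Assign ''v'' (Reg ''P'' \<oplus> (Reg ''y'' \<ominus> Const 1)) ;;
        Store ''T'' (Reg ''v'') (Const 0) ;;
        For ''z'' ''qP'' (Assign ''v'' (Reg ''v'' \<oslash> Const 2) ;; match_prog))"

definition sort_prog :: com where
  "sort_prog = build_prog ;; Assign ''cnt'' (Const 0) ;; For ''i'' ''n'' extract_prog"

lemma written_sort [simp]:
  "written_regs match_prog = {''a'', ''b''}"
  "written_arrs match_prog = {''T''}"
  "written_regs build_prog = {''i'', ''P1'', ''v'', ''a'', ''b''}"
  "written_arrs build_prog = {''T''}"
  "written_regs extract_prog = {''y'', ''cnt'', ''v'', ''z'', ''a'', ''b''}"
  "written_arrs extract_prog = {''T'', ''ord''}"
  "written_regs sort_prog = {''i'', ''P1'', ''v'', ''a'', ''b'', ''y'', ''cnt'', ''z''}"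
  "written_arrs sort_prog = {''T'', ''ord''}"
  by (auto simp: match_prog_def build_prog_def extract_prog_def sort_prog_def)

definition entries :: "(nat \<Rightarrow> int) \<Rightarrow> bool" where
  "entries T \<longleftrightarrow> (\<forall>v. 1 \<le> v \<and> v < 2 * P \<longrightarrow> 0 \<le> T v \<and> T v \<le> int n)"

lemma match_prog:
  assumes v: "reg s ''v'' = int v" "1 \<le> v" "v < P"
    and ch: "0 \<le> arr s ''T'' (2 * v)" "arr s ''T'' (2 * v) \<le> int n"
      "0 \<le> arr s ''T'' (2 * v + 1)" "arr s ''T'' (2 * v + 1) \<le> int n"
    and xe: "\<And>i. i < n \<Longrightarrow> wd 0 (arr s ''xe'' i)"
  shows "runs L match_prog s (\<lambda>t s'. t \<le> 40 \<and>
    arr s' ''T'' = (arr s ''T'')(v := winner (arr s ''xe'') (arr s ''T'' (2 * v)) (arr s ''T'' (2 * v + 1))))"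
proof -
  let ?T = "arr s ''T''" and ?a = "arr s ''T'' (2 * v)" and ?b = "arr s ''T'' (2 * v + 1)"
  have wv: "wd k (int v)" if "3 \<le> k" for k using that v le_N by (intro wd_nat) auto
  have wab: "wd k ?a" "wd k ?b" if "3 \<le> k" for k
    using that ch le_N(1) by (auto intro!: wd_N)
  have wx: "wd k (arr s ''xe'' (nat (?a - 1)))" if "?a \<noteq> 0" for k
    using that ch by (intro wd_mono[OF xe]) auto
  have wy: "wd k (arr s ''xe'' (nat (?b - 1)))" if "?b \<noteq> 0" for k
    using that ch by (intro wd_mono[OF xe]) auto
  have idx: "nat (2 * int v) = 2 * v" "nat (2 * int v + 1) = Suc (2 * v)" by simp_all
  show ?thesis
    unfolding match_prog_def winner_def
    using v ch wv wab wx wy by (simp add: idx wd_rules)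
qed

definition tournament :: "(nat \<Rightarrow> int) \<Rightarrow> (nat \<Rightarrow> int) \<Rightarrow> nat set \<Rightarrow> bool" where
  "tournament e T R \<longleftrightarrow> entries T \<and> (\<forall>i<P. T (P + i) = (if i \<in> R then int i + 1 else 0)) \<and>
     (\<forall>v. 1 \<le> v \<and> v < P \<longrightarrow> fair e T v)"

lemma build_prog:
  assumes env: "env s" and xe: "\<And>i. i < n \<Longrightarrow> wd 0 (arr s ''xe'' i)" and xm: "\<And>i. i < n \<Longrightarrow> wd 0 (arr s ''xm'' i)"
  shows "runs L build_prog s (\<lambda>t s'. t \<le> P * 90 + 30 \<and>
     tournament (arr s ''xe'') (arr s' ''T'') {i. i < n \<and> arr s ''xm'' i \<noteq> 0})"
proof -
  define R where "R = {i. i < n \<and> arr s ''xm'' i \<noteq> 0}"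
  let ?leaf = "\<lambda>m s'. \<forall>i<m. arr s' ''T'' (P + i) = (if i \<in> R then int i + 1 else 0)"
  let ?b1 = "(Cond (Reg ''i'' \<prec> Reg ''n'')
          (Cond (Arr ''xm'' (Reg ''i'') \<doteq> Const 0) (Store ''T'' (Reg ''P'' \<oplus> Reg ''i'') (Const 0))
            (Store ''T'' (Reg ''P'' \<oplus> Reg ''i'') (Reg ''i'' \<oplus> Const 1)))
          (Store ''T'' (Reg ''P'' \<oplus> Reg ''i'') (Const 0)))"
  have loop1: "runs L (For ''i'' ''P'' ?b1) s (\<lambda>t s'. t \<le> P * 28 + 6 \<and> ?leaf P s')"
  proof (rule runs_For[where m = P and T = 20 and I = ?leaf], goal_cases)
    case (9 i s')
    have regs: "reg s' ''n'' = int n" "reg s' ''P'' = int P" and xm': "arr s' ''xm'' = arr s ''xm''"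
      using unchanged_reg[OF 9(4)] unchanged_arr[OF 9(4)] env by (simp_all add: env_def)
    have wi: "wd k (int i)" if "3 \<le> k" for k using that 9(1) le_N(3) by (intro wd_nat) auto
    have wm: "wd k (arr s ''xm'' i)" if "i < n" for k using wd_mono[OF xm[OF that]] by simp
    have idx: "nat (int P + int i) = P + i" by simp
    show ?case
    proof (cases "i < n")
      case True
      then show ?thesis using 9(1-3) wm[OF True]
        by (auto simp: regs xm' idx wi wd_rules less_Suc_eq R_def)
    next
      case False
      then show ?thesis using 9(1-3)
        by (auto simp: regs xm' idx wi wd_rules less_Suc_eq R_def)
    qed
  qed (use env in \<open>auto simp: env_def wd_rules\<close>)
  let ?I = "\<lambda>m s'. ?leaf P s' \<and> (\<forall>v. P - m \<le> v \<and> v < 2 * P \<longrightarrow> 0 \<le> arr s' ''T'' v \<and> arr s' ''T'' v \<le> int n) \<and>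
     (\<forall>v. P - m \<le> v \<and> v < P \<longrightarrow> fair (arr s ''xe'') (arr s' ''T'') v)"
  have loop2: "runs L (For ''i'' ''P1'' (Assign ''v'' (Reg ''P1'' \<ominus> Reg ''i'') ;; match_prog)) s1
      (\<lambda>t s'. t \<le> (P - 1) * 54 + 6 \<and> ?I (P - 1) s')"
    if s1: "reg s1 ''P1'' = int (P - 1)" "arr s1 ''xe'' = arr s ''xe''" "?leaf P s1" for s1
  proof (rule runs_For[where m = "P - 1" and T = 46 and I = ?I], goal_cases)
    case 8
    have "0 \<le> arr s1 ''T'' v \<and> arr s1 ''T'' v \<le> int n" if "P \<le> v" "v < 2 * P" for v
    proof -
      have "v - P < P" using that by simp
      then have "arr s1 ''T'' (P + (v - P)) = (if v - P \<in> R then int (v - P) + 1 else 0)"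
        using s1(3) by blast
      then show ?thesis using that by (auto simp: R_def)
    qed
    then show ?case using s1(3) by auto
  next
    case (9 i s')
    define v where "v = P - 1 - i"
    have v: "1 \<le> v" "v < P" "P - i = Suc v" "P - Suc i = v" using 9(1) by (auto simp: v_def)
    have regs: "reg s' ''P1'' = int (P - 1)" "reg s' ''i'' = int i" and xe': "arr s' ''xe'' = arr s ''xe''"
      using unchanged_reg[OF 9(4)] unchanged_arr[OF 9(4)] s1 9(2) by simp_all
    have val: "int (P - 1) - int i = int v" using 9(1) by (simp add: v_def)
    have w: "wd k (int v)" "wd k (int i)" "wd k (int (P - 1))" if "3 \<le> k" for k
      using that 9(1) le_N(3) v by - (rule wd_nat; simp)+
    let ?s2 = "s'\<lparr>reg := (reg s')(''v'' := int v)\<rparr>"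
    have bnd: "0 \<le> arr s' ''T'' u \<and> arr s' ''T'' u \<le> int n" if "Suc v \<le> u" "u < 2 * P" for u
      using 9(3) that v(3) by simp
    have m: "runs L match_prog ?s2 (\<lambda>t s''. t \<le> 40 \<and> arr s'' ''T'' =
        (arr s' ''T'')(v := winner (arr s ''xe'') (arr s' ''T'' (2 * v)) (arr s' ''T'' (2 * v + 1))))"
      using match_prog[of ?s2 v] bnd[of "2 * v"] bnd[of "2 * v + 1"] v xe by (simp add: xe')
    show ?case
      unfolding runs_Seq
      apply (rule runs_Assign_val[where v = "int v"])
        apply (use regs w val in \<open>simp add: wd_rules\<close>)
       apply (use regs val in simp)
      apply (rule runs_conseq[OF m])
      subgoal premises prems for t s''
      proof -
        let ?T = "arr s' ''T''" and ?T' = "arr s'' ''T''"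
        have T': "?T' = ?T(v := winner (arr s ''xe'') (?T (2 * v)) (?T (2 * v + 1)))" and t: "t \<le> 40" using prems by auto
        have "?leaf P s''" using 9(3) v unfolding T' by simp
        moreover have "0 \<le> ?T' u \<and> ?T' u \<le> int n" if "v \<le> u" "u < 2 * P" for u
        proof (cases "u = v")
          case True
          then show ?thesis using bnd[of "2 * v"] bnd[of "2 * v + 1"] v unfolding T' winner_def by simp
        next
          case False
          then show ?thesis using bnd[of u] that unfolding T' by simp
        qed
        moreover have "fair (arr s ''xe'') ?T' u" if "v \<le> u" "u < P" for u
        proof (cases "u = v")
          case True
          have "2 * v \<noteq> v" "2 * v + 1 \<noteq> v" using v by simp_all
          then show ?thesis unfolding True fair_def T' by simp
        next
          case False
          then have "fair (arr s ''xe'') ?T u" using 9(3) that v(3) by auto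
          moreover have "2 * u \<noteq> v" "2 * u + 1 \<noteq> v" using that v(1) by auto
          ultimately show ?thesis using False unfolding fair_def T' by simp
        qed
        ultimately show ?thesis using t v(4) by simp
      qed
      done
  next
    case (10 t s')
    then show ?case by auto
  next
    case 5
    show ?case unfolding is_word_L by (rule wd_nat) (use le_N(3) in simp_all)
  qed (use s1 in auto)
  show ?thesis
    unfolding build_prog_def
    apply (subst runs_Seq, rule runs_conseq[OF loop1])
    subgoal premises p1 for t1 s1
    proof -
      have regs: "reg s1 ''P'' = int P" and xe1: "arr s1 ''xe'' = arr s ''xe''"
        using unchanged_reg[OF p1(2)] unchanged_arr[OF p1(2)] env by (simp_all add: env_def)
      have P1: "int P - 1 = int (P - 1)" using pos(3) by linarith
      show ?thesis
        apply (subst runs_Seq, rule runs_Assign_val[where v = "int (P - 1)"])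
          apply (simp add: regs wd_rules)
         apply (simp add: regs P1)
        apply (rule runs_conseq[OF loop2])
        using p1(1) xe1 apply simp_all[3]
        subgoal premises p2 for t2 s2
        proof -
          have "P - (P - 1) = 1" using pos(3) by arith
          note p3 = conjunct2[OF p2(1), unfolded this]
          have "(P - 1) * 54 \<le> P * 54" by simp
          then have "t1 + (3 + 1 + t2) \<le> P * 90 + 30"
            using conjunct1[OF p1(1)] conjunct1[OF p2(1)] by linarith
          then show ?thesis using p3 unfolding tournament_def entries_def R_def[symmetric] by simp
        qed
        done
    qed
    done
qed

lemma extract_prog:
  assumes env: "env s" and xe: "\<And>i. i < n \<Longrightarrow> wd 0 (arr s ''xe'' i)"
    and T: "tournament (arr s ''xe'') (arr s ''T'') R" and R: "R \<subseteq> {..<n}"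
    and c: "reg s ''cnt'' = int c" "c \<le> n"
  shows "runs L extract_prog s (\<lambda>t s'. t \<le> qP * 54 + 50 \<and>
     (R = {} \<and> reg s' ''cnt'' = int c \<and> arr s' ''ord'' = arr s ''ord'' \<and> arr s' ''T'' = arr s ''T'' \<or>
      (\<exists>i\<in>R. (\<forall>r\<in>R. arr s ''xe'' i \<le> arr s ''xe'' r) \<and> reg s' ''cnt'' = int (Suc c) \<and>
        arr s' ''ord'' = (arr s ''ord'')(c := int i) \<and> tournament (arr s ''xe'') (arr s' ''T'') (R - {i}))))"
proof -
  let ?e = "arr s ''xe''" and ?T = "arr s ''T''"
  have entries: "0 \<le> ?T v \<and> ?T v \<le> int n" if "1 \<le> v" "v < 2 * P" for v
    using T that by (auto simp: tournament_def entries_def)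
  have leaf: "?T (P + i) = (if i \<in> R then int i + 1 else 0)" if "i < P" for i
    using T that by (simp add: tournament_def)
  have fair: "fair ?e ?T v" if "1 \<le> v" "v < P" for v using T that by (simp add: tournament_def)
  have nP': "n \<le> P" using nP by (simp add: P_def)
  have min: "?T 1 \<noteq> 0 \<and> ?e (nat (?T 1 - 1)) \<le> ?e r" if "r \<in> R" for r
    using tournament_min[of qP ?e ?T r] fair leaf[of r] that R nP' by (auto simp: P_def)
  have one: "1 < 2 * P" using pos(3) by linarith
  have root: "?T 1 = 0 \<or> (\<exists>i\<in>R. ?T 1 = int i + 1)"
    using tournament_root[of P ?e ?T 1] fair leaf one by (metis order_refl)
  have w1: "wd k (?T 1)" if "3 \<le> k" for k
    using entries[of 1] one le_N(1) that by (intro wd_N) auto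
  have wc: "wd k (int c)" if "3 \<le> k" for k using that c le_N(1) by (intro wd_nat) auto
  show ?thesis
  proof (cases "?T 1 = 0")
    case True
    then have "R = {}" using min by blast
    then show ?thesis unfolding extract_prog_def using True c by (simp add: w1 wd_rules)
  next
    case False
    then obtain i where i: "i \<in> R" "?T 1 = int i + 1" using root by blast
    have iP: "i < P" "i < n" using i R nP' by auto
    have imin: "\<forall>r\<in>R. ?e i \<le> ?e r" using min i by simp
    define v0 where "v0 = P + i"
    have v0: "v0 < 2 * P" "P \<le> v0" using iP by (auto simp: v0_def)
    have wi: "wd k (int i)" "wd k (int i + 1)" if "3 \<le> k" for k
      using that iP le_N(1) by (auto intro!: wd_nat wd_N)
    have wv: "wd k (int P + int i)" if "4 \<le> k" for k
      using that by (simp add: wi wd_rules)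
    let ?leaves = "\<lambda>s'. \<forall>j<P. arr s' ''T'' (P + j) = (if j \<in> R - {i} then int j + 1 else 0)"
    \<comment> \<open>After \<open>z\<close> replays the only matches that may still be wrong are
      those at the remaining ancestors of the erased leaf. For \<open>h > qP\<close> the quotient
      \<open>v0 div 2 ^ h\<close> is 0, so none is left at the end.\<close>
    let ?I = "\<lambda>z s'. reg s' ''v'' = int (v0 div 2 ^ z) \<and> entries (arr s' ''T'') \<and> ?leaves s' \<and>
       (\<forall>u. 1 \<le> u \<and> u < P \<longrightarrow> fair ?e (arr s' ''T'') u \<or> (\<exists>h>z. u = v0 div 2 ^ h))"
    have path: "runs L (For ''z'' ''qP'' (Assign ''v'' (Reg ''v'' \<oslash> Const 2) ;; match_prog)) s1
        (\<lambda>t s'. t \<le> qP * 54 + 6 \<and> tournament ?e (arr s' ''T'') (R - {i}))"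
      if s1: "reg s1 ''qP'' = int qP" "reg s1 ''v'' = int v0" "arr s1 ''T'' = ?T(v0 := 0)" "arr s1 ''xe'' = ?e" for s1
    proof (rule runs_For[where m = qP and T = 46 and I = ?I], goal_cases)
      case 8
      have "entries (arr s1 ''T'')" using entries by (simp add: entries_def s1)
      moreover have "?leaves s1" using leaf by (auto simp: s1 v0_def)
      moreover have "fair ?e (arr s1 ''T'') u \<or> (\<exists>h>0. u = v0 div 2 ^ h)" if u: "1 \<le> u" "u < P" for u
      proof (cases "2 * u = v0 \<or> 2 * u + 1 = v0")
        case True
        then have "u = v0 div 2 ^ 1" by auto
        then show ?thesis by blast
      next
        case False
        then show ?thesis using fair[OF u] u v0 by (simp add: fair_def s1)
      qed
      ultimately show ?case using s1 by simp
    next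
      case (9 z s')
      define v where "v = v0 div 2 ^ Suc z"
      have vz: "int (v0 div 2 ^ z) div 2 = int v"
        by (simp only: v_def power_Suc2 div_mult2_eq zdiv_int of_nat_numeral)
      have "(2::nat) ^ Suc z \<le> P" using 9(1) unfolding P_def by (intro power_increasing) auto
      then have v1: "1 \<le> v" using v0 unfolding v_def
        by (metis One_nat_def div_greater_zero_iff less_eq_Suc_le order_trans zero_less_numeral zero_less_power)
      have "v \<le> v0 div 2" unfolding v_def by (intro div_le_mono2) auto
      then have vP: "v < P" using v0 by linarith
      have xe': "arr s' ''xe'' = ?e" using unchanged_arr[OF 9(4)] s1 by simp
      have w: "wd k (int (v0 div 2 ^ z))" if "4 \<le> k" for k
      proof (rule wd_le)
        show "wd k (int P + int i)" using that by (rule wv)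
      qed (auto simp: v0_def div_le_dividend simp flip: of_nat_add)
      have ent: "0 \<le> arr s' ''T'' u \<and> arr s' ''T'' u \<le> int n" if "1 \<le> u" "u < 2 * P" for u
        using 9(3) that by (auto simp: entries_def)
      let ?s2 = "s'\<lparr>reg := (reg s')(''v'' := int v)\<rparr>"
      have m: "runs L match_prog ?s2 (\<lambda>t s''. t \<le> 40 \<and> arr s'' ''T'' =
          (arr s' ''T'')(v := winner ?e (arr s' ''T'' (2 * v)) (arr s' ''T'' (2 * v + 1))))"
        using match_prog[of ?s2 v] ent[of "2 * v"] ent[of "2 * v + 1"] v1 vP xe by (simp add: xe')
      show ?case
        unfolding runs_Seq
        apply (rule runs_Assign_val[where v = "int v"])
          apply (use 9(3) w in \<open>simp add: wd_rules\<close>)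
         apply (use 9(3) vz in simp)
        apply (rule runs_conseq[OF m])
        subgoal premises prems for t s''
        proof -
          let ?T1 = "arr s' ''T''" and ?T2 = "arr s'' ''T''"
          have T': "?T2 = ?T1(v := winner ?e (?T1 (2 * v)) (?T1 (2 * v + 1)))" and t: "t \<le> 40" using prems by auto
          have "?leaves s''" using 9(3) vP unfolding T' by simp
          moreover have "entries ?T2"
            unfolding entries_def
          proof (intro allI impI)
            fix u assume "1 \<le> u \<and> u < 2 * P"
            then show "0 \<le> ?T2 u \<and> ?T2 u \<le> int n"
              using ent[of "2 * v"] ent[of "2 * v + 1"] ent[of u] v1 vP unfolding T' winner_def by simp
          qed
          moreover have "fair ?e ?T2 u \<or> (\<exists>h>Suc z. u = v0 div 2 ^ h)" if u: "1 \<le> u" "u < P" for u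
          proof (cases "u = v")
            case True
            have "2 * v \<noteq> v" "2 * v + 1 \<noteq> v" using v1 by simp_all
            then show ?thesis unfolding True fair_def T' by simp
          next
            case uv: False
            show ?thesis
            proof (cases "2 * u = v \<or> 2 * u + 1 = v")
              case True
              then have "u = v div 2" by auto
              then have "u = v0 div 2 ^ Suc (Suc z)"
                by (simp only: v_def power_Suc2 div_mult2_eq)
              then show ?thesis by blast
            next
              case False
              have "fair ?e ?T1 u \<or> (\<exists>h>z. u = v0 div 2 ^ h)" using 9(3) u by blast
              then show ?thesis
              proof
                assume "fair ?e ?T1 u"
                then show ?thesis using False uv unfolding fair_def T' by simp
              next
                assume "\<exists>h>z. u = v0 div 2 ^ h"
                then obtain h where "h > z" "u = v0 div 2 ^ h" by blast
                then show ?thesis using uv unfolding v_def by (metis Suc_lessI)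
              qed
            qed
          qed
          moreover have "reg s'' ''v'' = int v" using unchanged_reg[OF prems(2)] by simp
          ultimately show ?thesis using t unfolding v_def[symmetric] by simp
        qed
        done
    next
      case (10 t s')
      have zero: "v0 div 2 ^ h = 0" if "h > qP" for h
      proof (rule div_less)
        have "(2::nat) ^ Suc qP \<le> 2 ^ h" using that by (intro power_increasing) auto
        then show "v0 < 2 ^ h" using v0 by (simp add: P_def)
      qed
      have "fair ?e (arr s' ''T'') u" if u: "1 \<le> u" "u < P" for u
      proof -
        have "fair ?e (arr s' ''T'') u \<or> (\<exists>h>qP. u = v0 div 2 ^ h)" using 10(2) u by blast
        then show ?thesis using zero u(1) by auto
      qed
      then have "tournament ?e (arr s' ''T'') (R - {i})"
        using 10(2) unfolding tournament_def by blast
      then show ?case using 10(1) by simp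
    qed (use s1 le_N(7) in \<open>auto intro!: wd_nat\<close>)
    have idx: "nat (int P + int i) = v0" by (simp add: v0_def)
    let ?s1 = "s\<lparr>reg := (reg s)(''y'' := int i + 1, ''cnt'' := int (Suc c), ''v'' := int v0),
         arr := (arr s)(''ord'' := (arr s ''ord'')(c := int i), ''T'' := ?T(v0 := 0))\<rparr>"
    have p1: "runs L (For ''z'' ''qP'' (Assign ''v'' (Reg ''v'' \<oslash> Const 2) ;; match_prog)) ?s1
        (\<lambda>t s'. t \<le> qP * 54 + 6 \<and> tournament ?e (arr s' ''T'') (R - {i}))"
      by (rule path) (use env in \<open>simp_all add: env_def\<close>)
    have v0i: "int P + int i = int v0" by (simp add: v0_def)
    have P: "reg s ''P'' = int P" using env by (simp add: env_def)
    show ?thesis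
      unfolding extract_prog_def
      using i c P
      apply (simp add: w1 wi wc wv wd_rules v0i idx wv[unfolded v0i] add.commute[of 1])
      apply (rule runs_conseq[OF p1[simplified add.commute[of 1] of_nat_Suc]])
      subgoal premises prems for t s'
        using prems(6) imin i unchanged_reg[OF prems(7)] unchanged_arr[OF prems(7)]
        by (intro conjI disjI2 bexI[of _ i]) auto
      done
  qed
qed

definition sorted_order :: "state \<Rightarrow> nat \<Rightarrow> (nat \<Rightarrow> nat) \<Rightarrow> bool" where
  "sorted_order s c f \<longleftrightarrow> reg s ''cnt'' = int c \<and> c \<le> n \<and>
     (\<forall>x<c. arr s ''ord'' x = int (f x) \<and> f x < n \<and> arr s ''xm'' (f x) \<noteq> 0) \<and>
     (\<forall>i<n. arr s ''xm'' i \<noteq> 0 \<longrightarrow> (\<exists>x<c. f x = i)) \<and>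
     (\<forall>x y. x \<le> y \<and> y < c \<longrightarrow> arr s ''xe'' (f x) \<le> arr s ''xe'' (f y))"

lemma sort_prog:
  assumes env: "env s" and xe: "\<And>i. i < n \<Longrightarrow> wd 0 (arr s ''xe'' i)" and xm: "\<And>i. i < n \<Longrightarrow> wd 0 (arr s ''xm'' i)"
  shows "runs L sort_prog s (\<lambda>t s'. t \<le> P * 90 + n * (qP * 54 + 58) + 40 \<and> (\<exists>c f. sorted_order s' c f))"
proof -
  let ?e = "arr s ''xe''"
  define R0 where "R0 = {i. i < n \<and> arr s ''xm'' i \<noteq> 0}"
  \<comment> \<open>The order output so far is sorted, and each of its keys is at most every key
    still in the tree; the second fact is what allows the next winner to be appended.\<close>
  define J where "J R c f s' \<longleftrightarrow> R \<subseteq> R0 \<and> tournament ?e (arr s' ''T'') R \<and> reg s' ''cnt'' = int c \<and>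
     (\<forall>x<c. arr s' ''ord'' x = int (f x) \<and> f x \<in> R0) \<and> (\<forall>i\<in>R0. i \<in> R \<or> (\<exists>x<c. f x = i)) \<and>
     (\<forall>x y. x \<le> y \<and> y < c \<longrightarrow> ?e (f x) \<le> ?e (f y)) \<and> (\<forall>x<c. \<forall>r\<in>R. ?e (f x) \<le> ?e r)"
    for R c f and s' :: state
  \<comment> \<open>Bounding \<open>card R\<close> by \<open>n - u\<close> forces the tree to be
    empty after \<open>n\<close> rounds, although rounds may be idle.\<close>
  let ?I = "\<lambda>u s'. \<exists>R c f. J R c f s' \<and> c \<le> u \<and> card R \<le> n - u"
  have finR0: "finite R0" "R0 \<subseteq> {..<n}" by (auto simp: R0_def)
  have loop: "runs L (For ''i'' ''n'' extract_prog) s1 (\<lambda>t s'. t \<le> n * (qP * 54 + 58) + 6 \<and> ?I n s')"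
    if s1: "env s1" "arr s1 ''xe'' = ?e" "tournament ?e (arr s1 ''T'') R0" "reg s1 ''cnt'' = 0" for s1
  proof (rule runs_For[where m = n and T = "qP * 54 + 50" and I = ?I], goal_cases)
    case (7 k s v)
    then show ?case by (simp add: J_def)
  next
    case 8
    have "card R0 \<le> n" using card_mono[OF _ finR0(2)] by simp
    moreover have "J R0 0 (\<lambda>_. 0) s1" using s1 by (simp add: J_def)
    ultimately show ?case by (intro exI[of _ R0] exI[of _ 0] exI[of _ "\<lambda>_. 0"]) simp
  next
    case (9 u s')
    then obtain R c f where J: "J R c f s'" and c: "c \<le> u" and card: "card R \<le> n - u" by blast
    have env': "env s'" by (rule env_unchanged[OF s1(1) 9(4)]) (auto simp: env_regs_def)
    have xe': "arr s' ''xe'' = ?e" using unchanged_arr[OF 9(4)] s1 by simp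
    have R: "R \<subseteq> {..<n}" "R \<subseteq> R0" using J finR0 by (auto simp: J_def)
    have fR: "finite R" using R finite_subset by blast
    have "runs L extract_prog s' (\<lambda>t s''. t \<le> qP * 54 + 50 \<and>
     (R = {} \<and> reg s'' ''cnt'' = int c \<and> arr s'' ''ord'' = arr s' ''ord'' \<and> arr s'' ''T'' = arr s' ''T'' \<or>
      (\<exists>i\<in>R. (\<forall>r\<in>R. ?e i \<le> ?e r) \<and> reg s'' ''cnt'' = int (Suc c) \<and>
        arr s'' ''ord'' = (arr s' ''ord'')(c := int i) \<and> tournament ?e (arr s'' ''T'') (R - {i}))))"
      using extract_prog[OF env', of R c] xe J R c 9(1) by (simp add: xe' J_def)
    then show ?case
    proof (rule runs_conseq)
      fix t :: nat and s'' :: state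
      assume post: "t \<le> qP * 54 + 50 \<and>
     (R = {} \<and> reg s'' ''cnt'' = int c \<and> arr s'' ''ord'' = arr s' ''ord'' \<and> arr s'' ''T'' = arr s' ''T'' \<or>
      (\<exists>i\<in>R. (\<forall>r\<in>R. ?e i \<le> ?e r) \<and> reg s'' ''cnt'' = int (Suc c) \<and>
        arr s'' ''ord'' = (arr s' ''ord'')(c := int i) \<and> tournament ?e (arr s'' ''T'') (R - {i})))"
      then consider "R = {}" "J R c f s''"
        | i where "i \<in> R" "\<forall>r\<in>R. ?e i \<le> ?e r" "reg s'' ''cnt'' = int (Suc c)"
          "arr s'' ''ord'' = (arr s' ''ord'')(c := int i)" "tournament ?e (arr s'' ''T'') (R - {i})"
        using J by (auto simp: J_def)
      then have "?I (Suc u) s''"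
      proof cases
        case 1
        then show ?thesis using c by (intro exI[of _ R] exI[of _ c] exI[of _ f]) simp
      next
        case 2
        have "J (R - {i}) (Suc c) (f(c := i)) s''"
          using J 2 R unfolding J_def by (auto simp: less_Suc_eq)
        moreover have "card (R - {i}) \<le> n - Suc u" using card 2(1) fR by (simp add: card_Diff_singleton)
        ultimately show ?thesis using c by (intro exI[of _ "R - {i}"] exI[of _ "Suc c"] exI[of _ "f(c := i)"]) simp
      qed
      then show "t \<le> qP * 54 + 50 \<and> ?I (Suc u) s''" using post by blast
    qed
  next
    case (10 t s')
    have "qP * 54 + 50 + 8 = qP * 54 + 58" by simp
    then show ?case using 10(1,2) by (simp only:)
  qed (use s1 in \<open>auto simp: env_def wd_rules\<close>)
  show ?thesis
    unfolding sort_prog_def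
  proof (subst runs_Seq, rule runs_conseq[OF build_prog[OF env xe xm]], goal_cases)
    case (3 t1 s1)
    note un = 3(2)
    have env1: "env s1" by (rule env_unchanged[OF env un]) (auto simp: env_regs_def)
    have xe1: "arr s1 ''xe'' = ?e" using unchanged_arr[OF un] by simp
    let ?s2 = "s1\<lparr>reg := (reg s1)(''cnt'' := 0)\<rparr>"
    have l: "runs L (For ''i'' ''n'' extract_prog) ?s2 (\<lambda>t s'. t \<le> n * (qP * 54 + 58) + 6 \<and> ?I n s')"
      by (rule loop) (use env1 xe1 3(1) in \<open>simp_all add: env_def R0_def\<close>)
    show ?case
    proof (subst runs_Seq, subst runs_Assign, intro conjI, simp, simp only: expr_val.simps, rule runs_conseq[OF l], goal_cases)
      case (1 t s')
      then obtain R c f where J: "J R c f s'" and c: "c \<le> n" and R: "card R \<le> n - n" by blast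
      have "finite R" using J finR0 finite_subset unfolding J_def by blast
      then have "R = {}" using R by simp
      have xx: "arr s' ''xe'' = ?e" "arr s' ''xm'' = arr s ''xm''"
        using unchanged_arr[OF 1(2)] unchanged_arr[OF un] by simp_all
      have "sorted_order s' c f"
        using J c \<open>R = {}\<close> unfolding sorted_order_def J_def R0_def xx by auto
      moreover have "t1 + (expr_cost (Const 0) + 1 + t) \<le> P * 90 + n * (qP * 54 + 58) + 40"
        using conjunct1[OF 1(1)] conjunct1[OF 3(1)] by simp
      ultimately show ?case by blast
    qed
  qed
qed

end

section \<open>Floating-point candidates\<close>

definition fval :: "int \<Rightarrow> int \<Rightarrow> real" where
  "fval m e = real_of_int m * 2 powi e"

lemma float_val_fval: "m \<noteq> 0 \<Longrightarrow> float_val m e = ereal (fval m e)"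
  by (simp add: float_val_def fval_def)

lemma powi_add_nat: "(2::real) powi (e + int d) = 2 ^ d * 2 powi e"
  by (simp add: power_int_add mult.commute)

lemma le_div_iff_int: "0 < c \<Longrightarrow> b \<le> a div c \<longleftrightarrow> b * c \<le> (a::int)"
proof -
  assume c: "0 < c"
  have "b \<le> a div c \<longleftrightarrow> b \<le> \<lfloor>real_of_int a / real_of_int c\<rfloor>" by (simp add: floor_divide_of_int_eq)
  also have "\<dots> \<longleftrightarrow> real_of_int b * real_of_int c \<le> real_of_int a"
    using c by (simp add: le_floor_iff pos_le_divide_eq)
  also have "\<dots> \<longleftrightarrow> real_of_int (b * c) \<le> real_of_int a" by simp
  finally show ?thesis unfolding of_int_le_iff .
qed

text \<open>Aligning by a left shift of \<open>a\<close> would leave the word range, since the gap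
  between the exponents is itself only bounded by a word. Shifting the other mantissa to the right
  loses nothing: \<open>a * 2 ^ d < b\<close> means \<open>a * 2 ^ d \<le> b - 1\<close>, and the
  integer quotient decides this exactly.\<close>

lemma fval_less_iff_ge:
  assumes "e' \<le> e"
  shows "fval a e < fval b e' \<longleftrightarrow> a \<le> (b - 1) div 2 ^ nat (e - e')"
proof -
  define d where "d = nat (e - e')"
  have e: "e = e' + int d" using assms by (simp add: d_def)
  have "fval a e < fval b e' \<longleftrightarrow> (real_of_int a * 2 ^ d) * 2 powi e' < real_of_int b * 2 powi e'"
    unfolding fval_def e powi_add_nat by (simp add: mult_ac)
  also have "\<dots> \<longleftrightarrow> real_of_int a * 2 ^ d < real_of_int b" by simp
  also have "\<dots> \<longleftrightarrow> real_of_int (a * 2 ^ d) < real_of_int b" by simp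
  also have "\<dots> \<longleftrightarrow> a * 2 ^ d \<le> b - 1" unfolding of_int_less_iff by linarith
  also have "\<dots> \<longleftrightarrow> a \<le> (b - 1) div 2 ^ d" by (subst le_div_iff_int) auto
  finally show ?thesis unfolding d_def .
qed

lemma fval_less_iff_le:
  assumes "e \<le> e'"
  shows "fval a e < fval b e' \<longleftrightarrow> a div 2 ^ nat (e' - e) < b"
proof -
  define d where "d = nat (e' - e)"
  have e: "e' = e + int d" using assms by (simp add: d_def)
  have "fval a e < fval b e' \<longleftrightarrow> real_of_int a * 2 powi e < (real_of_int b * 2 ^ d) * 2 powi e"
    unfolding fval_def e powi_add_nat by (simp add: mult_ac)
  also have "\<dots> \<longleftrightarrow> real_of_int a < real_of_int b * 2 ^ d" by simp
  also have "\<dots> \<longleftrightarrow> real_of_int a < real_of_int (b * 2 ^ d)" by simp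
  also have "\<dots> \<longleftrightarrow> \<not> b * 2 ^ d \<le> a" unfolding of_int_less_iff by linarith
  also have "\<dots> \<longleftrightarrow> \<not> b \<le> a div 2 ^ d" by (subst le_div_iff_int) auto
  finally show ?thesis unfolding d_def by linarith
qed

section \<open>Minima of floating-point values; rounding to digits\<close>

context params
begin

definition set_prog :: com where
  "set_prog = Store ''C_man'' (Reg ''kk'') (Reg ''cm'') ;; Store ''C_exp'' (Reg ''kk'') (Reg ''ce'')"

definition update_prog :: com where
  "update_prog =
     Cond (Arr ''C_man'' (Reg ''kk'') \<doteq> Const 0) set_prog
       (Assign ''d'' (Reg ''ce'' \<ominus> Arr ''C_exp'' (Reg ''kk'')) ;;
        Cond (Reg ''d'' \<prec> Const 0)
          (Cond ((Reg ''cm'' \<ggreater> (Const 0 \<ominus> Reg ''d'')) \<prec> Arr ''C_man'' (Reg ''kk'')) set_prog Skip)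
          (Cond (((Arr ''C_man'' (Reg ''kk'') \<ominus> Const 1) \<ggreater> Reg ''d'') \<prec> Reg ''cm'') Skip set_prog))"

lemma written_update [simp]:
  "written_regs update_prog = {''d''}" "written_arrs update_prog = {''C_man'', ''C_exp''}"
  by (auto simp: update_prog_def set_prog_def)

definition C_words :: "state \<Rightarrow> bool" where
  "C_words s \<longleftrightarrow> (\<forall>k<n. 0 \<le> arr s ''C_man'' k \<and> wd 6 (arr s ''C_man'' k) \<and> wd 6 (arr s ''C_exp'' k))"

lemma update_prog:
  assumes k: "reg s ''kk'' = int k" "k < n" and C: "C_words s"
    and cm: "reg s ''cm'' = m" "0 < m" "wd 6 m" and ce: "reg s ''ce'' = e" "wd 6 e"
  shows "runs L update_prog s (\<lambda>t s'. t \<le> 40 \<and> C_words s' \<and>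
     output_seq s' = (output_seq s)(k := min (output_seq s k) (ereal (fval m e))))"
proof -
  let ?m = "arr s ''C_man'' k" and ?e = "arr s ''C_exp'' k"
  have w: "wd a ?m" "wd a ?e" "wd a m" "wd a e" if "6 \<le> a" for a
    using C k cm ce wd_mono[OF _ that] by (auto simp: C_words_def)
  have m0: "0 \<le> ?m" using C k by (simp add: C_words_def)
  have wk: "wd a (int k)" if "3 \<le> a" for a using that k le_N(1) by (intro wd_nat) auto
  define s1 where "s1 = s\<lparr>arr := (arr s)(''C_man'' := (arr s ''C_man'')(k := m), ''C_exp'' := (arr s ''C_exp'')(k := e))\<rparr>"
  have cand: "C_words s1" "output_seq s1 = (output_seq s)(k := ereal (fval m e))"
    using C cm ce by (auto simp: C_words_def s1_def output_seq_def fun_eq_iff float_val_fval)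
  have irrel: "C_words (x\<lparr>reg := r\<rparr>) = C_words x" "output_seq (x\<lparr>reg := r\<rparr>) = output_seq x" for x :: state and r
    by (auto simp: C_words_def output_seq_def fun_eq_iff)
  have set: "runs L set_prog x (\<lambda>t s'. t = 6 \<and> s' = x\<lparr>arr := arr s1\<rparr>)"
    if "arr x = arr s" "reg x ''kk'' = int k" "reg x ''cm'' = m" "reg x ''ce'' = e" for x
    unfolding set_prog_def using that w wk by (simp add: s1_def)
  let ?P = "\<lambda>s'. C_words s' \<and> output_seq s' = (output_seq s)(k := min (output_seq s k) (ereal (fval m e)))"
  have keep: "?P x" if "arr x = arr s" "output_seq s k \<le> ereal (fval m e)" for x
    using that C by (auto simp: C_words_def output_seq_def fun_eq_iff min_absorb1)
  have upd: "?P x" if "arr x = arr s1" "ereal (fval m e) \<le> output_seq s k" for x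
  proof -
    have "C_words x = C_words s1" "output_seq x = output_seq s1"
      using that(1) by (auto simp: C_words_def output_seq_def fun_eq_iff)
    then show ?thesis using cand that(2) by (simp add: min_absorb2)
  qed
  show ?thesis
  proof (cases "?m = 0")
    case True
    then have "output_seq s k = \<infinity>" by (simp add: output_seq_def float_val_def)
    then show ?thesis
      unfolding update_prog_def using True k w wk
      apply simp
      apply (rule runs_conseq[OF set])
      using k cm ce upd by auto
  next
    case False
    have old: "output_seq s k = ereal (fval ?m ?e)" using False by (simp add: output_seq_def float_val_fval)
    let ?s2 = "s\<lparr>reg := (reg s)(''d'' := e - ?e)\<rparr>"
    have setd: "runs L set_prog ?s2 (\<lambda>t s'. t = 6 \<and> s' = ?s2\<lparr>arr := arr s1\<rparr>)"
      by (rule set) (use k cm ce in simp_all)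
    show ?thesis
    proof (cases "e < ?e")
      case True
      show ?thesis
      proof (cases "m div 2 ^ nat (?e - e) < ?m")
        case c: True
        then have lt: "fval m e < fval ?m ?e" using True by (simp add: fval_less_iff_le)
        show ?thesis
          unfolding update_prog_def using False True c k cm ce w wk
          apply (simp add: wd_rules)
          apply (rule runs_conseq[OF setd])
          using upd old lt by auto
      next
        case c: False
        then have "\<not> fval m e < fval ?m ?e" using True by (simp add: fval_less_iff_le)
        then have "?P ?s2" by (intro keep) (simp_all add: old)
        then show ?thesis
          unfolding update_prog_def using False True c k cm ce w wk
          by (simp add: wd_rules)
      qed
    next
      case ge: False
      show ?thesis
      proof (cases "(?m - 1) div 2 ^ nat (e - ?e) < m")
        case c: True
        then have "\<not> fval m e < fval ?m ?e" using ge by (simp add: fval_less_iff_ge)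
        then have "?P ?s2" by (intro keep) (simp_all add: old)
        then show ?thesis
          unfolding update_prog_def using False ge c k cm ce w wk
          by (simp add: wd_rules)
      next
        case c: False
        then have lt: "fval m e < fval ?m ?e" using ge by (simp add: fval_less_iff_ge)
        show ?thesis
          unfolding update_prog_def using False ge c k cm ce w wk
          apply (simp add: wd_rules)
          apply (rule runs_conseq[OF setd])
          using upd old lt by auto
      qed
    qed
  qed
qed

text \<open>The value \<open>m * 2 powi e\<close> in multiples of \<open>unit \<alpha>\<close>,
  rounded down. For \<open>e \<le> \<alpha>\<close> the value is below
  \<open>2 powi (p + \<alpha>)\<close>, which is \<open>2 ^ K\<close> units. The left shift by the
  small amount \<open>K\<close> comes first, so the possibly huge shift is always to the
  right.\<close>

definition digit :: "int \<Rightarrow> int \<Rightarrow> int \<Rightarrow> int" where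
  "digit \<alpha> m e = (m * 2 ^ K) div 2 ^ nat (int p + \<alpha> - e)"

definition unit :: "int \<Rightarrow> real" where
  "unit \<alpha> = 2 powi (int p + \<alpha> - int K)"

lemma unit_pos: "0 < unit \<alpha>"
  by (simp add: unit_def)

lemma fval_digit:
  assumes "e \<le> \<alpha>"
  shows "of_int (digit \<alpha> m e) * unit \<alpha> \<le> fval m e" "fval m e \<le> (of_int (digit \<alpha> m e) + 1) * unit \<alpha>"
proof -
  define d where "d = nat (int p + \<alpha> - e)"
  have "int p + \<alpha> - int K + int K = e + int d" using assms by (simp add: d_def)
  then have "(2::real) ^ K * unit \<alpha> = 2 ^ d * 2 powi e"
    unfolding unit_def powi_add_nat[symmetric] by (simp add: add.commute)
  then have "fval m e = (real_of_int (m * 2 ^ K) / real_of_int (2 ^ d)) * unit \<alpha>"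
    by (simp add: fval_def field_simps)
  note eq = this
  have r: "of_int (digit \<alpha> m e) \<le> real_of_int (m * 2 ^ K) / real_of_int (2 ^ d)"
    "real_of_int (m * 2 ^ K) / real_of_int (2 ^ d) \<le> of_int (digit \<alpha> m e) + 1"
    using of_int_div_bounds[of "2 ^ d" "m * 2 ^ K"] unfolding digit_def d_def[symmetric] by simp_all
  show "of_int (digit \<alpha> m e) * unit \<alpha> \<le> fval m e" "fval m e \<le> (of_int (digit \<alpha> m e) + 1) * unit \<alpha>"
    unfolding eq using r unit_pos[of \<alpha>] by (simp_all only: mult_right_mono less_imp_le)
qed

lemma digit_bounds:
  assumes "e \<le> \<alpha>" "0 \<le> m" "m < 2 ^ p"
  shows "0 \<le> digit \<alpha> m e" "digit \<alpha> m e < 2 ^ K"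
proof -
  define d where "d = nat (int p + \<alpha> - e)"
  show "0 \<le> digit \<alpha> m e" using assms unfolding digit_def by (intro div_int_pos_iff[THEN iffD2]) simp
  have "\<not> 2 ^ K * 2 ^ d \<le> m * 2 ^ K"
  proof -
    have "(2::int) ^ p \<le> 2 ^ d" using assms by (intro power_increasing) (auto simp: d_def)
    then have "m < 2 ^ d" using assms by linarith
    then show ?thesis by simp
  qed
  then have "\<not> 2 ^ K \<le> (m * 2 ^ K) div 2 ^ d" by (subst le_div_iff_int) auto
  then show "digit \<alpha> m e < 2 ^ K" unfolding digit_def d_def by simp
qed

text \<open>A normalized mantissa at the reference exponent fills at least half of the
  \<open>2 ^ K\<close> units. This is the only source of relative accuracy; at smaller exponents the
  digit may even be 0.\<close>

lemma digit_top:
  assumes "2 ^ (p - 1) \<le> m" "1 \<le> p" shows "2 ^ (K - 1) \<le> digit \<alpha> m \<alpha>"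
proof -
  have "(2::int) ^ (K - 1) * 2 ^ p = 2 ^ (p - 1) * 2 ^ K"
    using K6 assms(2) by (simp flip: power_add)
  also have "\<dots> \<le> m * 2 ^ K" using assms(1) by (intro mult_right_mono) auto
  finally show ?thesis unfolding digit_def by (subst le_div_iff_int) auto
qed

text \<open>Both digits are below \<open>2 ^ K\<close>, so their sum is below \<open>M\<close> and
  cannot carry. A single position of the convolution thus determines both the output index and the
  rounded sum.\<close>

lemma digit_decode:
  fixes a b :: int
  assumes "0 \<le> a" "a < 2 ^ K" "0 \<le> b" "b < 2 ^ K" "s < M"
  shows "(i * M + nat a) + (j * M + nat b) = k * M + s \<longleftrightarrow> i + j = k \<and> a + b = int s"
proof -
  have ab: "nat a + nat b < M"
  proof -
    have "a + b < 2 * 2 ^ K" using assms by linarith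
    then have "int (nat a + nat b) < int M" using assms by (simp add: M_def)
    then show ?thesis by (simp only: of_nat_less_iff)
  qed
  have e: "(i * M + nat a) + (j * M + nat b) = (i + j) * M + (nat a + nat b)" by (simp add: algebra_simps)
  show ?thesis
  proof
    assume l: "(i * M + nat a) + (j * M + nat b) = k * M + s"
    then have l': "(i + j) * M + (nat a + nat b) = k * M + s" unfolding e .
    have "((i + j) * M + (nat a + nat b)) div M = i + j" "(k * M + s) div M = k"
      using ab assms(5) by simp_all
    then have "i + j = k" unfolding l' by simp
    then show "i + j = k \<and> a + b = int s" using l' assms by auto
  next
    assume "i + j = k \<and> a + b = int s"
    then show "(i * M + nat a) + (j * M + nat b) = k * M + s" unfolding e using assms by (auto simp: nat_add_distrib[symmetric])
  qed
qed

end

section \<open>Processing a group of indices\<close>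

text \<open>The \<open>x\<close> sequence supplies the summand with the larger exponent. The exact
  convolution enters only through the lower bound \<open>lb\<close>, which is the same function when
  the roles of the sequences are exchanged, so both passes can share it.\<close>

locale pair_inst = params +
  fixes xm xe ym ye :: "nat \<Rightarrow> int" and lb :: "nat \<Rightarrow> ereal"
  assumes p1: "1 \<le> p"
    and x: "\<And>i. i < n \<Longrightarrow> xm i = 0 \<or> 2 ^ (p - 1) \<le> xm i \<and> xm i < 2 ^ p"
      "\<And>i. i < n \<Longrightarrow> wd 0 (xm i)" "\<And>i. i < n \<Longrightarrow> wd 0 (xe i)"
    and y: "\<And>i. i < n \<Longrightarrow> ym i = 0 \<or> 2 ^ (p - 1) \<le> ym i \<and> ym i < 2 ^ p"
      "\<And>i. i < n \<Longrightarrow> wd 0 (ym i)" "\<And>i. i < n \<Longrightarrow> wd 0 (ye i)"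
    and lb: "\<And>i j. i + j < n \<Longrightarrow> xm i \<noteq> 0 \<Longrightarrow> ym j \<noteq> 0 \<Longrightarrow>
      lb (i + j) \<le> ereal (fval (xm i) (xe i) + fval (ym j) (ye j))"
begin

definition inp :: "state \<Rightarrow> bool" where
  "inp s \<longleftrightarrow> (\<forall>i<n. arr s ''xm'' i = xm i \<and> arr s ''xe'' i = xe i \<and> arr s ''ym'' i = ym i \<and> arr s ''ye'' i = ye i)"

lemma inp_unchanged:
  "inp s \<Longrightarrow> unchanged X Y s s' \<Longrightarrow> Y \<inter> {''xm'', ''xe'', ''ym'', ''ye''} = {} \<Longrightarrow> inp s'"
  by (auto simp: inp_def unchanged_def)

definition sum :: "nat \<Rightarrow> nat \<Rightarrow> real" where
  "sum i j = fval (xm i) (xe i) + fval (ym j) (ye j)"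

abbreviation dx where "dx \<alpha> i \<equiv> digit \<alpha> (xm i) (xe i)"
abbreviation dy where "dy \<alpha> j \<equiv> digit \<alpha> (ym j) (ye j)"

lemma nonneg: "i < n \<Longrightarrow> 0 \<le> xm i" "i < n \<Longrightarrow> xm i < 2 ^ p" "i < n \<Longrightarrow> 0 \<le> ym i" "i < n \<Longrightarrow> ym i < 2 ^ p"
proof -
  have "(0::int) \<le> 2 ^ (p - 1)" by simp
  then show "i < n \<Longrightarrow> 0 \<le> xm i" "i < n \<Longrightarrow> 0 \<le> ym i" using x(1)[of i] y(1)[of i] by linarith+
  show "i < n \<Longrightarrow> xm i < 2 ^ p" "i < n \<Longrightarrow> ym i < 2 ^ p" using x(1)[of i] y(1)[of i] by auto
qed

lemma dx_bounds: "i < n \<Longrightarrow> xe i \<le> \<alpha> \<Longrightarrow> 0 \<le> dx \<alpha> i" "i < n \<Longrightarrow> xe i \<le> \<alpha> \<Longrightarrow> dx \<alpha> i < 2 ^ K"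
  and dy_bounds: "i < n \<Longrightarrow> ye i \<le> \<alpha> \<Longrightarrow> 0 \<le> dy \<alpha> i" "i < n \<Longrightarrow> ye i \<le> \<alpha> \<Longrightarrow> dy \<alpha> i < 2 ^ K"
  using nonneg digit_bounds by blast+

text \<open>Each of the two digits loses less than one unit by rounding down; adding 2 makes the
  candidate an upper bound for the actual sum.\<close>

definition cand :: "int \<Rightarrow> int \<Rightarrow> real" where
  "cand \<alpha> s = fval (s + 2) (int p + \<alpha> - int K)"

lemma cand_eq: "cand \<alpha> s = (of_int s + 2) * unit \<alpha>"
  by (simp add: cand_def fval_def unit_def)

lemma cand_mono: "s \<le> s' \<Longrightarrow> cand \<alpha> s \<le> cand \<alpha> s'"
  unfolding cand_eq using unit_pos[of \<alpha>] by (intro mult_right_mono) auto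

lemma cand_ge_sum:
  assumes "xe i \<le> \<alpha>" "ye j \<le> \<alpha>" shows "sum i j \<le> cand \<alpha> (dx \<alpha> i + dy \<alpha> j)"
  using fval_digit(2)[OF assms(1), of "xm i"] fval_digit(2)[OF assms(2), of "ym j"]
  unfolding sum_def cand_eq by (simp add: algebra_simps)

text \<open>The candidate exceeds the sum by at most 2 units. Since \<open>xe i\<close> is the
  reference exponent, the digit of \<open>xm i\<close> is at least \<open>2 ^ (K - 1)\<close>, so
  these 2 units are at most a fraction \<open>4 / 2 ^ K\<close> of the sum.\<close>

lemma cand_le_sum:
  assumes "i < n" "j < n" "xm i \<noteq> 0" "xe i = \<alpha>" "ye j \<le> \<alpha>"
  shows "cand \<alpha> (dx \<alpha> i + dy \<alpha> j) \<le> (1 + 4 / 2 ^ K) * sum i j"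
proof -
  have "2 ^ (K - 1) \<le> dx \<alpha> i" using digit_top[of "xm i" \<alpha>] x(1)[OF assms(1)] p1 assms by simp
  then have "real_of_int (2 ^ (K - 1)) \<le> real_of_int (dx \<alpha> i)" by (simp only: of_int_le_iff)
  then have "2 ^ (K - 1) \<le> real_of_int (dx \<alpha> i)" by simp
  moreover have "(2::real) ^ K = 2 * 2 ^ (K - 1)" using K6 by (simp flip: power_Suc)
  ultimately have "2 \<le> 4 / 2 ^ K * real_of_int (dx \<alpha> i)" by (simp add: field_simps)
  then have "2 * unit \<alpha> \<le> 4 / 2 ^ K * real_of_int (dx \<alpha> i) * unit \<alpha>"
    using unit_pos[of \<alpha>] by (intro mult_right_mono) auto
  also have "\<dots> = 4 / 2 ^ K * (real_of_int (dx \<alpha> i) * unit \<alpha>)" by simp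
  also have "\<dots> \<le> 4 / 2 ^ K * sum i j"
  proof (rule mult_left_mono)
    have "0 \<le> real_of_int (dy \<alpha> j) * unit \<alpha>"
      using dy_bounds(1)[OF assms(2,5)] unit_pos[of \<alpha>] by simp
    then show "real_of_int (dx \<alpha> i) * unit \<alpha> \<le> sum i j"
      using fval_digit(1)[of "xe i" \<alpha> "xm i"] fval_digit(1)[OF assms(5), of "ym j"] assms(4) unfolding sum_def by simp
  qed simp
  finally have "2 * unit \<alpha> \<le> 4 / 2 ^ K * sum i j" .
  moreover have "of_int (dx \<alpha> i + dy \<alpha> j) * unit \<alpha> \<le> sum i j"
    using fval_digit(1)[of "xe i" \<alpha> "xm i"] fval_digit(1)[OF assms(5), of "ym j"] assms(4) unfolding sum_def
    by (simp add: algebra_simps)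
  ultimately show ?thesis unfolding cand_eq by (simp add: algebra_simps)
qed

text \<open>Holds without any accuracy: the two digits sum to at most \<open>2 * 2 ^ K - 2\<close>,
  so even after adding 2 the candidate is at most \<open>2 ^ (K + 1)\<close> units. Hence any hit of
  a group bounds the output in terms of the top exponent.\<close>

lemma cand_le_pow:
  assumes "i < n" "j < n" "xe i \<le> \<alpha>" "ye j \<le> \<alpha>"
  shows "cand \<alpha> (dx \<alpha> i + dy \<alpha> j) \<le> 2 powi (int p + \<alpha> + 1)"
proof -
  have "dx \<alpha> i + dy \<alpha> j + 2 \<le> 2 ^ (K + 1)"
    using dx_bounds(2)[OF assms(1,3)] dy_bounds(2)[OF assms(2,4)] by simp
  then have "real_of_int (dx \<alpha> i + dy \<alpha> j + 2) \<le> real_of_int (2 ^ (K + 1))" by (simp only: of_int_le_iff)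
  then have "cand \<alpha> (dx \<alpha> i + dy \<alpha> j) \<le> 2 ^ (K + 1) * unit \<alpha>"
    unfolding cand_eq using unit_pos[of \<alpha>] by (intro mult_right_mono) auto
  also have "\<dots> = 2 powi (int p + \<alpha> - int K + int (K + 1))"
    unfolding powi_add_nat unit_def by simp
  finally show ?thesis by (simp add: algebra_simps)
qed

text \<open>A normalized mantissa gives \<open>xm i\<close> at least the value
  \<open>2 powi (p - 1 + xe i)\<close>. Two exponent classes above \<open>\<alpha>\<close> this
  reaches the bound of \<open>cand_le_pow\<close>, which is why just two classes have to be watched
  for every output position.\<close>

lemma sum_ge_pow:
  assumes "i < n" "j < n" "xm i \<noteq> 0" "\<alpha> + 2 \<le> xe i" shows "2 powi (int p + \<alpha> + 1) \<le> sum i j"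
proof -
  have "real_of_int (2 ^ (p - 1)) \<le> real_of_int (xm i)"
    using x(1)[OF assms(1)] assms(3) by (simp only: of_int_le_iff) simp
  then have "2 ^ (p - 1) * 2 powi (xe i) \<le> fval (xm i) (xe i)"
    unfolding fval_def by (intro mult_right_mono) auto
  moreover have "(2::real) ^ (p - 1) * 2 powi (xe i) = 2 powi (xe i + int (p - 1))" unfolding powi_add_nat ..
  moreover have "(2::real) powi (int p + \<alpha> + 1) \<le> 2 powi (xe i + int (p - 1))"
    using assms(4) p1 by (intro power_int_increasing) auto
  moreover have "0 \<le> fval (ym j) (ye j)" using nonneg(3)[OF assms(2)] by (simp add: fval_def)
  ultimately show ?thesis unfolding sum_def by linarith
qed

lemma wd_xy:
  assumes "i < n" shows "wd k (xm i)" "wd k (xe i)" "wd k (ym i)" "wd k (ye i)"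
  using x(2,3)[OF assms] y(2,3)[OF assms] wd_mono by blast+

lemma wd_2K: "3 \<le> k \<Longrightarrow> wd k (2 ^ K)"
  using wd_nat[OF le_N(8)] by simp

definition head_prog :: com where
  "head_prog =
     Assign ''t0'' (Reg ''tt'' \<otimes> Reg ''S'') ;;
     Assign ''t1'' (Reg ''t0'' \<oplus> Reg ''S'') ;;
     Cond (Reg ''cnt'' \<prec> Reg ''t1'') (Assign ''t1'' (Reg ''cnt'')) Skip ;;
     Assign ''ea'' (Arr ''xe'' (Arr ''ord'' (Reg ''t1'' \<ominus> Const 1))) ;;
     Assign ''e0'' (Arr ''xe'' (Arr ''ord'' (Reg ''t0'')))"

definition clear_prog :: com where
  "clear_prog =
     For ''x'' ''N''
       (Store ''ar'' (Reg ''x'') (Const 0) ;; Store ''ai'' (Reg ''x'') (Const 0) ;;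
        Store ''br'' (Reg ''x'') (Const 0) ;; Store ''bi'' (Reg ''x'') (Const 0))"

definition fill_x_prog :: com where
  "fill_x_prog =
     For ''x'' ''S''
       (Assign ''y'' (Reg ''t0'' \<oplus> Reg ''x'') ;;
        Cond (Reg ''y'' \<prec> Reg ''cnt'')
          (Assign ''i'' (Arr ''ord'' (Reg ''y'')) ;;
           Store ''ar'' (Reg ''i'' \<otimes> Reg ''M'' \<oplus>
             ((Arr ''xm'' (Reg ''i'') \<lless> Reg ''K'') \<ggreater> (Reg ''p'' \<oplus> Reg ''ea'' \<ominus> Arr ''xe'' (Reg ''i'')))) (Reg ''Q''))
          Skip)"

definition fill_y_prog :: com where
  "fill_y_prog =
     For ''j'' ''n''
       (Cond (Arr ''ym'' (Reg ''j'') \<doteq> Const 0) Skip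
          (Cond (Reg ''ea'' \<prec> Arr ''ye'' (Reg ''j'')) Skip
            (Store ''br'' (Reg ''j'' \<otimes> Reg ''M'' \<oplus>
              ((Arr ''ym'' (Reg ''j'') \<lless> Reg ''K'') \<ggreater> (Reg ''p'' \<oplus> Reg ''ea'' \<ominus> Arr ''ye'' (Reg ''j'')))) (Reg ''Q''))))"

lemma written_fill [simp]:
  "written_regs head_prog = {''t0'', ''t1'', ''ea'', ''e0''}" "written_arrs head_prog = {}"
  "written_regs clear_prog = {''x''}" "written_arrs clear_prog = {''ar'', ''ai'', ''br'', ''bi''}"
  "written_regs fill_x_prog = {''x'', ''y'', ''i''}" "written_arrs fill_x_prog = {''ar''}"
  "written_regs fill_y_prog = {''j''}" "written_arrs fill_y_prog = {''br''}"
  by (auto simp: head_prog_def clear_prog_def fill_x_prog_def fill_y_prog_def)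

definition order :: "nat \<Rightarrow> (nat \<Rightarrow> nat) \<Rightarrow> bool" where
  "order c f \<longleftrightarrow> c \<le> n \<and> (\<forall>z<c. f z < n \<and> xm (f z) \<noteq> 0) \<and>
     (\<forall>i<n. xm i \<noteq> 0 \<longrightarrow> (\<exists>z<c. f z = i)) \<and>
     (\<forall>y z. y \<le> z \<and> z < c \<longrightarrow> xe (f y) \<le> xe (f z))"

definition ordered :: "state \<Rightarrow> nat \<Rightarrow> (nat \<Rightarrow> nat) \<Rightarrow> bool" where
  "ordered s c f \<longleftrightarrow> reg s ''cnt'' = int c \<and> (\<forall>z<c. arr s ''ord'' z = int (f z))"

definition hi where "hi c t = min (t * S + S) c"
definition top_exp where "top_exp c f t = xe (f (hi c t - 1))"
definition bot_exp where "bot_exp f t = xe (f (t * S))"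

lemma head_prog:
  assumes env: "env s" and inp: "inp s" and ord: "ordered s c f" and f: "order c f"
    and t: "reg s ''tt'' = int t" "t * S < c"
  shows "runs L head_prog s (\<lambda>k s'. k \<le> 30 \<and> reg s' ''t0'' = int (t * S) \<and>
     reg s' ''ea'' = top_exp c f t \<and> reg s' ''e0'' = bot_exp f t)"
proof -
  have c: "c \<le> n" using f by (simp add: order_def)
  have fz: "f z < n" if "z < c" for z using f that by (simp add: order_def)
  have tS: "t \<le> N" "t * S \<le> N"
  proof -
    show "t * S \<le> N" using t c le_N(1) by simp
    moreover have "1 \<le> S" using pos(4) by linarith
    then have "t * 1 \<le> t * S" by (rule mult_le_mono2)
    ultimately show "t \<le> N" by linarith
  qed
  have hi: "hi c t \<ge> 1" "hi c t \<le> c" "hi c t - 1 < c" using t pos(4) unfolding hi_def by linarith+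
  have regs: "reg s ''S'' = int S" "reg s ''cnt'' = int c" using env ord by (auto simp: env_def ordered_def)
  have o: "arr s ''ord'' z = int (f z)" if "z < c" for z using ord that by (simp add: ordered_def)
  have xe': "arr s ''xe'' i = xe i" if "i < n" for i using inp that by (simp add: inp_def)
  have w: "wd k (int t)" "wd k (int (t * S))" "wd k (int S)" "wd k (int c)" "wd k (int (hi c t))" if "3 \<le> k" for k
    using that tS le_N c hi by - (rule wd_nat; linarith)+
  have wf: "wd k (int (f z))" if "3 \<le> k" "z < c" for k z
    using that fz[OF that(2)] le_N(1) by (intro wd_nat) auto
  have idx: "nat (int (hi c t) - 1) = hi c t - 1" by simp
  let ?s2 = "s\<lparr>reg := (reg s)(''t0'' := int (t * S), ''t1'' := int (t * S) + int S)\<rparr>"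
  have clip: "runs L (Cond (Reg ''cnt'' \<prec> Reg ''t1'') (Assign ''t1'' (Reg ''cnt'')) Skip) ?s2
     (\<lambda>k s'. k \<le> 6 \<and> s' = s\<lparr>reg := (reg s)(''t0'' := int (t * S), ''t1'' := int (hi c t))\<rparr>)"
  proof (cases "c < t * S + S")
    case True
    have "int c < int (t * S + S)" using True by (simp only: of_nat_less_iff)
    moreover have "hi c t = c" using True by (simp add: hi_def)
    ultimately show ?thesis using regs w by (simp add: wd_rules del: of_nat_mult)
  next
    case False
    have "\<not> int c < int (t * S + S)" unfolding of_nat_less_iff by (rule False)
    moreover have "int (hi c t) = int (t * S) + int S" using False by (simp add: hi_def)
    ultimately show ?thesis using regs w by (simp add: wd_rules del: of_nat_mult)
  qed
  show ?thesis
    unfolding head_prog_def runs_Seq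
    apply (rule runs_Assign_val[where v = "int (t * S)"])
      apply (use t regs w in \<open>simp add: wd_rules\<close>)
     apply (use t regs in simp)
    apply (rule runs_Assign_val[where v = "int (t * S) + int S"])
      apply (use t regs w in \<open>simp add: wd_rules\<close>)
     apply (use t regs in simp)
    apply (simp del: of_nat_mult runs_Cond runs_Assign)
    apply (rule runs_conseq[OF clip])
    using w wf[OF _ hi(3)] wf[OF _ t(2)] hi o[OF hi(3)] o[OF t(2)] xe'[OF fz[OF hi(3)]] xe'[OF fz[OF t(2)]]
      wd_xy(2)[OF fz[OF hi(3)]] wd_xy(2)[OF fz[OF t(2)]] idx
    by (auto simp: wd_rules top_exp_def bot_exp_def simp del: of_nat_mult)
qed

lemma clear_prog:
  assumes env: "env s"
  shows "runs L clear_prog s (\<lambda>t s'. t \<le> N * 20 + 6 \<and>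
     (\<forall>z<N. arr s' ''ar'' z = 0 \<and> arr s' ''ai'' z = 0 \<and> arr s' ''br'' z = 0 \<and> arr s' ''bi'' z = 0))"
  unfolding clear_prog_def
proof (rule runs_For[where m = N and T = 12 and I = "\<lambda>m s'. \<forall>z<m. arr s' ''ar'' z = 0 \<and> arr s' ''ai'' z = 0 \<and> arr s' ''br'' z = 0 \<and> arr s' ''bi'' z = 0"], goal_cases)
  case (9 z s')
  then show ?case by (auto simp: wd_rules less_Suc_eq)
qed (use env in \<open>auto simp: env_def wd_rules\<close>)

definition PA where
  "PA \<alpha> f a b = {f z * M + nat (dx \<alpha> (f z)) |z. a \<le> z \<and> z < b}"

text \<open>Elements above \<open>\<alpha>\<close> exceed every exponent of the group and are left
  to the exchanged pass. Elements between the exponent of a particular \<open>x\<close> entry and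
  \<open>\<alpha>\<close> stay in: they produce candidates for genuine sums, so they can only lower
  the output legitimately.\<close>

definition PB where
  "PB \<alpha> b = {j * M + nat (dy \<alpha> j) |j. j < b \<and> ym j \<noteq> 0 \<and> ye j \<le> \<alpha>}"

lemma fill_x_prog:
  assumes env: "env s" and inp: "inp s" and ord: "ordered s c f" and f: "order c f"
    and t: "reg s ''t0'' = int (t * S)" "t * S < c" "reg s ''ea'' = top_exp c f t"
    and clr: "\<forall>z<N. arr s ''ar'' z = 0"
  shows "runs L fill_x_prog s (\<lambda>k s'. k \<le> S * 50 + 6 \<and>
     (\<forall>z<N. arr s' ''ar'' z = (if z \<in> PA (top_exp c f t) f (t * S) (hi c t) then Q else 0)))"
proof -
  let ?\<alpha> = "top_exp c f t"
  have c: "c \<le> n" using f by (simp add: order_def)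
  have fz: "f z < n" if "z < c" for z using f that by (simp add: order_def)
  have hi: "hi c t \<ge> 1" "hi c t \<le> c" "hi c t - 1 < c" using t pos(4) unfolding hi_def by linarith+
  have le_top: "xe (f z) \<le> ?\<alpha>" if "z < hi c t" for z
    using f that hi unfolding order_def top_exp_def by (metis Suc_diff_1 Suc_leI less_Suc_eq_le order_less_le_trans zero_less_one)
  have \<alpha>w: "wd k ?\<alpha>" for k unfolding top_exp_def by (rule wd_xy(2)[OF fz[OF hi(3)]])
  show ?thesis unfolding fill_x_prog_def
  proof (rule runs_For[where m = S and T = 42 and I = "\<lambda>m s'. \<forall>z<N. arr s' ''ar'' z =
       (if z \<in> PA ?\<alpha> f (t * S) (min (t * S + m) c) then Q else 0)"], goal_cases)
    case 8
    then show ?case using clr by (auto simp: PA_def)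
  next
    case (9 m s')
    have regs: "reg s' ''cnt'' = int c" "reg s' ''t0'' = int (t * S)" "reg s' ''ea'' = ?\<alpha>"
      "reg s' ''M'' = int M" "reg s' ''K'' = int K" "reg s' ''p'' = int p" "reg s' ''Q'' = Q"
      using unchanged_reg[OF 9(4)] env ord t by (simp_all add: env_def ordered_def)
    define z where "z = t * S + m"
    have z: "int (t * S) + int m = int z" by (simp add: z_def)
    have w: "wd k (int m)" "wd k (int (t * S))" "wd k (int c)" if "3 \<le> k" for k
      using that 9(1) t(2) c le_N by - (rule wd_nat; linarith)+
    have wz: "wd 10 (int z)" unfolding z[symmetric] using w by (simp add: wd_rules)
    show ?case
    proof (cases "z < c")
      case True
      have zhi: "z < hi c t" using True 9(1) by (simp add: hi_def z_def)
      let ?i = "f z"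
      note i = fz[OF True]
      have arrs: "arr s' ''ord'' z = int ?i" "arr s' ''xm'' ?i = xm ?i" "arr s' ''xe'' ?i = xe ?i"
        using unchanged_arr[OF 9(4)] ord inp True i by (simp_all add: inp_def ordered_def)
      have d: "0 \<le> dx ?\<alpha> ?i" "dx ?\<alpha> ?i < 2 ^ K" using dx_bounds[OF i le_top[OF zhi]] by auto
      have wi: "wd k (int ?i)" if "3 \<le> k" for k using that i le_N(1) by (intro wd_nat) auto
      have wdx: "wd k (dx ?\<alpha> ?i)" if "3 \<le> k" for k
        by (rule wd_le[OF wd_2K[OF that]]) (use d in auto)
      have sh: "0 \<le> int p + ?\<alpha> - xe ?i" using le_top[OF zhi] by simp
      have ix: "nat (int ?i * int M + dx ?\<alpha> ?i) = ?i * M + nat (dx ?\<alpha> ?i)"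
        using d(1) by (simp add: nat_add_distrib flip: of_nat_mult)
      have new: "PA ?\<alpha> f (t * S) (min (t * S + Suc m) c) = insert (?i * M + nat (dx ?\<alpha> ?i)) (PA ?\<alpha> f (t * S) (min (t * S + m) c))"
        using True unfolding PA_def z_def by (auto simp: less_Suc_eq min_def split: if_splits)
      show ?thesis
        unfolding runs_Seq
        apply (rule runs_Assign_val[where v = "int z"])
          apply (use regs 9(2) w wz z in \<open>simp del: of_nat_mult\<close>)
         apply (use regs 9(2) z in \<open>simp del: of_nat_mult\<close>)
        using True regs arrs wz w(3) wi wdx wd_xy(1,2)[OF i] \<alpha>w sh d(1)
        apply (simp add: wd_rules wd_2K digit_def[symmetric] ix)
        using 9(3) new by auto
    next
      case False
      have same: "min (t * S + Suc m) c = min (t * S + m) c" using False by (simp add: z_def)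
      show ?thesis
        unfolding runs_Seq
        apply (rule runs_Assign_val[where v = "int z"])
          apply (use regs 9(2) w wz z in \<open>simp del: of_nat_mult\<close>)
         apply (use regs 9(2) z in \<open>simp del: of_nat_mult\<close>)
        using False regs wz w(3) 9(3) same by simp
    qed
  next
    case (10 k s')
    then show ?case by (simp add: hi_def)
  qed (use env in \<open>auto simp: env_def wd_rules\<close>)
qed

lemma fill_y_prog:
  assumes env: "env s" and inp: "inp s" and ea: "reg s ''ea'' = \<alpha>" "\<And>k. wd k \<alpha>"
    and clr: "\<forall>z<N. arr s ''br'' z = 0"
  shows "runs L fill_y_prog s (\<lambda>k s'. k \<le> n * 50 + 6 \<and>
     (\<forall>z<N. arr s' ''br'' z = (if z \<in> PB \<alpha> n then Q else 0)))"
  unfolding fill_y_prog_def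
proof (rule runs_For[where m = n and T = 42 and I = "\<lambda>m s'. \<forall>z<N. arr s' ''br'' z =
     (if z \<in> PB \<alpha> m then Q else 0)"], goal_cases)
  case 8
  then show ?case using clr by (auto simp: PB_def)
next
  case (9 j s')
  have regs: "reg s' ''ea'' = \<alpha>" "reg s' ''M'' = int M" "reg s' ''K'' = int K" "reg s' ''p'' = int p" "reg s' ''Q'' = Q"
    using unchanged_reg[OF 9(4)] env ea by (simp_all add: env_def)
  have arrs: "arr s' ''ym'' j = ym j" "arr s' ''ye'' j = ye j"
    using unchanged_arr[OF 9(4)] inp 9(1) by (simp_all add: inp_def)
  have wi: "wd k (int j)" if "3 \<le> k" for k using that 9(1) le_N(1) by (intro wd_nat) auto
  show ?case
  proof (cases "ym j \<noteq> 0 \<and> ye j \<le> \<alpha>")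
    case True
    have d: "0 \<le> dy \<alpha> j" "dy \<alpha> j < 2 ^ K" using dy_bounds[OF 9(1)] True by auto
    have wdx: "wd k (dy \<alpha> j)" if "3 \<le> k" for k
      by (rule wd_le[OF wd_2K[OF that]]) (use d in auto)
    have ix: "nat (int j * int M + dy \<alpha> j) = j * M + nat (dy \<alpha> j)"
      using d(1) by (simp add: nat_add_distrib flip: of_nat_mult)
    have new: "PB \<alpha> (Suc j) = insert (j * M + nat (dy \<alpha> j)) (PB \<alpha> j)"
      using True unfolding PB_def by (auto simp: less_Suc_eq)
    show ?thesis
      using True regs 9(2) arrs wi wdx wd_xy(3,4)[OF 9(1)] ea(2) d(1)
      apply (simp add: wd_rules wd_2K digit_def[symmetric] ix)
      using 9(3) new by auto
  next
    case False
    then have same: "PB \<alpha> (Suc j) = PB \<alpha> j" unfolding PB_def by (auto simp: less_Suc_eq)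
    show ?thesis
      using False regs 9(2,3) arrs wi wd_xy(3,4)[OF 9(1)] ea(2) same by auto
  qed
qed (use env in \<open>auto simp: env_def wd_rules\<close>)

end

section \<open>Reading off the smallest rounded sum and recording groups\<close>

context params
begin

text \<open>The digit sums are scanned in descending order, so the last assignment leaves the
  smallest one. The register holds this sum plus 1, with 0 for "none". The reduction modulo
  \<open>N\<close> changes the index only for convolution position 0.\<close>

definition scan_prog :: com where
  "scan_prog =
     Assign ''hit'' (Const 0) ;;
     For ''sc'' ''M''
       (Assign ''sv'' (Reg ''M'' \<ominus> Const 1 \<ominus> Reg ''sc'') ;;
        Assign ''ix'' (Reg ''N'' \<ominus> (Reg ''kk'' \<otimes> Reg ''M'' \<oplus> Reg ''sv'')) ;;
        Assign ''ix'' (Reg ''q'' \<otimes> Reg ''N'' \<oplus> (Reg ''ix'' \<ominus> (Reg ''ix'' \<oslash> Reg ''N'') \<otimes> Reg ''N'')) ;;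
        Cond (Reg ''Q'' \<otimes> Reg ''N'' \<prec> Const 2 \<otimes> Arr ''cr'' (Reg ''ix'')) (Assign ''hit'' (Reg ''sv'' \<oplus> Const 1)) Skip)"

lemma written_scan [simp]:
  "written_regs scan_prog = {''hit'', ''sc'', ''sv'', ''ix''}" "written_arrs scan_prog = {}"
  by (auto simp: scan_prog_def)

lemma scan_prog:
  assumes env: "env s" and k: "reg s ''kk'' = int k" "k < n"
    and H: "\<And>t. t < N \<Longrightarrow> wd 7 (arr s ''cr'' (q * N + (N - t) mod N)) \<and>
      (Q * int N < 2 * arr s ''cr'' (q * N + (N - t) mod N) \<longleftrightarrow> H t)"
  shows "runs L scan_prog s (\<lambda>t s'. t \<le> M * 58 + 10 \<and>
     (reg s' ''hit'' = 0 \<and> (\<forall>\<sigma><M. \<not> H (k * M + \<sigma>)) \<or>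
      (\<exists>\<sigma><M. reg s' ''hit'' = int \<sigma> + 1 \<and> H (k * M + \<sigma>) \<and> (\<forall>\<sigma>'<\<sigma>. \<not> H (k * M + \<sigma>')))))"
proof -
  let ?I = "\<lambda>m s'. reg s' ''hit'' = 0 \<and> (\<forall>\<sigma>. M - m \<le> \<sigma> \<and> \<sigma> < M \<longrightarrow> \<not> H (k * M + \<sigma>)) \<or>
      (\<exists>\<sigma>. M - m \<le> \<sigma> \<and> \<sigma> < M \<and> reg s' ''hit'' = int \<sigma> + 1 \<and> H (k * M + \<sigma>) \<and>
        (\<forall>\<sigma>'. M - m \<le> \<sigma>' \<and> \<sigma>' < \<sigma> \<longrightarrow> \<not> H (k * M + \<sigma>')))"
  have loop: "runs L (For ''sc'' ''M''
       (Assign ''sv'' (Reg ''M'' \<ominus> Const 1 \<ominus> Reg ''sc'') ;;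
        Assign ''ix'' (Reg ''N'' \<ominus> (Reg ''kk'' \<otimes> Reg ''M'' \<oplus> Reg ''sv'')) ;;
        Assign ''ix'' (Reg ''q'' \<otimes> Reg ''N'' \<oplus> (Reg ''ix'' \<ominus> (Reg ''ix'' \<oslash> Reg ''N'') \<otimes> Reg ''N'')) ;;
        Cond (Reg ''Q'' \<otimes> Reg ''N'' \<prec> Const 2 \<otimes> Arr ''cr'' (Reg ''ix'')) (Assign ''hit'' (Reg ''sv'' \<oplus> Const 1)) Skip)) s1
     (\<lambda>t s'. t \<le> M * 58 + 6 \<and> ?I M s')"
    if s1: "env s1" "reg s1 ''kk'' = int k" "reg s1 ''hit'' = 0" "arr s1 = arr s" for s1
  proof (rule runs_For[where m = M and T = 50 and I = ?I], goal_cases)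
    case 8
    show ?case using s1 by auto
  next
    case (9 m s')
    define \<sigma> where "\<sigma> = M - 1 - m"
    define t where "t = k * M + \<sigma>"
    have \<sigma>: "\<sigma> < M" "M - m = Suc \<sigma>" "M - Suc m = \<sigma>" "int M - 1 - int m = int \<sigma>" using 9(1) by (auto simp: \<sigma>_def)
    have tN: "t < N"
    proof -
      have "t < (k + 1) * M" using \<sigma> by (simp add: t_def)
      also have "\<dots> \<le> n * M" using k by (intro mult_le_mono1) simp
      finally show ?thesis using nMN by simp
    qed
    have regs: "reg s' ''M'' = int M" "reg s' ''N'' = int N" "reg s' ''q'' = int q" "reg s' ''Q'' = Q" "reg s' ''kk'' = int k"
      and arrs: "arr s' ''cr'' = arr s ''cr''"
      using unchanged_reg[OF 9(4)] unchanged_arr[OF 9(4)] s1 by (simp_all add: env_def)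
    have w: "wd a (int m)" "wd a (int \<sigma>)" "wd a (int k)" "wd a (int t)" "wd a (int (N - t))" "wd a (int ((N - t) mod N))" if "3 \<le> a" for a
    proof -
      have "(N - t) mod N \<le> N" by (simp add: less_imp_le)
      then show "wd a (int m)" "wd a (int \<sigma>)" "wd a (int k)" "wd a (int t)" "wd a (int (N - t))" "wd a (int ((N - t) mod N))"
        using that 9(1) \<sigma> k tN le_N by - (rule wd_nat; linarith)+
    qed
    have v1: "int N - (int k * int M + int \<sigma>) = int (N - t)" using tN by (simp add: t_def)
    have v2: "int q * int N + (int (N - t) - int (N - t) div int N * int N) = int (q * N + (N - t) mod N)"
      by (simp add: minus_div_mult_eq_mod zmod_int del: of_nat_diff)
    have wc: "wd a (arr s ''cr'' (q * N + (N - t) mod N))" if "7 \<le> a" for a using H[OF tN] wd_mono[OF _ that] by blast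
    have wkM: "wd a (int k * int M + int \<sigma>)" if "3 \<le> a" for a using w(4)[OF that] by (simp add: t_def)
    have wix: "wd 10 (int (q * N + (N - t) mod N))" using w(6) by (simp add: wd_rules del: of_nat_mod)
    have step: "?I (Suc m) s''" if hit: "reg s'' ''hit'' = reg s' ''hit''" and no: "\<not> H t" for s''
    proof -
      have all: "\<not> H (k * M + u)" if "\<sigma> \<le> u" "Suc \<sigma> \<le> u \<longrightarrow> \<not> H (k * M + u)" for u
        using no that unfolding t_def by (cases "u = \<sigma>") auto
      from 9(3) consider "reg s' ''hit'' = 0" "\<forall>u. Suc \<sigma> \<le> u \<and> u < M \<longrightarrow> \<not> H (k * M + u)"
        | v where "Suc \<sigma> \<le> v" "v < M" "reg s' ''hit'' = int v + 1" "H (k * M + v)"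
          "\<forall>u. Suc \<sigma> \<le> u \<and> u < v \<longrightarrow> \<not> H (k * M + u)"
        unfolding \<sigma>(2) by blast
      then show ?thesis
      proof cases
        case 1
        then show ?thesis unfolding \<sigma>(3) hit using all by blast
      next
        case (2 v)
        then show ?thesis unfolding \<sigma>(3) hit using all Suc_leD by blast
      qed
    qed
    show ?case
      unfolding runs_Seq
      apply (rule runs_Assign_val[where v = "int \<sigma>"])
        apply (use regs 9(2) w in \<open>simp add: wd_rules\<close>)
       apply (use regs 9(2) \<sigma> in simp)
      apply (rule runs_Assign_val[where v = "int (N - t)"])
        apply (use regs w wkM v1 in \<open>simp add: wd_rules del: of_nat_diff\<close>)
       apply (use regs v1 in \<open>simp del: of_nat_diff\<close>)
      apply (rule runs_Assign_val[where v = "int (q * N + (N - t) mod N)"])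
        apply (use regs w v2 wix in \<open>simp add: wd_rules del: of_nat_diff of_nat_mod\<close>)
       apply (use regs v2 in \<open>simp del: of_nat_diff of_nat_mod\<close>)
      apply (cases "H t")
      subgoal
        using regs arrs w wc wix H[OF tN] \<sigma>(1)
        apply (simp add: wd_rules del: of_nat_mod of_nat_add of_nat_mult)
        unfolding \<sigma>(3) t_def by auto
      subgoal
        using regs arrs w wc wix H[OF tN] \<sigma>(1)
        apply (simp add: wd_rules del: of_nat_mod of_nat_add of_nat_mult)
        by (rule step[of "s'\<lparr>reg := r\<rparr>" for r, simplified]) simp_all
      done
  next
    case (10 t s')
    then show ?case by simp
  qed (use s1 in \<open>auto simp: env_def wd_rules\<close>)
  show ?thesis
    unfolding scan_prog_def
    apply (subst runs_Seq, subst runs_Assign, intro conjI, simp)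
    apply (rule runs_conseq[OF loop])
    using env k by (auto simp: env_def)
qed

text \<open>Slot 0 of position \<open>kk\<close> keeps the first group that hits it, with top
  exponent \<open>Fe\<close>. Slots 1 and 2 are for groups that begin with exponent
  \<open>Fe\<close> or \<open>Fe + 1\<close> and continue beyond it. A group with equal bottom and
  top exponent consists of accurate elements only, and one that begins at \<open>Fe + 2\<close> or
  above is irrelevant, so neither is recorded.\<close>

definition record_prog :: com where
  "record_prog =
     Cond (Arr ''Fl'' (Reg ''kk'') \<doteq> Const 0)
       (Store ''Fl'' (Reg ''kk'') (Const 1) ;; Store ''Fe'' (Reg ''kk'') (Reg ''ea'') ;;
        Store ''G'' (Const 3 \<otimes> Reg ''kk'') (Reg ''t0''))
       (Cond (Reg ''e0'' \<prec> Reg ''ea'')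
          (Cond (Reg ''e0'' \<ominus> Arr ''Fe'' (Reg ''kk'') \<prec> Const 2)
            (Store ''G'' (Const 3 \<otimes> Reg ''kk'' \<oplus> Const 1 \<oplus> (Reg ''e0'' \<ominus> Arr ''Fe'' (Reg ''kk''))) (Reg ''t0'')) Skip)
          Skip)"

definition hit_prog :: com where
  "hit_prog =
     scan_prog ;;
     Cond (Reg ''hit'' \<doteq> Const 0) Skip
       (Assign ''cm'' (Reg ''hit'' \<oplus> Const 1) ;;
        Assign ''ce'' (Reg ''p'' \<oplus> Reg ''ea'' \<ominus> Reg ''K'') ;;
        update_prog ;; record_prog)"

lemma written_hit [simp]:
  "written_regs record_prog = {}" "written_arrs record_prog = {''Fl'', ''Fe'', ''G''}"
  "written_regs hit_prog = {''hit'', ''sc'', ''sv'', ''ix'', ''cm'', ''ce'', ''d''}"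
  "written_arrs hit_prog = {''C_man'', ''C_exp'', ''Fl'', ''Fe'', ''G''}"
  by (auto simp: record_prog_def hit_prog_def)

definition recorded :: "nat \<Rightarrow> int \<Rightarrow> int \<Rightarrow> nat \<Rightarrow> state \<Rightarrow> state \<Rightarrow> bool" where
  "recorded k \<alpha> \<beta> b s s' \<longleftrightarrow>
     (if arr s ''Fl'' k = 0 then
        arr s' ''Fl'' = (arr s ''Fl'')(k := 1) \<and> arr s' ''Fe'' = (arr s ''Fe'')(k := \<alpha>) \<and>
        arr s' ''G'' = (arr s ''G'')(3 * k := int b)
      else arr s' ''Fl'' = arr s ''Fl'' \<and> arr s' ''Fe'' = arr s ''Fe'' \<and>
        arr s' ''G'' = (if \<beta> < \<alpha> \<and> \<beta> - arr s ''Fe'' k < 2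
          then (arr s ''G'')(3 * k + (1 + nat (\<beta> - arr s ''Fe'' k)) := int b) else arr s ''G''))"

lemma record_prog:
  assumes k: "reg s ''kk'' = int k" "k < n" and ea: "reg s ''ea'' = \<alpha>" "wd 0 \<alpha>" and e0: "reg s ''e0'' = \<beta>" "wd 0 \<beta>"
    and b: "reg s ''t0'' = int b" "b \<le> n"
    and Fl: "arr s ''Fl'' k = 0 \<or> arr s ''Fl'' k = 1" and Fe: "wd 0 (arr s ''Fe'' k)" "arr s ''Fl'' k = 1 \<Longrightarrow> arr s ''Fe'' k \<le> \<beta>"
  shows "runs L record_prog s (\<lambda>t s'. t \<le> 40 \<and> recorded k \<alpha> \<beta> b s s')"
proof -
  have w: "wd a (int k)" "wd a (int b)" if "3 \<le> a" for a
    using that k b le_N(1) by - (rule wd_nat; linarith)+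
  have w0: "wd a \<alpha>" "wd a \<beta>" "wd a (arr s ''Fe'' k)" for a using ea e0 Fe wd_mono by blast+
  have ix: "nat (3 * int k) = 3 * k" by simp
  have ix2: "nat (3 * int k + 1 + (\<beta> - arr s ''Fe'' k)) = 3 * k + (1 + nat (\<beta> - arr s ''Fe'' k))"
    "0 \<le> 3 * int k + 1 + (\<beta> - arr s ''Fe'' k)" if "arr s ''Fl'' k = 1"
    using Fe(2)[OF that] by simp_all
  show ?thesis
  proof (cases "arr s ''Fl'' k = 0")
    case True
    then show ?thesis unfolding record_prog_def recorded_def using k ea e0 b w w0 ix by (simp add: wd_rules)
  next
    case False
    then have 1: "arr s ''Fl'' k = 1" using Fl by simp
    show ?thesis unfolding record_prog_def recorded_def using 1 k ea e0 b w w0 ix2[OF 1] by (simp add: wd_rules)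
  qed
qed

end

section \<open>Effect of one group on one output position\<close>

context pair_inst
begin

definition group_pair :: "nat \<Rightarrow> (nat \<Rightarrow> nat) \<Rightarrow> nat \<Rightarrow> nat \<Rightarrow> nat \<Rightarrow> nat \<Rightarrow> bool" where
  "group_pair c f t k z j \<longleftrightarrow> t * S \<le> z \<and> z < hi c t \<and> f z + j = k \<and> ym j \<noteq> 0 \<and> ye j \<le> top_exp c f t"

definition least_digit :: "nat \<Rightarrow> (nat \<Rightarrow> nat) \<Rightarrow> nat \<Rightarrow> nat \<Rightarrow> int \<Rightarrow> bool" where
  "least_digit c f t k \<sigma> \<longleftrightarrow>
     (\<exists>z j. group_pair c f t k z j \<and> dx (top_exp c f t) (f z) + dy (top_exp c f t) j = \<sigma>) \<and>
     (\<forall>z j. group_pair c f t k z j \<longrightarrow> \<sigma> \<le> dx (top_exp c f t) (f z) + dy (top_exp c f t) j)"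

text \<open>The interface between machine and mathematics: the preservation of the invariant is
  derived from this relation between states alone, without reference to the program.\<close>

definition hit_result :: "nat \<Rightarrow> (nat \<Rightarrow> nat) \<Rightarrow> nat \<Rightarrow> nat \<Rightarrow> state \<Rightarrow> state \<Rightarrow> bool" where
  "hit_result c f t k s s' \<longleftrightarrow>
     (\<forall>z j. \<not> group_pair c f t k z j) \<and> output_seq s' = output_seq s \<and>
       arr s' ''Fl'' = arr s ''Fl'' \<and> arr s' ''Fe'' = arr s ''Fe'' \<and> arr s' ''G'' = arr s ''G'' \<or>
     (\<exists>\<sigma>. least_digit c f t k \<sigma> \<and>
       output_seq s' = (output_seq s)(k := min (output_seq s k) (ereal (cand (top_exp c f t) \<sigma>))) \<and>
       recorded k (top_exp c f t) (bot_exp f t) (t * S) s s')"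

lemma order_facts:
  assumes f: "order c f" and t: "t * S < c"
  shows "c \<le> n" "\<And>z. z < c \<Longrightarrow> f z < n" "\<And>z. z < c \<Longrightarrow> xm (f z) \<noteq> 0"
    "1 \<le> hi c t" "hi c t \<le> c" "hi c t - 1 < c" "t * S < hi c t"
    "\<And>y z. y \<le> z \<Longrightarrow> z < c \<Longrightarrow> xe (f y) \<le> xe (f z)"
    "\<And>z. z < hi c t \<Longrightarrow> xe (f z) \<le> top_exp c f t"
    "wd a (top_exp c f t)" "wd a (bot_exp f t)" "bot_exp f t \<le> top_exp c f t"
proof -
  show c: "c \<le> n" and fn: "\<And>z. z < c \<Longrightarrow> f z < n" and "\<And>z. z < c \<Longrightarrow> xm (f z) \<noteq> 0"
    and mono: "\<And>y z. y \<le> z \<Longrightarrow> z < c \<Longrightarrow> xe (f y) \<le> xe (f z)"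
    using f by (auto simp: order_def)
  show hi: "1 \<le> hi c t" "hi c t \<le> c" "hi c t - 1 < c" "t * S < hi c t" using t pos(4) unfolding hi_def by linarith+
  show top: "xe (f z) \<le> top_exp c f t" if "z < hi c t" for z
    unfolding top_exp_def by (rule mono) (use that hi in auto)
  show "wd a (top_exp c f t)" "wd a (bot_exp f t)"
    unfolding top_exp_def bot_exp_def using wd_xy(2)[OF fn[OF hi(3)]] wd_xy(2)[OF fn[OF t]] by auto
  show "bot_exp f t \<le> top_exp c f t" unfolding bot_exp_def by (rule top[OF hi(4)])
qed

lemma PA_PB:
  assumes f: "order c f" and t: "t * S < c"
  shows "PA (top_exp c f t) f (t * S) (hi c t) \<subseteq> {..<N}" "PB (top_exp c f t) n \<subseteq> {..<N}"
    "\<And>i j. i \<in> PA (top_exp c f t) f (t * S) (hi c t) \<Longrightarrow> j \<in> PB (top_exp c f t) n \<Longrightarrow> i + j < N"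
    "\<And>k \<sigma>. k < n \<Longrightarrow> \<sigma> < M \<Longrightarrow>
      (\<exists>i\<in>PA (top_exp c f t) f (t * S) (hi c t). \<exists>j\<in>PB (top_exp c f t) n. i + j = k * M + \<sigma>) \<longleftrightarrow>
      (\<exists>z j. group_pair c f t k z j \<and> dx (top_exp c f t) (f z) + dy (top_exp c f t) j = int \<sigma>)"
proof -
  let ?\<alpha> = "top_exp c f t"
  note of = order_facts[OF f t]
  have lt: "i * M + nat d < n * M" if "i < n" "0 \<le> d" "d < 2 ^ K" for i d
  proof -
    have "nat d < M" using that by (simp add: M_def nat_less_iff)
    then have "i * M + nat d < (i + 1) * M" by simp
    also have "\<dots> \<le> n * M" using that by (intro mult_le_mono1) simp
    finally show ?thesis .
  qed
  have a: "i < n * M" if "i \<in> PA ?\<alpha> f (t * S) (hi c t)" for i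
    using that dx_bounds of lt unfolding PA_def by fastforce
  have b: "j < n * M" if "j \<in> PB ?\<alpha> n" for j
    using that dy_bounds lt unfolding PB_def by auto
  show "PA ?\<alpha> f (t * S) (hi c t) \<subseteq> {..<N}" "PB ?\<alpha> n \<subseteq> {..<N}"
    "\<And>i j. i \<in> PA ?\<alpha> f (t * S) (hi c t) \<Longrightarrow> j \<in> PB ?\<alpha> n \<Longrightarrow> i + j < N"
    using a b nMN by fastforce+
  fix k \<sigma> assume k: "k < n" "\<sigma> < M"
  show "(\<exists>i\<in>PA ?\<alpha> f (t * S) (hi c t). \<exists>j\<in>PB ?\<alpha> n. i + j = k * M + \<sigma>) \<longleftrightarrow>
      (\<exists>z j. group_pair c f t k z j \<and> dx ?\<alpha> (f z) + dy ?\<alpha> j = int \<sigma>)"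
  proof
    assume "\<exists>i\<in>PA ?\<alpha> f (t * S) (hi c t). \<exists>j\<in>PB ?\<alpha> n. i + j = k * M + \<sigma>"
    then obtain z j where z: "t * S \<le> z" "z < hi c t" and j: "j < n" "ym j \<noteq> 0" "ye j \<le> ?\<alpha>"
      and eq: "(f z * M + nat (dx ?\<alpha> (f z))) + (j * M + nat (dy ?\<alpha> j)) = k * M + \<sigma>"
      unfolding PA_def PB_def by auto
    have fz: "f z < n" "xe (f z) \<le> ?\<alpha>" using of z by auto
    have "f z + j = k \<and> dx ?\<alpha> (f z) + dy ?\<alpha> j = int \<sigma>"
      using eq digit_decode[OF dx_bounds[OF fz] dy_bounds[OF j(1,3)] k(2)] by simp
    then show "\<exists>z j. group_pair c f t k z j \<and> dx ?\<alpha> (f z) + dy ?\<alpha> j = int \<sigma>"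
      using z j unfolding group_pair_def by blast
  next
    assume "\<exists>z j. group_pair c f t k z j \<and> dx ?\<alpha> (f z) + dy ?\<alpha> j = int \<sigma>"
    then obtain z j where z: "t * S \<le> z" "z < hi c t" and j: "ym j \<noteq> 0" "ye j \<le> ?\<alpha>"
      and eq: "f z + j = k" "dx ?\<alpha> (f z) + dy ?\<alpha> j = int \<sigma>"
      unfolding group_pair_def by auto
    have jn: "j < n" using eq k by simp
    have fz: "f z < n" "xe (f z) \<le> ?\<alpha>" using of z by auto
    have "(f z * M + nat (dx ?\<alpha> (f z))) + (j * M + nat (dy ?\<alpha> j)) = k * M + \<sigma>"
      using eq digit_decode[OF dx_bounds[OF fz] dy_bounds[OF jn j(2)] k(2)] by simp
    moreover have "f z * M + nat (dx ?\<alpha> (f z)) \<in> PA ?\<alpha> f (t * S) (hi c t)" using z unfolding PA_def by blast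
    moreover have "j * M + nat (dy ?\<alpha> j) \<in> PB ?\<alpha> n" using j jn unfolding PB_def by blast
    ultimately show "\<exists>i\<in>PA ?\<alpha> f (t * S) (hi c t). \<exists>j\<in>PB ?\<alpha> n. i + j = k * M + \<sigma>" by blast
  qed
qed

lemma hit_prog:
  assumes env: "env s" and k: "reg s ''kk'' = int k" "k < n" and f: "order c f" and t: "t * S < c"
    and regs: "reg s ''t0'' = int (t * S)" "reg s ''ea'' = top_exp c f t" "reg s ''e0'' = bot_exp f t"
    and conv: "\<And>u. u < N \<Longrightarrow> wd 7 (arr s ''cr'' (q * N + (N - u) mod N)) \<and>
      (Q * int N < 2 * arr s ''cr'' (q * N + (N - u) mod N) \<longleftrightarrow>
        (\<exists>i\<in>PA (top_exp c f t) f (t * S) (hi c t). \<exists>j\<in>PB (top_exp c f t) n. i + j = u))"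
    and C: "C_words s"
    and Fl: "arr s ''Fl'' k = 0 \<or> arr s ''Fl'' k = 1" and Fe: "wd 0 (arr s ''Fe'' k)" "arr s ''Fl'' k = 1 \<Longrightarrow> arr s ''Fe'' k \<le> bot_exp f t"
  shows "runs L hit_prog s (\<lambda>u s'. u \<le> M * 58 + 120 \<and> C_words s' \<and> hit_result c f t k s s')"
proof -
  let ?\<alpha> = "top_exp c f t" and ?\<beta> = "bot_exp f t"
  let ?H = "\<lambda>u. \<exists>i\<in>PA ?\<alpha> f (t * S) (hi c t). \<exists>j\<in>PB ?\<alpha> n. i + j = u"
  note of = order_facts[OF f t]
  note PAB = PA_PB(4)[OF f t k(2)]
  have digit_lt: "\<exists>\<sigma><M. dx ?\<alpha> (f z) + dy ?\<alpha> j = int \<sigma>" if "group_pair c f t k z j" for z j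
  proof -
    have fz: "f z < n" "xe (f z) \<le> ?\<alpha>" and j: "j < n" "ye j \<le> ?\<alpha>"
      using that of k unfolding group_pair_def by auto
    have "0 \<le> dx ?\<alpha> (f z) + dy ?\<alpha> j" "dx ?\<alpha> (f z) + dy ?\<alpha> j < int M"
      using dx_bounds[OF fz] dy_bounds[OF j] by (auto simp: M_def)
    then show ?thesis by (metis nonneg_int_cases of_nat_less_iff)
  qed
  show ?thesis
    unfolding hit_prog_def
  proof (subst runs_Seq, rule runs_conseq[OF scan_prog[OF env k conv]], goal_cases)
    case (2 t1 s1)
    note un = 2(2)
    have same: "reg s1 ''kk'' = int k" "reg s1 ''t0'' = int (t * S)" "reg s1 ''ea'' = ?\<alpha>" "reg s1 ''e0'' = ?\<beta>"
        "reg s1 ''p'' = int p" "reg s1 ''K'' = int K"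
      using unchanged_reg[OF un] k regs env by (simp_all add: env_def)
    have arrs: "arr s1 = arr s" using un by (auto simp: unchanged_def)
    have C1: "C_words s1" and out1: "output_seq s1 = output_seq s" using C by (auto simp: C_words_def output_seq_def fun_eq_iff arrs)
    have t1: "t1 \<le> M * 58 + 10" using 2 by blast
    from 2(1) consider "reg s1 ''hit'' = 0" "\<forall>\<sigma><M. \<not> ?H (k * M + \<sigma>)"
      | \<sigma> where "\<sigma> < M" "reg s1 ''hit'' = int \<sigma> + 1" "?H (k * M + \<sigma>)" "\<forall>\<sigma>'<\<sigma>. \<not> ?H (k * M + \<sigma>')"
      by blast
    then show ?case
    proof cases
      case 1
      have "\<not> group_pair c f t k z j" for z j
        using 1(2) PAB digit_lt by blast
      then have "hit_result c f t k s s1" unfolding hit_result_def by (simp add: arrs out1)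
      then show ?thesis using 1(1) t1 C1 by simp
    next
      case (2 \<sigma>)
      have least: "least_digit c f t k (int \<sigma>)"
        unfolding least_digit_def
      proof (intro conjI allI impI)
        show "\<exists>z j. group_pair c f t k z j \<and> dx ?\<alpha> (f z) + dy ?\<alpha> j = int \<sigma>" using PAB[OF 2(1)] 2(3) by blast
        fix z j assume gp: "group_pair c f t k z j"
        then obtain \<sigma>' where \<sigma>': "\<sigma>' < M" "dx ?\<alpha> (f z) + dy ?\<alpha> j = int \<sigma>'" using digit_lt by blast
        then have "?H (k * M + \<sigma>')" using PAB gp by blast
        then have "\<not> \<sigma>' < \<sigma>" using 2(4) by blast
        then show "int \<sigma> \<le> dx ?\<alpha> (f z) + dy ?\<alpha> j" using \<sigma>' by simp
      qed
      have w\<sigma>: "wd a (int \<sigma>)" if "3 \<le> a" for a using that 2(1) le_N(2) by (intro wd_nat) auto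
      let ?m = "2 + int \<sigma>" and ?e = "int p + ?\<alpha> - int K"
      let ?s2 = "s1\<lparr>reg := (reg s1)(''cm'' := ?m, ''ce'' := ?e)\<rparr>"
      have C2: "C_words ?s2" and out2: "output_seq ?s2 = output_seq s"
        using C1 out1 by (auto simp: C_words_def output_seq_def fun_eq_iff)
      have upd: "runs L update_prog ?s2 (\<lambda>u s'. u \<le> 40 \<and> C_words s' \<and>
         output_seq s' = (output_seq s)(k := min (output_seq s k) (ereal (fval ?m ?e))))"
        using update_prog[of ?s2 k ?m ?e] C2 out2 k same w\<sigma> of(10) by (simp add: wd_rules)
      show ?thesis
        using 2(2)
        apply (simp add: wd_rules w\<sigma> same of(10))
        apply (rule runs_conseq[OF upd])
        subgoal premises p3 for t3 s3
        proof -
          note u3 = p3(3)[simplified]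
          have s3: "reg s3 ''kk'' = int k" "reg s3 ''t0'' = int (t * S)" "reg s3 ''ea'' = ?\<alpha>" "reg s3 ''e0'' = ?\<beta>"
            "arr s3 ''Fl'' = arr s ''Fl''" "arr s3 ''Fe'' = arr s ''Fe''" "arr s3 ''G'' = arr s ''G''"
            using unchanged_reg[OF u3] unchanged_arr[OF u3] same arrs by simp_all
          have "t * S \<le> n" using t of(1) by simp
          then have rp: "runs L record_prog s3 (\<lambda>u s'. u \<le> 40 \<and> recorded k ?\<alpha> ?\<beta> (t * S) s3 s')"
            using record_prog[of s3 k ?\<alpha> ?\<beta> "t * S"] s3 k of(10,11) Fl Fe by simp
          show ?thesis
          proof (rule runs_conseq[OF rp], goal_cases)
            case (1 t4 s4)
            have "arr s4 ''C_man'' = arr s3 ''C_man''" "arr s4 ''C_exp'' = arr s3 ''C_exp''"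
              using unchanged_arr[OF 1(2)] by simp_all
            then have C4: "C_words s4" "output_seq s4 = output_seq s3"
              using p3 by (auto simp: C_words_def output_seq_def fun_eq_iff)
            have "recorded k ?\<alpha> ?\<beta> (t * S) s s4"
              using conjunct2[OF 1(1)] unfolding recorded_def s3(5-7) .
            moreover have "output_seq s4 = (output_seq s)(k := min (output_seq s k) (ereal (cand ?\<alpha> (int \<sigma>))))"
              using C4(2) p3(2) unfolding cand_def by (simp add: add.commute)
            ultimately have "hit_result c f t k s s4"
              unfolding hit_result_def using least by blast
            then show ?case using C4 t1 p3 1(1) by simp
          qed
        qed
        done
    qed
  qed
qed

end

section \<open>The invariant over the sequence of groups\<close>

context pair_inst
begin

abbreviation approx :: real where "approx \<equiv> 1 + 4 / 2 ^ K"

definition role :: "(nat \<Rightarrow> nat) \<Rightarrow> nat \<Rightarrow> nat \<Rightarrow> nat \<Rightarrow> bool" where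
  "role f k z j \<longleftrightarrow> f z + j = k \<and> ym j \<noteq> 0 \<and> ye j \<le> xe (f z)"

text \<open>The state of output position \<open>k\<close> once the first \<open>b\<close> elements of the sorted order have been
  processed. A pair whose first component does not have the top exponent of its group is either
  approximated already or lies in one of the at most three groups recorded for \<open>k\<close>.\<close>

definition progress :: "nat \<Rightarrow> (nat \<Rightarrow> nat) \<Rightarrow> nat \<Rightarrow> nat \<Rightarrow> state \<Rightarrow> bool" where
  "progress c f b k s \<longleftrightarrow>
     (\<forall>r<3. 0 \<le> arr s ''G'' (3 * k + r) \<and> arr s ''G'' (3 * k + r) \<le> int n) \<and>
     wd 0 (arr s ''Fe'' k) \<and> (arr s ''Fl'' k = 0 \<or> arr s ''Fl'' k = 1) \<and>
     (arr s ''Fl'' k = 0 \<longrightarrow> (\<forall>z j. z < b \<and> z < c \<longrightarrow> \<not> role f k z j)) \<and>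
     (arr s ''Fl'' k = 1 \<longrightarrow>
        output_seq s k \<le> ereal (2 powi (int p + arr s ''Fe'' k + 1)) \<and>
        (\<forall>z. b \<le> z \<and> z < c \<longrightarrow> arr s ''Fe'' k \<le> xe (f z)) \<and>
        (\<forall>z j. z < b \<and> z < c \<and> role f k z j \<longrightarrow>
           output_seq s k \<le> ereal (approx * sum (f z) j) \<or>
           arr s ''G'' (3 * k) = int (z div S * S) \<or>
           (\<exists>r\<in>{1,2}. arr s ''G'' (3 * k + r) = int (z div S * S) \<and>
              bot_exp f (z div S) = arr s ''Fe'' k + int r - 1 \<and> bot_exp f (z div S) < top_exp c f (z div S))))"

lemma progress_cong:
  assumes "\<And>r. r < 3 \<Longrightarrow> arr s' ''G'' (3 * k + r) = arr s ''G'' (3 * k + r)" "arr s' ''Fe'' k = arr s ''Fe'' k"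
    "arr s' ''Fl'' k = arr s ''Fl'' k" "output_seq s' k = output_seq s k" "progress c f b k s"
  shows "progress c f b k s'"
  using assms(1)[of 0] assms(1)[of 1] assms(1)[of 2] assms unfolding progress_def by simp

text \<open>A pair in the new group is accurate if its first component has the top exponent.
  Otherwise the group is the first hit, or it begins within two classes of \<open>Fe\<close> and is
  recorded, or it begins higher and the bound from the first hit already suffices. Earlier pairs
  keep their justification because outputs only decrease and no slot in use is overwritten.\<close>

lemma progress_step:
  assumes f: "order c f" and t: "t * S < c" and k: "k < n" and old: "progress c f (t * S) k s"
    and res: "hit_result c f t k s s'"
  shows "progress c f (t * S + S) k s'"
proof -
  let ?\<alpha> = "top_exp c f t" and ?\<beta> = "bot_exp f t"
  note of = order_facts[OF f t]
  have in_group: "z < hi c t" if "z < t * S + S" "z < c" for z using that by (simp add: hi_def)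
  have zdiv: "z div S = t" if "t * S \<le> z" "z < t * S + S" for z
    using that by (intro div_nat_eqI) (simp_all add: algebra_simps)
  \<comment> \<open>\<open>role\<close> compares with the exponent of the element itself,
    \<open>group_pair\<close> with the larger top exponent, so every role pair is seen by the
    convolution.\<close>
  have gp: "group_pair c f t k z j" if "t * S \<le> z" "z < t * S + S" "z < c" "role f k z j" for z j
    using that in_group of(9)[of z] unfolding group_pair_def role_def by (meson order_trans)
  have later: "?\<alpha> \<le> xe (f z)" if "t * S + S \<le> z" "z < c" for z
    unfolding top_exp_def by (rule of(8)) (use that in \<open>auto simp: hi_def\<close>)
  from res consider
      (none) "\<And>z j. \<not> group_pair c f t k z j" "output_seq s' = output_seq s" "arr s' ''Fl'' = arr s ''Fl''"
        "arr s' ''Fe'' = arr s ''Fe''" "arr s' ''G'' = arr s ''G''"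
    | (hit) \<sigma> where "least_digit c f t k \<sigma>" "output_seq s' = (output_seq s)(k := min (output_seq s k) (ereal (cand ?\<alpha> \<sigma>)))"
        "recorded k ?\<alpha> ?\<beta> (t * S) s s'"
    unfolding hit_result_def by blast
  then show ?thesis
  proof cases
    case none
    have no: "\<not> role f k z j" if "t * S \<le> z" "z < t * S + S" "z < c" for z j
      using gp that none(1) by blast
    have split: "z < t * S \<or> t * S \<le> z" for z by linarith
    show ?thesis
      using old no unfolding progress_def none(2-5) by (meson le_add1 linorder_not_less order_trans)
  next
    case (hit \<sigma>)
    obtain z0 j0 where g0: "group_pair c f t k z0 j0" and \<sigma>: "dx ?\<alpha> (f z0) + dy ?\<alpha> j0 = \<sigma>"
      using hit(1) unfolding least_digit_def by blast
    have b0: "f z0 < n" "j0 < n" "xe (f z0) \<le> ?\<alpha>" "ye j0 \<le> ?\<alpha>"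
      using g0 of k unfolding group_pair_def by auto
    have cle: "cand ?\<alpha> \<sigma> \<le> 2 powi (int p + ?\<alpha> + 1)" using cand_le_pow[OF b0] \<sigma> by simp
    have out_le: "output_seq s' k \<le> output_seq s k" "output_seq s' k \<le> ereal (cand ?\<alpha> \<sigma>)" unfolding hit(2) by auto
    have top: "output_seq s' k \<le> ereal (approx * sum (f z) j)"
      if z: "t * S \<le> z" "z < t * S + S" "z < c" "role f k z j" "xe (f z) = ?\<alpha>" for z j
    proof -
      have g: "group_pair c f t k z j" using gp z by blast
      then have "\<sigma> \<le> dx ?\<alpha> (f z) + dy ?\<alpha> j" using hit(1) unfolding least_digit_def by blast
      then have "cand ?\<alpha> \<sigma> \<le> cand ?\<alpha> (dx ?\<alpha> (f z) + dy ?\<alpha> j)" by (rule cand_mono)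
      also have "\<dots> \<le> approx * sum (f z) j"
        by (rule cand_le_sum) (use z of g k in \<open>auto simp: role_def\<close>)
      finally have "ereal (cand ?\<alpha> \<sigma>) \<le> ereal (approx * sum (f z) j)" by simp
      then show ?thesis using out_le(2) by (rule order_trans[rotated])
    qed
    have G_old: "\<forall>r<3. 0 \<le> arr s ''G'' (3 * k + r) \<and> arr s ''G'' (3 * k + r) \<le> int n"
      and Fl: "arr s ''Fl'' k = 0 \<or> arr s ''Fl'' k = 1" and Fe: "wd 0 (arr s ''Fe'' k)"
      using old unfolding progress_def by auto
    have b_n: "0 \<le> int (t * S)" "int (t * S) \<le> int n" unfolding of_nat_le_iff using t of(1) by simp_all
    show ?thesis
    proof (cases "arr s ''Fl'' k = 0")
      case True
      then have new: "arr s' ''Fl'' k = 1" "arr s' ''Fe'' k = ?\<alpha>" "arr s' ''G'' = (arr s ''G'')(3 * k := int (t * S))"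
        using hit(3) unfolding recorded_def by auto
      have no: "\<not> role f k z j" if "z < t * S" "z < c" for z j using old True that unfolding progress_def by blast
      show ?thesis
        unfolding progress_def new
      proof (intro conjI impI allI)
        fix r :: nat assume "r < 3"
        then show "0 \<le> ((arr s ''G'')(3 * k := int (t * S))) (3 * k + r)" "((arr s ''G'')(3 * k := int (t * S))) (3 * k + r) \<le> int n"
          using G_old b_n by auto
      next
        show "output_seq s' k \<le> ereal (2 powi (int p + ?\<alpha> + 1))"
          using out_le(2) cle by (meson ereal_less_eq(3) order_trans)
      next
        fix z assume "t * S + S \<le> z \<and> z < c"
        then show "?\<alpha> \<le> xe (f z)" using later by blast
      next
        fix z j assume z: "z < t * S + S \<and> z < c \<and> role f k z j"
        then have "t * S \<le> z" using no by (meson not_le)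
        then have "z div S = t" using zdiv z by blast
        then show "output_seq s' k \<le> ereal (approx * sum (f z) j) \<or>
           ((arr s ''G'')(3 * k := int (t * S))) (3 * k) = int (z div S * S) \<or>
           (\<exists>r\<in>{1,2}. ((arr s ''G'')(3 * k := int (t * S))) (3 * k + r) = int (z div S * S) \<and>
              bot_exp f (z div S) = ?\<alpha> + int r - 1 \<and> bot_exp f (z div S) < top_exp c f (z div S))"
          by simp
      qed (use of(10) in auto)
    next
      case False
      then have 1: "arr s ''Fl'' k = 1" using Fl by simp
      let ?F = "arr s ''Fe'' k"
      let ?w = "?\<beta> < ?\<alpha> \<and> ?\<beta> - ?F < 2"
      let ?i = "3 * k + (1 + nat (?\<beta> - ?F))"
      have new: "arr s' ''Fl'' k = 1" "arr s' ''Fe'' k = ?F" "arr s' ''G'' = (if ?w then (arr s ''G'')(?i := int (t * S)) else arr s ''G'')"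
        using hit(3) 1 unfolding recorded_def by auto
      have oldle: "output_seq s k \<le> ereal (2 powi (int p + ?F + 1))"
        and ge: "\<And>z. t * S \<le> z \<Longrightarrow> z < c \<Longrightarrow> ?F \<le> xe (f z)"
        and cov: "\<And>z j. z < t * S \<Longrightarrow> z < c \<Longrightarrow> role f k z j \<Longrightarrow> output_seq s k \<le> ereal (approx * sum (f z) j) \<or>
           arr s ''G'' (3 * k) = int (z div S * S) \<or>
           (\<exists>r\<in>{1,2}. arr s ''G'' (3 * k + r) = int (z div S * S) \<and>
              bot_exp f (z div S) = ?F + int r - 1 \<and> bot_exp f (z div S) < top_exp c f (z div S))"
        using old 1 unfolding progress_def by auto
      \<comment> \<open>Position \<open>t * S\<close> is the first one not yet processed, so its
        exponent is at least the recorded one, and \<open>nat (?\<beta> - ?F)\<close> is a faithful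
        difference.\<close>
      have F\<beta>: "?F \<le> ?\<beta>" using ge[of "t * S"] t by (simp add: bot_exp_def)
      have G0: "arr s' ''G'' (3 * k) = arr s ''G'' (3 * k)" unfolding new by simp
      show ?thesis
        unfolding progress_def new(1,2)
      proof (intro conjI impI allI)
        fix r :: nat assume "r < 3"
        then show "0 \<le> arr s' ''G'' (3 * k + r)" "arr s' ''G'' (3 * k + r) \<le> int n"
          using G_old b_n unfolding new by auto
      next
        show "output_seq s' k \<le> ereal (2 powi (int p + ?F + 1))" using out_le(1) oldle by (rule order_trans)
      next
        fix z assume "t * S + S \<le> z \<and> z < c"
        then show "?F \<le> xe (f z)" using ge by simp
      next
        fix z j assume z: "z < t * S + S \<and> z < c \<and> role f k z j"
        show "output_seq s' k \<le> ereal (approx * sum (f z) j) \<or>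
           arr s' ''G'' (3 * k) = int (z div S * S) \<or>
           (\<exists>r\<in>{1,2}. arr s' ''G'' (3 * k + r) = int (z div S * S) \<and>
              bot_exp f (z div S) = ?F + int r - 1 \<and> bot_exp f (z div S) < top_exp c f (z div S))"
        proof (cases "z < t * S")
          case True
          from cov[OF True] z consider "output_seq s k \<le> ereal (approx * sum (f z) j)" | "arr s ''G'' (3 * k) = int (z div S * S)"
            | r where "r \<in> {1, 2}" "arr s ''G'' (3 * k + r) = int (z div S * S)"
              "bot_exp f (z div S) = ?F + int r - 1" "bot_exp f (z div S) < top_exp c f (z div S)" by blast
          then show ?thesis
          proof cases
            case 1
            then show ?thesis using out_le(1) by (meson order_trans)
          next
            case 2
            then show ?thesis using G0 by simp
          next
            case (3 r)
            have "arr s' ''G'' (3 * k + r) = arr s ''G'' (3 * k + r)"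
            proof (rule ccontr)
              assume "\<not> ?thesis"
              then have "?w" "r = 1 + nat (?\<beta> - ?F)" unfolding new by (auto split: if_splits)
              then have "?\<beta> = bot_exp f (z div S)" using 3(3) F\<beta> by simp
              \<comment> \<open>Overwriting the slot would require the bottom exponent of the
                current group to equal that of an earlier recorded group. By sortedness the earlier
                top is at most the current bottom, hence at most the earlier bottom, yet a recorded
                group has bottom strictly below top.\<close>
              moreover have "top_exp c f (z div S) \<le> ?\<beta>"
              proof -
                have "z div S < t" using True pos(4) by (simp add: less_mult_imp_div_less)
                then have "Suc (z div S) * S \<le> t * S" by (intro mult_le_mono1) simp
                then have "z div S * S + S \<le> t * S" by simp
                then show ?thesis unfolding top_exp_def bot_exp_def
                  by (intro of(8)) (use t in \<open>auto simp: hi_def\<close>)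
              qed
              ultimately show False using 3(4) by simp
            qed
            then show ?thesis using 3 by auto
          qed
        next
          case False
          then have zt: "t * S \<le> z" "z div S = t" using zdiv z by auto
          have z\<beta>: "?\<beta> \<le> xe (f z)" unfolding bot_exp_def by (rule of(8)) (use zt z in auto)
          have z\<alpha>: "xe (f z) \<le> ?\<alpha>" using of(9) in_group z by blast
          show ?thesis
          proof (cases "xe (f z) = ?\<alpha>")
            case True
            then show ?thesis using top zt z by blast
          next
            case ne: False
            then have lt: "?\<beta> < ?\<alpha>" using z\<beta> z\<alpha> by simp
            show ?thesis
            proof (cases "?\<beta> - ?F < 2")
              case True
              define r where "r = 1 + nat (?\<beta> - ?F)"
              have "r \<in> {1, 2}" using True F\<beta> unfolding r_def by auto
              moreover have "arr s' ''G'' (3 * k + r) = int (z div S * S)" using True lt zt unfolding new r_def by simp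
              moreover have "bot_exp f (z div S) = ?F + int r - 1" using F\<beta> zt unfolding r_def by simp
              ultimately show ?thesis using lt zt by blast
            next
              case far: False
              \<comment> \<open>Every element of this group lies at least two classes above the
                first hit, so the pair is no smaller than what the output has already
                reached.\<close>
              have "2 powi (int p + ?F + 1) \<le> sum (f z) j"
                by (rule sum_ge_pow) (use far z\<beta> z of k in \<open>auto simp: role_def\<close>)
              moreover have "sum (f z) j \<le> approx * sum (f z) j"
              proof -
                have "0 \<le> sum (f z) j" using \<open>2 powi (int p + ?F + 1) \<le> sum (f z) j\<close>
                  by (meson order_trans zero_le_power_int zero_le_numeral)
                then show ?thesis by (simp add: algebra_simps)
              qed
              ultimately have "ereal (2 powi (int p + ?F + 1)) \<le> ereal (approx * sum (f z) j)" by simp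
              then show ?thesis using out_le(1) oldle by (meson order_trans)
            qed
          qed
        qed
      qed (use Fe in auto)
    qed
  qed
qed

text \<open>Candidates never undercut a genuine sum (\<open>cand_ge_sum\<close>), hence never
  \<open>lb\<close>. Other positions are unaffected because each owns three consecutive slots of
  \<open>G\<close>.\<close>

lemma hit_result_lb:
  assumes f: "order c f" and t: "t * S < c" and k: "k < n" and res: "hit_result c f t k s s'"
    and old: "lb k \<le> output_seq s k"
  shows "lb k \<le> output_seq s' k" "output_seq s' k \<le> output_seq s k" "\<And>k'. k' \<noteq> k \<Longrightarrow> output_seq s' k' = output_seq s k'"
    "\<And>k' r. k' \<noteq> k \<Longrightarrow> r < 3 \<Longrightarrow> arr s' ''G'' (3 * k' + r) = arr s ''G'' (3 * k' + r)"
    "\<And>k'. k' \<noteq> k \<Longrightarrow> arr s' ''Fl'' k' = arr s ''Fl'' k'" "\<And>k'. k' \<noteq> k \<Longrightarrow> arr s' ''Fe'' k' = arr s ''Fe'' k'"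
proof -
  note of = order_facts[OF f t]
  have cand: "lb k \<le> ereal (cand (top_exp c f t) \<sigma>)" if least: "least_digit c f t k \<sigma>" for \<sigma>
  proof -
    obtain z j where g: "group_pair c f t k z j" and \<sigma>: "dx (top_exp c f t) (f z) + dy (top_exp c f t) j = \<sigma>"
      using least unfolding least_digit_def by blast
    have "sum (f z) j \<le> cand (top_exp c f t) \<sigma>"
      unfolding \<sigma>[symmetric] by (rule cand_ge_sum) (use g of in \<open>auto simp: group_pair_def\<close>)
    moreover have "lb k \<le> ereal (sum (f z) j)"
      using lb[of "f z" j] g of k unfolding group_pair_def sum_def by auto
    ultimately show ?thesis by (meson ereal_less_eq(3) order_trans)
  qed
  show "lb k \<le> output_seq s' k" "output_seq s' k \<le> output_seq s k" "\<And>k'. k' \<noteq> k \<Longrightarrow> output_seq s' k' = output_seq s k'"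
    using res old cand unfolding hit_result_def by auto
  show "\<And>k'. k' \<noteq> k \<Longrightarrow> arr s' ''Fl'' k' = arr s ''Fl'' k'" "\<And>k'. k' \<noteq> k \<Longrightarrow> arr s' ''Fe'' k' = arr s ''Fe'' k'"
    using res unfolding hit_result_def recorded_def by (auto split: if_splits)
  fix k' r :: nat assume kr: "k' \<noteq> k" "r < 3"
  have "3 * k' + r \<noteq> 3 * k + u" if "u < 3" for u using kr that by presburger
  note ne = this
  have "arr s' ''G'' (3 * k' + r) = arr s ''G'' (3 * k' + r)" if rec: "recorded k (top_exp c f t) (bot_exp f t) (t * S) s s'"
  proof -
    have "3 * k' + r \<noteq> 3 * k" using ne[of 0] by simp
    moreover have "3 * k' + r \<noteq> 3 * k + (1 + nat (bot_exp f t - arr s ''Fe'' k))" if "bot_exp f t - arr s ''Fe'' k < 2"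
      using that by (intro ne) simp
    ultimately show ?thesis using rec unfolding recorded_def by (auto split: if_splits)
  qed
  then show "arr s' ''G'' (3 * k' + r) = arr s ''G'' (3 * k' + r)"
    using res unfolding hit_result_def by auto
qed

end

section \<open>All groups: invariant and cost\<close>

context pair_inst
begin

definition base_ctx :: "nat \<Rightarrow> (nat \<Rightarrow> nat) \<Rightarrow> state \<Rightarrow> bool" where
  "base_ctx c f s \<longleftrightarrow> env s \<and> inp s \<and> ordered s c f"

lemma base_ctx_unchanged:
  assumes "base_ctx c f s" "unchanged X Y s s'" "X \<inter> insert ''cnt'' env_regs = {}"
    "Y \<inter> {''xm'', ''xe'', ''ym'', ''ye'', ''ord''} = {}"
  shows "base_ctx c f s'"
proof -
  have "env s'" using env_unchanged[of s X Y s'] assms by (auto simp: base_ctx_def)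
  moreover have "inp s'" using inp_unchanged[of s X Y s'] assms by (auto simp: base_ctx_def)
  moreover have "reg s' ''cnt'' = reg s ''cnt''" "arr s' ''ord'' = arr s ''ord''"
    using assms(2-4) unfolding unchanged_def by blast+
  ultimately show ?thesis using assms(1) by (simp add: base_ctx_def ordered_def)
qed

lemma roots_unchanged: "roots s \<Longrightarrow> unchanged X Y s s' \<Longrightarrow> Y \<inter> {''Wr'', ''Wi''} = {} \<Longrightarrow> roots s'"
  by (simp add: roots_def unchanged_def)

text \<open>\<open>o0\<close> is the output at entry. Recording that outputs never rise above it
  lets the results of the first pass survive the second.\<close>

definition status :: "nat \<Rightarrow> (nat \<Rightarrow> nat) \<Rightarrow> nat \<Rightarrow> (nat \<Rightarrow> ereal) \<Rightarrow> state \<Rightarrow> bool" where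
  "status c f b o0 s \<longleftrightarrow> C_words s \<and>
     (\<forall>k<n. progress c f b k s \<and> lb k \<le> output_seq s k \<and> output_seq s k \<le> o0 k)"

lemma status_unchanged:
  assumes "status c f b o0 s" "unchanged X Y s s'" "Y \<inter> {''C_man'', ''C_exp'', ''Fl'', ''Fe'', ''G''} = {}"
  shows "status c f b o0 s'"
proof -
  have a: "arr s' ''C_man'' = arr s ''C_man''" "arr s' ''C_exp'' = arr s ''C_exp''" "arr s' ''Fl'' = arr s ''Fl''"
    "arr s' ''Fe'' = arr s ''Fe''" "arr s' ''G'' = arr s ''G''"
    using assms(2,3) unfolding unchanged_def by blast+
  then have "output_seq s' = output_seq s" "C_words s' = C_words s"
    by (auto simp: output_seq_def fun_eq_iff C_words_def)
  then show ?thesis using assms(1) a unfolding status_def progress_def by simp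
qed

definition group_prog :: com where
  "group_prog = head_prog ;; clear_prog ;; fill_x_prog ;; fill_y_prog ;; conv_prog ;; For ''kk'' ''n'' hit_prog"

lemma written_group [simp]:
  "written_regs group_prog = fft_regs \<union> {''t0'', ''t1'', ''ea'', ''e0'', ''y'', ''i'', ''kk'', ''hit'', ''sc'', ''sv'', ''ix'', ''cm'', ''ce'', ''d''}"
  "written_arrs group_prog = {''ar'', ''ai'', ''br'', ''bi'', ''cr'', ''ci'', ''C_man'', ''C_exp'', ''Fl'', ''Fe'', ''G''}"
  by (auto simp: group_prog_def fft_regs_def)

lemma hits_prog:
  assumes ctx: "base_ctx c f s" and f: "order c f" and t: "t * S < c"
    and regs: "reg s ''t0'' = int (t * S)" "reg s ''ea'' = top_exp c f t" "reg s ''e0'' = bot_exp f t"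
    and conv: "\<forall>u<N. wd 7 (arr s ''cr'' (q * N + (N - u) mod N)) \<and>
      (Q * int N < 2 * arr s ''cr'' (q * N + (N - u) mod N) \<longleftrightarrow>
        (\<exists>i\<in>PA (top_exp c f t) f (t * S) (hi c t). \<exists>j\<in>PB (top_exp c f t) n. i + j = u))"
    and st: "status c f (t * S) o0 s"
  shows "runs L (For ''kk'' ''n'' hit_prog) s (\<lambda>u s'. u \<le> n * (M * 58 + 128) + 6 \<and> status c f (t * S + S) o0 s')"
proof (rule runs_For[where m = n and T = "M * 58 + 120" and I = "\<lambda>m s'. C_words s' \<and>
     (\<forall>k<n. progress c f (if k < m then t * S + S else t * S) k s' \<and> lb k \<le> output_seq s' k \<and> output_seq s' k \<le> o0 k)"], goal_cases)
  case (7 k s v)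
  have "output_seq (s\<lparr>reg := (reg s)(''kk'' := v)\<rparr>) = output_seq s" by (simp add: output_seq_def fun_eq_iff)
  then show ?case using 7 by (simp add: C_words_def progress_def)
next
  case 8
  then show ?case using st by (simp add: status_def)
next
  case (9 k s')
  have ctx': "base_ctx c f s'" by (rule base_ctx_unchanged[OF ctx 9(4)]) (auto simp: env_regs_def)
  have env': "env s'" using ctx' by (simp add: base_ctx_def)
  have regs': "reg s' ''t0'' = int (t * S)" "reg s' ''ea'' = top_exp c f t" "reg s' ''e0'' = bot_exp f t"
    and cr: "arr s' ''cr'' = arr s ''cr''"
    using unchanged_reg[OF 9(4)] unchanged_arr[OF 9(4)] regs by simp_all
  have pk: "progress c f (t * S) k s'" and lbk: "lb k \<le> output_seq s' k" using 9(1,3) by auto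
  have Fl: "arr s' ''Fl'' k = 0 \<or> arr s' ''Fl'' k = 1" and Fe: "wd 0 (arr s' ''Fe'' k)"
    and Fb: "arr s' ''Fl'' k = 1 \<Longrightarrow> arr s' ''Fe'' k \<le> bot_exp f t"
    using pk t unfolding progress_def bot_exp_def by auto
  have hp: "runs L hit_prog s' (\<lambda>u s''. u \<le> M * 58 + 120 \<and> C_words s'' \<and> hit_result c f t k s' s'')"
    by (rule hit_prog[OF env' 9(2,1) f t regs' _ _ Fl Fe Fb]) (use conv cr 9(3) in auto)
  show ?case
  proof (rule runs_conseq[OF hp], goal_cases)
    case (1 u s'')
    then have res: "hit_result c f t k s' s''" by blast
    note r = hit_result_lb[OF f t 9(1) res lbk]
    have "progress c f (if k' < Suc k then t * S + S else t * S) k' s'' \<and> lb k' \<le> output_seq s'' k' \<and> output_seq s'' k' \<le> o0 k'"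
      if "k' < n" for k'
    proof (cases "k' = k")
      case True
      have "output_seq s'' k \<le> o0 k" using r(2) 9(3) that True by (meson order_trans)
      then show ?thesis using progress_step[OF f t 9(1) pk res] r(1) True by simp
    next
      case False
      have old: "progress c f (if k' < k then t * S + S else t * S) k' s'" "lb k' \<le> output_seq s' k'" "output_seq s' k' \<le> o0 k'"
        using 9(3) that by auto
      have "progress c f (if k' < k then t * S + S else t * S) k' s''"
        by (rule progress_cong[OF _ _ _ _ old(1)]) (use r(3-6) False in auto)
      moreover have "(k' < Suc k) = (k' < k)" using False by auto
      ultimately show ?thesis using old r(3)[OF False] by simp
    qed
    then show ?case using 1(1) by blast
  qed
next
  case (10 u s')
  then show ?case by (simp add: status_def algebra_simps)
qed (use ctx in \<open>auto simp: base_ctx_def env_def wd_rules\<close>)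

lemma group_prog:
  assumes ctx: "base_ctx c f s" and roots: "roots s" and f: "order c f"
    and t: "reg s ''tt'' = int t" "t * S < c" and st: "status c f (t * S) o0 s"
  shows "runs L group_prog s (\<lambda>u s'. u \<le> 500 * (q * N) \<and> status c f (t * S + S) o0 s')"
proof -
  let ?\<alpha> = "top_exp c f t"
  note of = order_facts[OF f t(2)]
  \<comment> \<open>Scanning inspects \<open>M\<close> digit sums for each of \<open>n\<close>
    positions; \<open>2 * (n * M) \<le> N\<close> makes this no dearer than the transforms.\<close>
  have time: "30 + (N * 20 + 6 + (S * 50 + 6 + (n * 50 + 6 + (q * (N * 420 + 120) + 24 + (n * (M * 58 + 128) + 6))))) \<le> 500 * (q * N)"
  proof -
    have "2 * (n * M) \<le> N" "S \<le> N" "n \<le> N" "256 \<le> N" using nMN le_N N256 by auto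
    moreover have "8 * N \<le> q * N" using q8 by simp
    moreover have "256 * q \<le> q * N" using N256 by (simp add: mult.commute)
    ultimately show ?thesis unfolding distrib_left by linarith
  qed
  have e: "env s" "inp s" "ordered s c f" using ctx by (auto simp: base_ctx_def)
  show ?thesis
    unfolding group_prog_def
  proof (subst runs_Seq, rule runs_conseq[OF head_prog[OF e f t]], goal_cases)
    case (1 t1 s1)
    have c1: "base_ctx c f s1" by (rule base_ctx_unchanged[OF ctx 1(2)]) (auto simp: env_regs_def)
    have r1: "roots s1" by (rule roots_unchanged[OF roots 1(2)]) auto
    have st1: "status c f (t * S) o0 s1" by (rule status_unchanged[OF st 1(2)]) auto
    have e1: "env s1" "inp s1" "ordered s1 c f" using c1 by (auto simp: base_ctx_def)
    note p1 = 1(1)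
    show ?case
    proof (subst runs_Seq, rule runs_conseq[OF clear_prog[OF e1(1)]], goal_cases)
      case (1 t2 s2)
      have c2: "base_ctx c f s2" by (rule base_ctx_unchanged[OF c1 1(2)]) (auto simp: env_regs_def)
      have r2: "roots s2" by (rule roots_unchanged[OF r1 1(2)]) auto
      have st2: "status c f (t * S) o0 s2" by (rule status_unchanged[OF st1 1(2)]) auto
      have e2: "env s2" "inp s2" "ordered s2 c f" using c2 by (auto simp: base_ctx_def)
      have g2: "reg s2 ''t0'' = int (t * S)" "reg s2 ''ea'' = ?\<alpha>" "reg s2 ''e0'' = bot_exp f t"
        using unchanged_reg[OF 1(2)] p1 by simp_all
      have cl: "\<forall>z<N. arr s2 ''ar'' z = 0" using 1(1) by blast
      note p2 = 1(1)
      show ?case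
      proof (subst runs_Seq, rule runs_conseq[OF fill_x_prog[OF e2 f g2(1) t(2) g2(2) cl]], goal_cases)
        case (1 t3 s3)
        have c3: "base_ctx c f s3" by (rule base_ctx_unchanged[OF c2 1(2)]) (auto simp: env_regs_def)
        have r3: "roots s3" by (rule roots_unchanged[OF r2 1(2)]) auto
        have st3: "status c f (t * S) o0 s3" by (rule status_unchanged[OF st2 1(2)]) auto
        have e3: "env s3" "inp s3" "ordered s3 c f" using c3 by (auto simp: base_ctx_def)
        have g3: "reg s3 ''t0'' = int (t * S)" "reg s3 ''ea'' = ?\<alpha>" "reg s3 ''e0'' = bot_exp f t"
          using unchanged_reg[OF 1(2)] g2 by simp_all
        have a3: "arr s3 ''ai'' = arr s2 ''ai''" "arr s3 ''br'' = arr s2 ''br''" "arr s3 ''bi'' = arr s2 ''bi''"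
          using unchanged_arr[OF 1(2)] by simp_all
        have cl3: "\<forall>z<N. arr s3 ''br'' z = 0" using p2 a3 by simp
        note p3 = 1(1)
        show ?case
        proof (subst runs_Seq, rule runs_conseq[OF fill_y_prog[OF e3(1,2) g3(2) of(10) cl3]], goal_cases)
          case (1 t4 s4)
          have c4: "base_ctx c f s4" by (rule base_ctx_unchanged[OF c3 1(2)]) (auto simp: env_regs_def)
          have r4: "roots s4" by (rule roots_unchanged[OF r3 1(2)]) auto
          have st4: "status c f (t * S) o0 s4" by (rule status_unchanged[OF st3 1(2)]) auto
          have e4: "env s4" using c4 by (auto simp: base_ctx_def)
          have g4: "reg s4 ''t0'' = int (t * S)" "reg s4 ''ea'' = ?\<alpha>" "reg s4 ''e0'' = bot_exp f t"
            using unchanged_reg[OF 1(2)] g3 by simp_all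
          have a4: "arr s4 ''ar'' = arr s3 ''ar''" "arr s4 ''ai'' = arr s3 ''ai''" "arr s4 ''bi'' = arr s3 ''bi''"
            using unchanged_arr[OF 1(2)] by simp_all
          have A: "arr s4 ''ar'' z = (if z \<in> PA ?\<alpha> f (t * S) (hi c t) then Q else 0) \<and> arr s4 ''ai'' z = 0" if "z < N" for z
            using p3 p2 that unfolding a4 a3 by blast
          have B: "arr s4 ''br'' z = (if z \<in> PB ?\<alpha> n then Q else 0) \<and> arr s4 ''bi'' z = 0" if "z < N" for z
            using 1(1) p2 that unfolding a4 a3 by blast
          note p4 = 1(1)
          show ?case
          proof (subst runs_Seq, rule runs_conseq[OF conv_prog[OF e4 r4 PA_PB(1-3)[OF f t(2)] A B]], goal_cases)
            case (5 t5 s5)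
            have c5: "base_ctx c f s5" by (rule base_ctx_unchanged[OF c4 5(2)]) (auto simp: env_regs_def fft_regs_def)
            have st5: "status c f (t * S) o0 s5" by (rule status_unchanged[OF st4 5(2)]) auto
            have g5: "reg s5 ''t0'' = int (t * S)" "reg s5 ''ea'' = ?\<alpha>" "reg s5 ''e0'' = bot_exp f t"
              using unchanged_reg[OF 5(2)] g4 by (simp_all add: fft_regs_def)
            show ?case
            proof (rule runs_conseq[OF hits_prog[OF c5 f t(2) g5 conjunct2[OF 5(1)] st5]], goal_cases)
              case (1 t6 s6)
              have "t1 + (t2 + (t3 + (t4 + (t5 + t6)))) \<le> 500 * (q * N)"
                using p1 p2 p3 p4 5(1) 1(1) time by linarith
              then show ?case using 1(1) by blast
            qed
          qed assumption+
        qed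
      qed
    qed
  qed
qed

definition groups_prog :: com where
  "groups_prog =
     Assign ''gr'' ((Reg ''cnt'' \<oplus> Reg ''S'' \<ominus> Const 1) \<oslash> Reg ''S'') ;;
     For ''tt'' ''gr'' group_prog"

lemma written_groups [simp]:
  "written_regs groups_prog = {''gr'', ''tt''} \<union> written_regs group_prog"
  "written_arrs groups_prog = written_arrs group_prog"
  by (auto simp: groups_prog_def)

text \<open>There are \<open>g = (c + S - 1) div S\<close> groups, each costing a multiple of
  \<open>q * N\<close>. The assumption \<open>S < c\<close> gives \<open>g * S \<le> 2 * n\<close>,
  so replacing one factor \<open>S\<close> of \<open>N \<le> 2 * (S * S)\<close> bounds
  \<open>g * N\<close> by \<open>4 * (n * S)\<close>.\<close>

lemma groups_prog:
  assumes ctx: "base_ctx c f s" and roots: "roots s" and f: "order c f" and Sc: "S < c"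
    and st: "status c f 0 o0 s"
  shows "runs L groups_prog s (\<lambda>u s'. u \<le> 2100 * (q * (n * S)) \<and> (\<exists>b\<ge>c. status c f b o0 s'))"
proof -
  define g where "g = (c + S - 1) div S"
  have c: "c \<le> n" using f by (simp add: order_def)
  have tS: "t * S < c" if "t < g" for t
  proof -
    have "Suc t * S \<le> g * S" using that by (intro mult_le_mono1) simp
    also have "\<dots> \<le> c + S - 1" unfolding g_def by (simp add: minus_mod_eq_div_mult[symmetric])
    finally show ?thesis using pos(4) unfolding mult_Suc by linarith
  qed
  have gS: "c \<le> g * S"
  proof -
    have "c + S - 1 = g * S + (c + S - 1) mod S" unfolding g_def by simp
    moreover have "(c + S - 1) mod S < S" using pos(4) by (rule mod_less_divisor)
    ultimately show ?thesis by linarith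
  qed
  have gS2: "g * S \<le> c + S" unfolding g_def using div_times_less_eq_dividend[of "c + S - 1" S] by linarith
  \<comment> \<open>The factor 2 is lost only for odd \<open>q\<close>, where \<open>S\<close> is
    rounded down to a power of two.\<close>
  have N2: "N \<le> 2 * (S * S)"
  proof -
    have "q \<le> Suc (q div 2 + q div 2)" by simp
    then have "(2::nat) ^ q \<le> 2 ^ Suc (q div 2 + q div 2)" by (intro power_increasing) auto
    then show ?thesis unfolding N_def S_def by (simp add: power_add)
  qed
  have gN: "g * N \<le> 4 * (n * S)"
  proof -
    have "g * N \<le> g * (2 * (S * S))" using N2 by (rule mult_le_mono2)
    also have "\<dots> = 2 * (g * S) * S" by simp
    also have "\<dots> \<le> 2 * (n + n) * S" using gS2 c Sc by (intro mult_le_mono1) simp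
    finally show ?thesis by simp
  qed
  have gn: "g \<le> N"
  proof -
    have "g * 1 \<le> g * N" using N256 by (intro mult_le_mono2) linarith
    moreover have "g * S \<le> 2 * N" using gS2 c Sc le_N by linarith
    moreover have "2 \<le> S" unfolding S_def using q8 by (cases "q div 2") auto
    then have "g * 2 \<le> g * S" by (rule mult_le_mono2)
    ultimately show ?thesis by linarith
  qed
  have time: "5 + 1 + (g * (500 * (q * N) + 8) + 6) + 10 \<le> 2100 * (q * (n * S))"
  proof -
    have "g * (500 * (q * N) + 8) = 500 * (q * (g * N)) + 8 * g" by (simp add: algebra_simps)
    moreover have "q * (g * N) \<le> q * (4 * (n * S))" using gN by (rule mult_le_mono2)
    moreover have "g * 1 \<le> g * N" using N256 by (intro mult_le_mono2) linarith
    then have "g \<le> 4 * (n * S)" using gN by linarith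
    moreover have "8 * (n * S) \<le> q * (n * S)" using q8 by (rule mult_le_mono1)
    moreover have "1 * 1 \<le> n * S" using n1 pos(4) by (intro mult_le_mono) linarith+
    ultimately show ?thesis by linarith
  qed
  have e: "reg s ''cnt'' = int c" "reg s ''S'' = int S" using ctx by (auto simp: base_ctx_def env_def ordered_def)
  have gv: "(int c + int S - 1) div int S = int g"
  proof -
    have "int c + int S - 1 = int (c + S - 1)" using pos(4) by linarith
    then show ?thesis by (simp only: g_def zdiv_int)
  qed
  have w: "wd k (int c)" "wd k (int g)" if "3 \<le> k" for k
    using that c le_N(1) gn by - (rule wd_nat; linarith)+
  let ?s1 = "s\<lparr>reg := (reg s)(''gr'' := int g)\<rparr>"
  have un1: "unchanged {''gr''} {} s ?s1" by (simp add: unchanged_def)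
  have ctx1: "base_ctx c f ?s1" by (rule base_ctx_unchanged[OF ctx un1]) (auto simp: env_regs_def)
  have roots1: "roots ?s1" by (rule roots_unchanged[OF roots un1]) auto
  have st1: "status c f 0 o0 ?s1" by (rule status_unchanged[OF st un1]) auto
  have loop: "runs L (For ''tt'' ''gr'' group_prog) ?s1 (\<lambda>u s'. u \<le> g * (500 * (q * N) + 8) + 6 \<and> status c f (g * S) o0 s')"
  proof (rule runs_For[where m = g and T = "500 * (q * N)" and I = "\<lambda>t s'. status c f (t * S) o0 s'"], goal_cases)
    case (7 t s' v)
    have un: "unchanged {''tt''} {} s' (s'\<lparr>reg := (reg s')(''tt'' := v)\<rparr>)" by (simp add: unchanged_def)
    show ?case by (rule status_unchanged[OF 7 un]) auto
  next
    case 8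
    then show ?case using st1 by simp
  next
    case (9 t s')
    have ctx': "base_ctx c f s'" by (rule base_ctx_unchanged[OF ctx1 9(4)]) (auto simp: env_regs_def fft_regs_def)
    have roots': "roots s'" by (rule roots_unchanged[OF roots1 9(4)]) auto
    show ?case
      by (rule runs_conseq[OF group_prog[OF ctx' roots' f 9(2) tS[OF 9(1)] 9(3)]]) (simp add: add.commute)
  next
    case (10 t s')
    then show ?case by simp
  qed (use w in \<open>auto simp: fft_regs_def\<close>)
  show ?thesis
    unfolding groups_prog_def runs_Seq
    apply (rule runs_Assign_val[where v = "int g"])
      apply (use e w in \<open>simp add: wd_rules\<close>)
     apply (use e gv in simp)
    apply (rule runs_conseq[OF loop])
    using time gS by auto
qed

end

section \<open>The algorithm\<close>

context pair_inst
begin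

text \<open>The reference exponent is \<open>xe i\<close> itself, so \<open>xm\<close> is shifted by
  exactly \<open>p\<close> and the candidate is accurate regardless of the group. The exact sum is
  avoided because aligning a much smaller summand would need more bits than a word has.\<close>

definition score_prog :: com where
  "score_prog =
     Assign ''cm'' (((Arr ''xm'' (Reg ''i'') \<lless> Reg ''K'') \<ggreater> Reg ''p'') \<oplus>
       ((Arr ''ym'' (Reg ''j'') \<lless> Reg ''K'') \<ggreater> (Reg ''p'' \<oplus> Arr ''xe'' (Reg ''i'') \<ominus> Arr ''ye'' (Reg ''j''))) \<oplus> Const 2) ;;
     Assign ''ce'' (Reg ''p'' \<oplus> Arr ''xe'' (Reg ''i'') \<ominus> Reg ''K'') ;;
     update_prog"

definition try_prog :: com where
  "try_prog =
     Assign ''i'' (Arr ''ord'' (Reg ''y'')) ;;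
     Cond (Reg ''kk'' \<prec> Reg ''i'') Skip
       (Assign ''j'' (Reg ''kk'' \<ominus> Reg ''i'') ;;
        Cond (Arr ''ym'' (Reg ''j'') \<doteq> Const 0) Skip
          (Cond (Arr ''xe'' (Reg ''i'') \<prec> Arr ''ye'' (Reg ''j'')) Skip score_prog))"

definition row_prog :: com where
  "row_prog =
     Assign ''g0'' (Arr ''G'' (Const 3 \<otimes> Reg ''kk'' \<oplus> Reg ''r3'')) ;;
     For ''x'' ''S''
       (Assign ''y'' (Reg ''g0'' \<oplus> Reg ''x'') ;; Cond (Reg ''y'' \<prec> Reg ''cnt'') try_prog Skip)"

definition brute_prog :: com where
  "brute_prog =
     Assign ''three'' (Const 3) ;;
     For ''kk'' ''n'' (For ''r3'' ''three'' row_prog)"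

lemma written_brute [simp]:
  "written_regs score_prog = {''cm'', ''ce'', ''d''}" "written_arrs score_prog = {''C_man'', ''C_exp''}"
  "written_regs try_prog = {''i'', ''j'', ''cm'', ''ce'', ''d''}" "written_arrs try_prog = {''C_man'', ''C_exp''}"
  "written_regs row_prog = {''g0'', ''x'', ''y'', ''i'', ''j'', ''cm'', ''ce'', ''d''}" "written_arrs row_prog = {''C_man'', ''C_exp''}"
  "written_regs brute_prog = {''three'', ''kk'', ''r3'', ''g0'', ''x'', ''y'', ''i'', ''j'', ''cm'', ''ce'', ''d''}"
  "written_arrs brute_prog = {''C_man'', ''C_exp''}"
  by (auto simp: score_prog_def try_prog_def row_prog_def brute_prog_def)

definition valid_out :: "state \<Rightarrow> bool" where
  "valid_out s \<longleftrightarrow> C_words s \<and> (\<forall>k<n. lb k \<le> output_seq s k)"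

lemma valid_out_reg [simp]: "valid_out (s\<lparr>reg := r\<rparr>) = valid_out s" "output_seq (s\<lparr>reg := r\<rparr>) = output_seq s"
  "C_words (s\<lparr>reg := r\<rparr>) = C_words s"
  by (auto simp: valid_out_def C_words_def output_seq_def fun_eq_iff)

definition settled :: "(nat \<Rightarrow> nat) \<Rightarrow> nat \<Rightarrow> nat \<Rightarrow> state \<Rightarrow> bool" where
  "settled f k z s \<longleftrightarrow> (\<forall>j. role f k z j \<longrightarrow> output_seq s k \<le> ereal (approx * sum (f z) j))"

lemma settled_mono: "settled f k z s \<Longrightarrow> output_seq s' k \<le> output_seq s k \<Longrightarrow> settled f k z s'"
  unfolding settled_def by (meson order_trans)

lemma settled_reg [simp]: "settled f k z (s\<lparr>reg := r\<rparr>) = settled f k z s"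
  by (simp add: settled_def)

lemma score_prog:
  assumes ctx: "base_ctx c f s" and i: "reg s ''i'' = int i" "i < n" "xm i \<noteq> 0"
    and j: "reg s ''j'' = int j" "ym j \<noteq> 0" "ye j \<le> xe i" and k: "reg s ''kk'' = int (i + j)" "i + j < n" and v: "valid_out s"
  shows "runs L score_prog s (\<lambda>t s'. t \<le> 70 \<and> valid_out s' \<and> (\<forall>k'. output_seq s' k' \<le> output_seq s k') \<and>
     output_seq s' (i + j) \<le> ereal (approx * sum i j))"
proof -
  have jn: "j < n" using k by simp
  define \<alpha> where "\<alpha> = xe i"
  have regs: "reg s ''K'' = int K" "reg s ''p'' = int p"
    and arrs: "arr s ''xm'' i = xm i" "arr s ''xe'' i = xe i" "arr s ''ym'' j = ym j" "arr s ''ye'' j = ye j"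
    using ctx i jn by (auto simp: base_ctx_def env_def inp_def)
  have w: "wd a (int i)" "wd a (int j)" if "3 \<le> a" for a
    using that i jn le_N(1) by - (rule wd_nat; linarith)+
  have dX: "(xm i * 2 ^ K) div 2 ^ p = dx \<alpha> i" by (simp add: digit_def \<alpha>_def)
  have dY: "(ym j * 2 ^ K) div 2 ^ nat (int p + xe i - ye j) = dy \<alpha> j" by (simp add: digit_def \<alpha>_def)
  have yj: "ye j \<le> \<alpha>" using j by (simp add: \<alpha>_def)
  have b: "0 \<le> dx \<alpha> i" "dx \<alpha> i < 2 ^ K" "0 \<le> dy \<alpha> j" "dy \<alpha> j < 2 ^ K"
    using dx_bounds[OF i(2), of \<alpha>] dy_bounds[OF jn yj] by (auto simp: \<alpha>_def)
  have wd: "wd a (dx \<alpha> i)" "wd a (dy \<alpha> j)" if "3 \<le> a" for a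
    using b by (auto intro: wd_le[OF wd_2K[OF that]])
  have \<alpha>w: "wd a \<alpha>" for a unfolding \<alpha>_def by (rule wd_xy(2)[OF i(2)])
  let ?m = "dx \<alpha> i + dy \<alpha> j + 2" and ?e = "int p + \<alpha> - int K"
  let ?c = "cand \<alpha> (dx \<alpha> i + dy \<alpha> j)"
  let ?s2 = "s\<lparr>reg := (reg s)(''cm'' := ?m, ''ce'' := ?e)\<rparr>"
  have upd: "runs L update_prog ?s2 (\<lambda>t s'. t \<le> 40 \<and> C_words s' \<and>
     output_seq s' = (output_seq s)(i + j := min (output_seq s (i + j)) (ereal ?c)))"
  proof -
    have "C_words ?s2" using v by (simp add: valid_out_def)
    moreover have "wd 6 ?m" "wd 6 ?e" using wd \<alpha>w by (simp_all add: wd_rules)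
    ultimately have "runs L update_prog ?s2 (\<lambda>t s'. t \<le> 40 \<and> C_words s' \<and>
       output_seq s' = (output_seq ?s2)(i + j := min (output_seq ?s2 (i + j)) (ereal (fval ?m ?e))))"
      using update_prog[of ?s2 "i + j" ?m ?e] k b by simp
    then show ?thesis by (simp add: cand_def)
  qed
  have sum_le: "sum i j \<le> ?c" by (rule cand_ge_sum) (use yj in \<open>auto simp: \<alpha>_def\<close>)
  have le_sum: "?c \<le> approx * sum i j"
    by (rule cand_le_sum) (use i jn yj in \<open>auto simp: \<alpha>_def\<close>)
  have "lb (i + j) \<le> ereal (sum i j)" using lb[of i j] i j k unfolding sum_def by simp
  then have lbc: "lb (i + j) \<le> ereal ?c" using sum_le by (meson ereal_less_eq(3) order_trans)
  have e1: "expr_safe L (((Arr ''xm'' (Reg ''i'') \<lless> Reg ''K'') \<ggreater> Reg ''p'') \<oplus>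
       ((Arr ''ym'' (Reg ''j'') \<lless> Reg ''K'') \<ggreater> (Reg ''p'' \<oplus> Arr ''xe'' (Reg ''i'') \<ominus> Arr ''ye'' (Reg ''j''))) \<oplus> Const 2) s"
    using i j regs w wd wd_xy(1,2)[OF i(2)] wd_xy(3,4)[OF jn] by (simp add: arrs wd_rules wd_2K dX dY)
  have e2: "expr_val (((Arr ''xm'' (Reg ''i'') \<lless> Reg ''K'') \<ggreater> Reg ''p'') \<oplus>
       ((Arr ''ym'' (Reg ''j'') \<lless> Reg ''K'') \<ggreater> (Reg ''p'' \<oplus> Arr ''xe'' (Reg ''i'') \<ominus> Arr ''ye'' (Reg ''j''))) \<oplus> Const 2) s = ?m"
    using i j regs by (simp add: arrs dX dY)
  show ?thesis
    unfolding score_prog_def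
    apply (subst runs_Seq, rule runs_Assign_val[OF e1 e2])
    apply (subst runs_Seq, rule runs_Assign_val[where v = ?e])
      apply (simp add: i regs arrs w wd_rules wd_xy[OF i(2)])
     apply (simp add: i regs arrs \<alpha>_def)
    apply (rule runs_conseq[of L update_prog _ "\<lambda>t s'. t \<le> 40 \<and> C_words s' \<and>
       output_seq s' = (output_seq s)(i + j := min (output_seq s (i + j)) (ereal ?c))"])
    subgoal using upd by simp
    subgoal premises prems for t s'
    proof -
      have out: "output_seq s' = (output_seq s)(i + j := min (output_seq s (i + j)) (ereal ?c))"
        and C: "C_words s'" and t: "t \<le> 40" using prems(1) by auto
      have "output_seq s' (i + j) \<le> ereal ?c" unfolding out by simp
      also have "\<dots> \<le> ereal (approx * sum i j)" using le_sum by simp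
      finally have "output_seq s' (i + j) \<le> ereal (approx * sum i j)" .
      moreover have "valid_out s'" using v C lbc unfolding valid_out_def out by auto
      moreover have "output_seq s' k' \<le> output_seq s k'" for k' unfolding out by simp
      ultimately show ?thesis using t by simp
    qed
    done
qed

lemma try_prog:
  assumes ctx: "base_ctx c f s" and f: "order c f" and k: "reg s ''kk'' = int k" "k < n"
    and z: "reg s ''y'' = int z" "z < c" and v: "valid_out s"
  shows "runs L try_prog s (\<lambda>t s'. t \<le> 110 \<and> valid_out s' \<and> (\<forall>k'. output_seq s' k' \<le> output_seq s k') \<and> settled f k z s')"
proof -
  let ?i = "f z"
  have i: "?i < n" "xm ?i \<noteq> 0" and cn: "c \<le> n" using f z by (auto simp: order_def)
  have ord: "arr s ''ord'' z = int ?i"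
    and arrs: "\<And>i. i < n \<Longrightarrow> arr s ''xm'' i = xm i \<and> arr s ''xe'' i = xe i \<and> arr s ''ym'' i = ym i \<and> arr s ''ye'' i = ye i"
    using ctx z by (auto simp: base_ctx_def env_def ordered_def inp_def)
  have w: "wd a (int z)" "wd a (int ?i)" "wd a (int k)" if "3 \<le> a" for a
    using that i cn z k le_N(1) by - (rule wd_nat; linarith)+
  show ?thesis
  proof (cases "?i \<le> k")
    case False
    then have "settled f k z s" unfolding settled_def role_def by auto
    then show ?thesis unfolding try_prog_def using False k z w ord v by simp
  next
    case True
    then obtain j where kj: "k = ?i + j" using le_Suc_ex by blast
    have jn: "j < n" using kj k by simp
    have wj: "wd a (int j)" if "3 \<le> a" for a using that jn le_N(1) by (intro wd_nat) auto
    have wij: "wd a (int ?i + int j)" if "3 \<le> a" for a using w(3)[OF that] by (simp add: kj)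
    have role: "role f k z j' \<longleftrightarrow> j' = j \<and> ym j \<noteq> 0 \<and> ye j \<le> xe ?i" for j'
      unfolding role_def kj by auto
    have kk: "reg s ''kk'' = int ?i + int j" using k kj by simp
    note a = arrs[OF jn] arrs[OF i(1)] wd_xy[OF jn] wd_xy[OF i(1)]
    show ?thesis
    proof (cases "ym j \<noteq> 0 \<and> ye j \<le> xe ?i")
      case yes: True
      let ?s1 = "s\<lparr>reg := (reg s)(''i'' := int ?i, ''j'' := int j)\<rparr>"
      have ctx1: "base_ctx c f ?s1"
        by (rule base_ctx_unchanged[OF ctx, of "{''i'', ''j''}" "{}"]) (auto simp: unchanged_def env_regs_def)
      have sp: "runs L score_prog ?s1 (\<lambda>t s'. t \<le> 70 \<and> valid_out s' \<and> (\<forall>k'. output_seq s' k' \<le> output_seq s k') \<and>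
         output_seq s' k \<le> ereal (approx * sum ?i j))"
        using score_prog[OF ctx1, of ?i j] i yes k kj v by simp
      have "settled f k z s'" if "output_seq s' k \<le> ereal (approx * sum ?i j)" for s'
        using that unfolding settled_def role by blast
      note set = this
      show ?thesis
        unfolding try_prog_def
        using z ord kk w wj wij a yes
        apply (simp add: wd_rules)
        apply (rule runs_conseq[OF sp])
        using set by auto
    next
      case no: False
      then have "settled f k z s" unfolding settled_def role by blast
      then show ?thesis
        unfolding try_prog_def
        using z ord kk w wj wij a no v by (cases "ym j = 0") (simp_all add: wd_rules)
    qed
  qed
qed

lemma row_prog:
  assumes ctx: "base_ctx c f s" and f: "order c f" and k: "reg s ''kk'' = int k" "k < n" and r: "reg s ''r3'' = int r" "r < 3"
    and G: "0 \<le> arr s ''G'' (3 * k + r)" "arr s ''G'' (3 * k + r) \<le> int n" and v: "valid_out s"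
  shows "runs L row_prog s (\<lambda>t s'. t \<le> S * 140 + 20 \<and> valid_out s' \<and> (\<forall>k'. output_seq s' k' \<le> output_seq s k') \<and>
     (\<forall>z<c. arr s ''G'' (3 * k + r) \<le> int z \<and> int z < arr s ''G'' (3 * k + r) + int S \<longrightarrow> settled f k z s'))"
proof -
  obtain g where g: "arr s ''G'' (3 * k + r) = int g" "g \<le> n" using G nonneg_int_cases by (metis of_nat_le_iff)
  have cn: "c \<le> n" using f by (simp add: order_def)
  have idx: "nat (3 * int k + int r) = 3 * k + r" by simp
  have w: "wd a (int k)" "wd a (int r)" "wd a (int g)" "wd a (int c)" if "3 \<le> a" for a
    using that k r g cn le_N(1) N256 by - (rule wd_nat; linarith)+
  let ?s1 = "s\<lparr>reg := (reg s)(''g0'' := int g)\<rparr>"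
  have ctx1: "base_ctx c f ?s1"
    by (rule base_ctx_unchanged[OF ctx, of "{''g0''}" "{}"]) (auto simp: unchanged_def env_regs_def)
  let ?I = "\<lambda>m s'. valid_out s' \<and> (\<forall>k'. output_seq s' k' \<le> output_seq s k') \<and>
     (\<forall>z<c. g \<le> z \<and> z < g + m \<longrightarrow> settled f k z s')"
  have loop: "runs L (For ''x'' ''S'' (Assign ''y'' (Reg ''g0'' \<oplus> Reg ''x'') ;; Cond (Reg ''y'' \<prec> Reg ''cnt'') try_prog Skip)) ?s1
     (\<lambda>t s'. t \<le> S * 140 + 6 \<and> ?I S s')"
  proof (rule runs_For[where m = S and T = 132 and I = ?I], goal_cases)
    case 8
    then show ?case using v by auto
  next
    case (9 m s')
    have ctx': "base_ctx c f s'" by (rule base_ctx_unchanged[OF ctx1 9(4)]) (auto simp: env_regs_def)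
    have regs: "reg s' ''g0'' = int g" "reg s' ''kk'' = int k" using unchanged_reg[OF 9(4)] k by simp_all
    have cnt: "reg s' ''cnt'' = int c" using ctx' by (simp add: base_ctx_def ordered_def)
    define z where "z = g + m"
    have wm: "wd a (int m)" if "3 \<le> a" for a using that 9(1) le_N(4) by (intro wd_nat) auto
    have wz: "wd a (int z)" if "4 \<le> a" for a using that w wm by (simp add: z_def wd_rules)
    let ?s2 = "s'\<lparr>reg := (reg s')(''y'' := int z)\<rparr>"
    have ctx2: "base_ctx c f ?s2"
      by (rule base_ctx_unchanged[OF ctx', of "{''y''}" "{}"]) (auto simp: unchanged_def env_regs_def)
    have safe: "expr_safe L (Reg ''g0'' \<oplus> Reg ''x'') s'" "expr_val (Reg ''g0'' \<oplus> Reg ''x'') s' = int z"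
      using regs 9(2) w wm by (simp_all add: wd_rules z_def)
    show ?case
    proof (cases "z < c")
      case True
      have tp: "runs L try_prog ?s2 (\<lambda>t s''. t \<le> 110 \<and> valid_out s'' \<and> (\<forall>k'. output_seq s'' k' \<le> output_seq s' k') \<and> settled f k z s'')"
        using try_prog[OF ctx2 f, of k z] regs k True 9(3) by simp
      show ?thesis
        apply (subst runs_Seq, rule runs_Assign_val[OF safe])
        using True cnt wz w apply simp
        apply (rule runs_conseq[OF tp])
        subgoal premises prems for t s''
        proof -
          have post: "valid_out s''" "\<And>k'. output_seq s'' k' \<le> output_seq s' k'" "settled f k z s''" "t \<le> 110" using prems by auto
          have I: "\<And>k'. output_seq s' k' \<le> output_seq s k'" "\<And>z. z < c \<Longrightarrow> g \<le> z \<Longrightarrow> z < g + m \<Longrightarrow> settled f k z s'" using 9(3) by auto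
          have "settled f k z' s''" if "z' < c" "g \<le> z'" "z' < g + Suc m" for z'
          proof (cases "z' = z")
            case False
            then have "settled f k z' s'" using that I(2) by (simp add: z_def)
            then show ?thesis using settled_mono post(2) by blast
          qed (use post in simp)
          moreover have "output_seq s'' k' \<le> output_seq s k'" for k' using post(2) I(1) by (meson order_trans)
          ultimately show ?thesis using post by simp
        qed
        done
    next
      case False
      show ?thesis
        apply (subst runs_Seq, rule runs_Assign_val[OF safe])
        using False cnt wz w 9(3) by (auto simp: z_def less_Suc_eq)
    qed
  next
    case (10 t s')
    then show ?case by simp
  qed (use ctx in \<open>auto simp: base_ctx_def env_def wd_rules\<close>)
  show ?thesis
    unfolding row_prog_def
    apply (subst runs_Seq, rule runs_Assign_val[where v = "int g"])
      apply (use k r w g in \<open>simp add: wd_rules idx\<close>)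
     apply (use k r g in \<open>simp add: idx\<close>)
    apply (rule runs_conseq[OF loop])
    using g by auto
qed

lemma brute_prog:
  assumes ctx: "base_ctx c f s" and f: "order c f"
    and G: "\<And>k r. k < n \<Longrightarrow> r < 3 \<Longrightarrow> 0 \<le> arr s ''G'' (3 * k + r) \<and> arr s ''G'' (3 * k + r) \<le> int n" and v: "valid_out s"
  shows "runs L brute_prog s (\<lambda>t s'. t \<le> 700 * (n * S) \<and> valid_out s' \<and> (\<forall>k'. output_seq s' k' \<le> output_seq s k') \<and>
     (\<forall>k<n. \<forall>r<3. \<forall>z<c. arr s ''G'' (3 * k + r) \<le> int z \<and> int z < arr s ''G'' (3 * k + r) + int S \<longrightarrow> settled f k z s'))"
proof -
  define cov where "cov k r s' \<longleftrightarrow> (\<forall>z<c. arr s ''G'' (3 * k + r) \<le> int z \<and> int z < arr s ''G'' (3 * k + r) + int S \<longrightarrow> settled f k z s')"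
    for k r and s' :: state
  have cov_mono: "cov k r s' \<Longrightarrow> (\<And>k'. output_seq s'' k' \<le> output_seq s' k') \<Longrightarrow> cov k r s''" for k r s' s''
    unfolding cov_def using settled_mono by blast
  have cov_reg: "cov k r (s'\<lparr>reg := x\<rparr>) = cov k r s'" for k r s' x by (simp add: cov_def)
  let ?s1 = "s\<lparr>reg := (reg s)(''three'' := 3)\<rparr>"
  have ctx1: "base_ctx c f ?s1"
    by (rule base_ctx_unchanged[OF ctx, of "{''three''}" "{}"]) (auto simp: unchanged_def env_regs_def)
  let ?J = "\<lambda>m s'. valid_out s' \<and> (\<forall>k'. output_seq s' k' \<le> output_seq s k') \<and> (\<forall>k<m. \<forall>r<3. cov k r s')"
  have loop: "runs L (For ''kk'' ''n'' (For ''r3'' ''three'' row_prog)) ?s1 (\<lambda>t s'. t \<le> n * (S * 420 + 98) + 6 \<and> ?J n s')"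
  proof (rule runs_For[where m = n and T = "S * 420 + 90" and I = ?J], goal_cases)
    case (7 k s' x)
    then show ?case by (simp add: cov_reg)
  next
    case 8
    then show ?case using v by auto
  next
    case (9 k s')
    have ctx': "base_ctx c f s'" by (rule base_ctx_unchanged[OF ctx1 9(4)]) (auto simp: env_regs_def)
    have regs: "reg s' ''three'' = int 3" "arr s' ''G'' = arr s ''G''"
      using unchanged_reg[OF 9(4)] unchanged_arr[OF 9(4)] by simp_all
    show ?case
    proof (rule runs_For[where m = 3 and T = "S * 140 + 20" and I = "\<lambda>m s2. valid_out s2 \<and> (\<forall>k'. output_seq s2 k' \<le> output_seq s' k') \<and> (\<forall>r<m. cov k r s2)"], goal_cases)
      case (7 r s2 x)
      then show ?case by (simp add: cov_reg)
    next
      case 8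
      then show ?case using 9(3) by simp
    next
      case (9 r s2)
      have ctx2: "base_ctx c f s2" by (rule base_ctx_unchanged[OF ctx' 9(4)]) (auto simp: env_regs_def)
      have regs2: "reg s2 ''kk'' = int k" "arr s2 ''G'' = arr s ''G''"
        using unchanged_reg[OF 9(4)] unchanged_arr[OF 9(4)] regs \<open>reg s' ''kk'' = int k\<close> by simp_all
      have rp: "runs L row_prog s2 (\<lambda>t s3. t \<le> S * 140 + 20 \<and> valid_out s3 \<and> (\<forall>k'. output_seq s3 k' \<le> output_seq s2 k') \<and> cov k r s3)"
        using row_prog[OF ctx2 f regs2(1) \<open>k < n\<close> 9(2,1)] G[OF \<open>k < n\<close> 9(1)] 9(3) unfolding regs2 cov_def by simp
      show ?case
      proof (rule runs_conseq[OF rp], goal_cases)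
        case (1 t s3)
        have "cov k r' s3" if "r' < Suc r" for r'
          using that 9(3) 1(1) cov_mono[of k r' s2 s3] by (cases "r' = r") auto
        moreover have "output_seq s3 k' \<le> output_seq s' k'" for k' using 1(1) 9(3) by (meson order_trans)
        ultimately show ?case using 1(1) by blast
      qed
    next
      case (10 t s2)
      have "cov k' r s2" if "k' < Suc k" "r < 3" for k' r
        using that \<open>?J k s'\<close> 10(2) cov_mono[of k' r s' s2] by (cases "k' = k") auto
      moreover have "output_seq s2 k' \<le> output_seq s k'" for k' using 10(2) \<open>?J k s'\<close> by (meson order_trans)
      moreover have "t \<le> S * 420 + 90" using 10(1) by simp
      ultimately show ?case using 10(2) by blast
    qed (use regs in \<open>auto simp: wd_rules\<close>)
  next
    case (10 t s')
    then show ?case by (simp add: algebra_simps)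
  qed (use ctx in \<open>auto simp: base_ctx_def env_def wd_rules\<close>)
  have time: "2 + (n * (S * 420 + 98) + 6) \<le> 700 * (n * S)"
  proof -
    have "n * 1 \<le> n * S" using pos(4) by (intro mult_le_mono2) linarith
    then show ?thesis using n1 unfolding distrib_left by linarith
  qed
  show ?thesis
    unfolding brute_prog_def
    apply (subst runs_Seq, rule runs_Assign_val[where v = 3])
      apply simp
     apply simp
    apply (rule runs_conseq[OF loop])
    using time unfolding cov_def by auto
qed

text \<open>With at most \<open>S\<close> finite entries the convolutions are skipped: the
  zero-initialised slots of \<open>G\<close> already point at a window that contains the whole
  order.\<close>

definition body_prog :: com where
  "body_prog = sort_prog ;; Cond (Reg ''S'' \<prec> Reg ''cnt'') groups_prog Skip ;; brute_prog"

lemma body_prog: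
  assumes env: "env s" and inp: "inp s" and roots: "S < n \<Longrightarrow> roots s" and C: "C_words s"
    and init: "\<And>k. k < n \<Longrightarrow> arr s ''Fl'' k = 0 \<and> arr s ''Fe'' k = 0" "\<And>k r. k < n \<Longrightarrow> r < 3 \<Longrightarrow> arr s ''G'' (3 * k + r) = 0"
    and lbs: "\<And>k. k < n \<Longrightarrow> lb k \<le> output_seq s k" and P2: "P \<le> 2 * n"
  shows "runs L body_prog s (\<lambda>t s'. t \<le> 3000 * (q * (n * S)) \<and> valid_out s' \<and> (\<forall>k<n. output_seq s' k \<le> output_seq s k) \<and>
     (\<forall>i j. i + j < n \<and> xm i \<noteq> 0 \<and> ym j \<noteq> 0 \<and> ye j \<le> xe i \<longrightarrow> output_seq s' (i + j) \<le> ereal (approx * sum i j)))"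
proof -
  have xs: "wd 0 (arr s ''xe'' i)" "wd 0 (arr s ''xm'' i)" if "i < n" for i
    using inp that x(2,3)[OF that] by (simp_all add: inp_def)
  have nS: "n * 1 \<le> n * S" using pos(4) by (intro mult_le_mono2) linarith
  have time: "(P * 90 + n * (qP * 54 + 58) + 40) + (10 + 2100 * (q * (n * S))) + 700 * (n * S) \<le> 3000 * (q * (n * S))"
  proof -
    have "qP \<le> q" using q_eq by simp
    then have "n * qP \<le> n * q" by (rule mult_le_mono2)
    moreover have "n * q * 1 \<le> n * q * S" using pos(4) by (intro mult_le_mono2) linarith
    moreover have "n * q * S = q * (n * S)" by simp
    moreover have "8 * (n * S) \<le> q * (n * S)" using q8 by (rule mult_le_mono1)
    ultimately show ?thesis using nS P2 n1 unfolding distrib_left by linarith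
  qed
  show ?thesis
    unfolding body_prog_def
  proof (subst runs_Seq, rule runs_conseq[OF sort_prog[OF env xs]], goal_cases)
    case (3 t1 s1)
    then obtain c f where so: "sorted_order s1 c f" by blast
    note un1 = 3(2)
    have env1: "env s1" by (rule env_unchanged[OF env un1]) (auto simp: env_regs_def)
    have inp1: "inp s1" by (rule inp_unchanged[OF inp un1]) auto
    have a1: "arr s1 ''C_man'' = arr s ''C_man''" "arr s1 ''C_exp'' = arr s ''C_exp''" "arr s1 ''Fl'' = arr s ''Fl''"
      "arr s1 ''Fe'' = arr s ''Fe''" "arr s1 ''G'' = arr s ''G''" "arr s1 ''Wr'' = arr s ''Wr''" "arr s1 ''Wi'' = arr s ''Wi''"
      using unchanged_arr[OF un1] by simp_all
    have out1: "output_seq s1 = output_seq s" and C1: "C_words s1" using C by (auto simp: output_seq_def fun_eq_iff C_words_def a1)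
    have ordd: "ordered s1 c f" using so by (simp add: sorted_order_def ordered_def)
    have ix: "arr s1 ''xm'' i = xm i" "arr s1 ''xe'' i = xe i" if "i < n" for i
      using inp1 that by (simp_all add: inp_def)
    have fn: "f z < n" "arr s1 ''xm'' (f z) \<noteq> 0" if "z < c" for z
      using so that by (simp_all add: sorted_order_def)
    have f: "order c f"
      unfolding order_def
    proof (intro conjI allI impI)
      show "c \<le> n" using so by (simp add: sorted_order_def)
    next
      fix z assume "z < c"
      then show "f z < n" "xm (f z) \<noteq> 0" using fn ix(1)[OF fn(1)] by auto
    next
      fix i assume "i < n" "xm i \<noteq> 0"
      then show "\<exists>z<c. f z = i" using so ix(1) unfolding sorted_order_def by simp
    next
      fix y z assume "y \<le> z \<and> z < c"
      then have "y < c" "z < c" "arr s1 ''xe'' (f y) \<le> arr s1 ''xe'' (f z)" using so unfolding sorted_order_def by auto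
      then show "xe (f y) \<le> xe (f z)" using ix(2)[OF fn(1)] by simp
    qed
    have cn: "c \<le> n" using f by (simp add: order_def)
    have ctx1: "base_ctx c f s1" using env1 inp1 ordd by (simp add: base_ctx_def)
    have st1: "status c f 0 (output_seq s) s1"
      unfolding status_def progress_def using C1 init lbs by (simp add: a1 out1)
    \<comment> \<open>The common postcondition of both branches: a role pair is either approximated
      already or lies in a window of \<open>S\<close> elements starting at one of the three recorded
      positions.\<close>
    define mid where "mid s2 \<longleftrightarrow> base_ctx c f s2 \<and> valid_out s2 \<and> (\<forall>k<n. output_seq s2 k \<le> output_seq s k) \<and>
       (\<forall>k<n. \<forall>r<3. 0 \<le> arr s2 ''G'' (3 * k + r) \<and> arr s2 ''G'' (3 * k + r) \<le> int n) \<and>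
       (\<forall>k<n. \<forall>z<c. \<forall>j. role f k z j \<longrightarrow> output_seq s2 k \<le> ereal (approx * sum (f z) j) \<or>
          (\<exists>r<3. arr s2 ''G'' (3 * k + r) \<le> int z \<and> int z < arr s2 ''G'' (3 * k + r) + int S))" for s2 :: state
    have cnt: "reg s1 ''cnt'' = int c" "reg s1 ''S'' = int S" using ctx1 by (auto simp: base_ctx_def env_def ordered_def)
    have wc: "wd 10 (int c)" using cn le_N(1) by (intro wd_nat) auto
    have cond: "runs L (Cond (Reg ''S'' \<prec> Reg ''cnt'') groups_prog Skip) s1 (\<lambda>t s2. t \<le> 10 + 2100 * (q * (n * S)) \<and> mid s2)"
    proof (cases "S < c")
      case True
      have roots1: "roots s1" using roots True cn by (simp add: roots_def a1)
      have gp: "runs L groups_prog s1 (\<lambda>u s'. u \<le> 2100 * (q * (n * S)) \<and> (\<exists>b\<ge>c. status c f b (output_seq s) s'))"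
        by (rule groups_prog[OF ctx1 roots1 f True st1])
      show ?thesis
        using True cnt wc
        apply (simp add: wd_rules del: written_groups)
        apply (rule runs_conseq[OF gp])
        subgoal premises prems for t s2
        proof -
          obtain b where b: "c \<le> b" "status c f b (output_seq s) s2" and t: "t \<le> 2100 * (q * (n * S))" using prems(5) by blast
          have un2: "unchanged (written_regs groups_prog) (written_arrs groups_prog) s1 s2" using prems(6) .
          have ctx2: "base_ctx c f s2"
            by (rule base_ctx_unchanged[OF ctx1 un2]) (auto simp: env_regs_def fft_regs_def)
          have pr: "progress c f b k s2" if "k < n" for k using b that by (simp add: status_def)
          have "output_seq s2 k \<le> ereal (approx * sum (f z) j) \<or>
              (\<exists>r<3. arr s2 ''G'' (3 * k + r) \<le> int z \<and> int z < arr s2 ''G'' (3 * k + r) + int S)"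
            if k: "k < n" and z: "z < c" and rl: "role f k z j" for k z j
          proof -
            have zb: "z < b" using z b by simp
            have zs: "z div S * S \<le> z" "z < z div S * S + S"
              using pos(4) by (simp_all add: div_times_less_eq_dividend dividend_less_div_times add.commute)
            have zi: "int (z div S * S) \<le> int z" "int z < int (z div S * S) + int S"
              using zs unfolding of_nat_add[symmetric] of_nat_le_iff of_nat_less_iff by auto
            have "arr s2 ''Fl'' k = 1" using pr[OF k] zb z rl unfolding progress_def by blast
            then have "output_seq s2 k \<le> ereal (approx * sum (f z) j) \<or>
               arr s2 ''G'' (3 * k) = int (z div S * S) \<or> (\<exists>r\<in>{1,2}. arr s2 ''G'' (3 * k + r) = int (z div S * S))"
              using pr[OF k] zb z rl unfolding progress_def by blast
            then consider "output_seq s2 k \<le> ereal (approx * sum (f z) j)" | r where "r < 3" "arr s2 ''G'' (3 * k + r) = int (z div S * S)"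
            proof (elim disjE bexE, goal_cases)
              case 2
              show ?case by (rule 2(2)[of 0]) (use 2(3) in simp_all)
            next
              case (3 r)
              have "r < 3" using 3(3) by auto
              then show ?case using 3(2,4) by blast
            qed blast
            then show ?thesis using zi by (metis)
          qed
          moreover have "0 \<le> arr s2 ''G'' (3 * k + r) \<and> arr s2 ''G'' (3 * k + r) \<le> int n" if "k < n" "r < 3" for k r
            using pr[OF that(1)] that(2) unfolding progress_def by blast
          ultimately have "mid s2" using ctx2 b unfolding mid_def status_def valid_out_def by blast
          then show ?thesis using t by simp
        qed
        done
    next
      case False
      have "mid s1"
        unfolding mid_def
      proof (intro conjI allI impI)
        show "valid_out s1" using C1 lbs by (simp add: valid_out_def out1)
        fix k z j assume k: "k < n" and z: "z < c"
        \<comment> \<open>The value 0 in slot 0 is not a recorded group but the default; it denotes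
          the first \<open>S\<close> positions, and here \<open>c \<le> S\<close>.\<close>
        have "arr s1 ''G'' (3 * k + 0) \<le> int z \<and> int z < arr s1 ''G'' (3 * k + 0) + int S"
          using init(2)[OF k, of 0] False z unfolding a1 by simp
        then show "output_seq s1 k \<le> ereal (approx * sum (f z) j) \<or>
          (\<exists>r<3. arr s1 ''G'' (3 * k + r) \<le> int z \<and> int z < arr s1 ''G'' (3 * k + r) + int S)"
          by (intro disjI2 exI[of _ 0]) simp
      qed (use ctx1 init out1 a1 in auto)
      then show ?thesis using False cnt wc by (simp add: wd_rules)
    qed
    show ?case
    proof (subst runs_Seq, rule runs_conseq[OF cond], goal_cases)
      case (1 t2 s2)
      have m: "base_ctx c f s2" "valid_out s2" "\<And>k. k < n \<Longrightarrow> output_seq s2 k \<le> output_seq s k"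
        and G2: "\<And>k r. k < n \<Longrightarrow> r < 3 \<Longrightarrow> 0 \<le> arr s2 ''G'' (3 * k + r) \<and> arr s2 ''G'' (3 * k + r) \<le> int n"
        and cv: "\<And>k z j. k < n \<Longrightarrow> z < c \<Longrightarrow> role f k z j \<Longrightarrow> output_seq s2 k \<le> ereal (approx * sum (f z) j) \<or>
          (\<exists>r<3. arr s2 ''G'' (3 * k + r) \<le> int z \<and> int z < arr s2 ''G'' (3 * k + r) + int S)"
        using 1(1) unfolding mid_def by auto
      note p2 = 1(1)
      show ?case
      proof (rule runs_conseq[OF brute_prog[OF m(1) f G2 m(2)]], assumption, assumption, goal_cases)
        case (1 t3 s3)
        have "t1 + (t2 + t3) \<le> 3000 * (q * (n * S))" using 3(1) p2 1(1) time by linarith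
        moreover have "output_seq s3 (i + j) \<le> ereal (approx * sum i j)"
          if ij: "i + j < n" "xm i \<noteq> 0" "ym j \<noteq> 0" "ye j \<le> xe i" for i j
        proof -
          obtain z where z: "z < c" "f z = i" using f ij unfolding order_def by (meson add_lessD1)
          have rl: "role f (i + j) z j" using z ij by (simp add: role_def)
          from cv[OF ij(1) z(1) rl] show ?thesis
          proof
            assume "output_seq s2 (i + j) \<le> ereal (approx * sum (f z) j)"
            then show ?thesis using 1(1) z by (meson order_trans)
          next
            assume "\<exists>r<3. arr s2 ''G'' (3 * (i + j) + r) \<le> int z \<and> int z < arr s2 ''G'' (3 * (i + j) + r) + int S"
            then have "settled f (i + j) z s3" using 1(1) ij(1) z(1) by blast
            then show ?thesis using rl z unfolding settled_def by blast
          qed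
        qed
        moreover have "output_seq s3 k \<le> output_seq s k" if "k < n" for k using 1(1) m(3)[OF that] by (meson order_trans)
        ultimately show ?case using 1(1) by blast
      qed
    qed
  qed
qed

end

section \<open>The exact convolution as an attained minimum\<close>

lemma finite_splits: "finite {A i + B j |i j. i + j = (k::nat)}"
proof -
  have "{A i + B j |i j. i + j = k} \<subseteq> (\<lambda>(i, j). A i + B j) ` ({..k} \<times> {..k})" by auto
  then show ?thesis by (rule finite_subset) simp
qed

lemma min_plus_conv_le: "min_plus_conv A B (i + j) \<le> A i + B j"
  unfolding min_plus_conv_def by (rule Min_le[OF finite_splits]) blast

lemma min_plus_conv_attained:
  obtains i j where "i + j = k" "min_plus_conv A B k = A i + B j"
proof -
  have "A 0 + B k \<in> {A i + B j |i j. i + j = k}" by (intro CollectI exI[of _ 0] exI[of _ k]) simp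
  then have "{A i + B j |i j. i + j = k} \<noteq> {}" by blast
  from Min_in[OF finite_splits this] show ?thesis using that unfolding min_plus_conv_def by blast
qed

section \<open>Initialisation and the complete program\<close>

context params
begin

text \<open>A normalized \<open>p\<close>-bit mantissa puts the given approximation of
  \<open>\<epsilon>\<close> between \<open>2 powi (p + e - 1)\<close> and
  \<open>2 powi (p + e)\<close>, where \<open>e\<close> is its exponent. Choosing
  \<open>K = 3 - (p + e)\<close> makes \<open>4 / 2 ^ K\<close> equal to the lower of these bounds,
  hence at most \<open>\<epsilon>\<close>, while the factor 2 allowed in the approximation still
  yields \<open>2 ^ K \<le> 16 / \<epsilon>\<close>. The mantissa itself is not inspected.\<close>

definition setup_prog :: com where
  "setup_prog =
     Assign ''K'' (Const 3 \<ominus> (Reg ''p'' \<oplus> Reg ''eps_exp'')) ;;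
     Assign ''M'' (Const 2 \<otimes> (Const 1 \<lless> Reg ''K'')) ;;
     Assign ''P'' (Const 1) ;;
     Assign ''qP'' (Const 0) ;;
     For ''i'' ''n''
       (Cond (Reg ''P'' \<prec> Reg ''n'')
          (Assign ''P'' (Const 2 \<otimes> Reg ''P'') ;; Assign ''qP'' (Reg ''qP'' \<oplus> Const 1)) Skip) ;;
     Assign ''N'' (Const 2 \<otimes> Reg ''P'' \<otimes> Reg ''M'') ;;
     Assign ''q'' (Reg ''qP'' \<oplus> Reg ''K'' \<oplus> Const 2) ;;
     Assign ''S'' (Const 1 \<lless> (Reg ''q'' \<oslash> Const 2)) ;;
     Assign ''Q'' (Const 1 \<lless> (Const 2 \<otimes> (Const 8 \<otimes> Reg ''q'')))"

lemma written_setup [simp]: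
  "written_regs setup_prog = {''K'', ''M'', ''P'', ''qP'', ''i'', ''N'', ''q'', ''S'', ''Q''}"
  "written_arrs setup_prog = {}"
  by (auto simp: setup_prog_def)

lemma setup_prog:
  assumes regs: "reg s ''n'' = int n" "reg s ''p'' = int p" "3 - (int p + reg s ''eps_exp'') = int K"
    and eps: "wd 0 (reg s ''eps_exp'')" and qP: "qP = (LEAST d. n \<le> 2 ^ d)"
  shows "runs L setup_prog s (\<lambda>t s'. t \<le> n * 30 + 70 \<and> env s')"
proof -
  have least1: "n \<le> 2 ^ qP" by (rule nP)
  have least2: "qP \<le> d" if "n \<le> 2 ^ d" for d
    using Least_le[of "\<lambda>d. n \<le> 2 ^ d", OF that] unfolding qP .
  note least = least1 least2
  have we: "wd a (reg s ''eps_exp'')" for a using eps wd_mono by blast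
  have wpow: "wd a (2 ^ d)" if "d \<le> q" "3 \<le> a" for a d
  proof -
    have "(2::nat) ^ d \<le> N" unfolding N_def using that by (intro power_increasing) auto
    from wd_nat[OF this that(2)] show ?thesis by simp
  qed
  let ?s1 = "s\<lparr>reg := (reg s)(''K'' := int K, ''M'' := int M, ''P'' := 1, ''qP'' := 0)\<rparr>"
  \<comment> \<open>After \<open>m\<close> rounds the exponent is either \<open>m\<close> or has
    stopped at \<open>qP\<close>; \<open>n\<close> rounds are enough, because
    \<open>n \<le> 2 ^ n\<close> gives \<open>qP \<le> n\<close>.\<close>
  let ?I = "\<lambda>m s'. \<exists>d\<le>qP. reg s' ''P'' = 2 ^ d \<and> reg s' ''qP'' = int d \<and> (d = qP \<or> d = m)"
  have loop: "runs L (For ''i'' ''n''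
       (Cond (Reg ''P'' \<prec> Reg ''n'')
          (Assign ''P'' (Const 2 \<otimes> Reg ''P'') ;; Assign ''qP'' (Reg ''qP'' \<oplus> Const 1)) Skip)) ?s1
     (\<lambda>t s'. t \<le> n * 24 + 6 \<and> ?I n s')"
  proof (rule runs_For[where m = n and T = 16 and I = ?I], goal_cases)
    case 8
    show ?case by (intro exI[of _ 0]) simp
  next
    case (9 m s')
    then obtain d where d: "d \<le> qP" "reg s' ''P'' = 2 ^ d" "reg s' ''qP'' = int d" "d = qP \<or> d = m" by blast
    have n: "reg s' ''n'' = int n" using unchanged_reg[OF 9(4)] regs by simp
    have w: "wd a (2 ^ d)" "wd a (int d)" if "3 \<le> a" for a
      using wpow[of d a] d q_eq that le_N(7) by (auto intro!: wd_nat)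
    have lt: "(2::int) ^ d < int n \<longleftrightarrow> \<not> n \<le> 2 ^ d"
      by (metis not_le of_nat_less_iff of_nat_numeral of_nat_power)
    show ?case
    proof (cases "n \<le> 2 ^ d")
      case True
      then have "d = qP" using least d by (simp add: le_antisym)
      then show ?thesis using d n w lt True by (simp add: wd_rules)
    next
      case False
      then have "d < qP" using least(1) d(1) by (metis le_neq_implies_less)
      then show ?thesis using d n w lt False
        by (auto simp: wd_rules intro!: exI[of _ "Suc d"])
    qed
  next
    case (10 t s')
    then show ?case by simp
  qed (use regs in \<open>auto simp: wd_rules\<close>)
  have KM: "int M = 2 * 2 ^ K" by (simp add: M_def)
  have q2: "nat (int q div 2) = q div 2" by (simp flip: zdiv_int)
  have wq: "wd a (16 * int q)" "wd a (8 * int q)" if "3 \<le> a" for a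
    by (rule wd_le[OF wd_nat[OF le_N(9) that]]; simp)+
  have wS: "wd a (2 ^ (q div 2))" if "3 \<le> a" for a using wpow[of "q div 2"] that by simp
  have wQ: "wd a (2 ^ (16 * q))" if "7 \<le> a" for a using wd_Q[OF that] by (simp add: Q_def)
  have n16: "nat (16 * int q) = 16 * q" by simp
  show ?thesis
    unfolding setup_prog_def
    apply (subst runs_Seq, rule runs_Assign_val[where v = "int K"])
      apply (use regs we in \<open>simp add: wd_rules\<close>)
     apply (use regs in simp)
    apply (subst runs_Seq, rule runs_Assign_val[where v = "int M"])
      apply (use wpow[of K] q_eq in \<open>simp add: wd_rules\<close>)
     apply (simp add: KM)
    apply (subst runs_Seq, rule runs_Assign_val[where v = 1], simp, simp)
    apply (subst runs_Seq, rule runs_Assign_val[where v = 0], simp, simp)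
    apply (subst runs_Seq)
    apply (rule runs_conseq[of _ _ _ "\<lambda>t s'. t \<le> n * 24 + 6 \<and> ?I n s'"])
    subgoal using loop by simp
    subgoal premises prems for t s'
    proof -
      obtain d where d: "d \<le> qP" "reg s' ''P'' = 2 ^ d" "reg s' ''qP'' = int d" "d = qP \<or> d = n" using prems(1) by blast
      have "n \<le> 2 ^ n" by (simp add: less_imp_le)
      then have "qP \<le> n" by (rule least(2))
      then have dq: "d = qP" using d by auto
      have r: "reg s' ''M'' = int M" "reg s' ''K'' = int K" "reg s' ''n'' = int n" "reg s' ''p'' = int p"
        using unchanged_reg[OF prems(2)] regs by simp_all
      have P: "reg s' ''P'' = int P" "reg s' ''qP'' = int qP" using d dq by (simp_all add: P_def)
      have N: "2 * int P * int M = int N" by (simp add: NPM)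
      have qv: "int qP + int K + 2 = int q" by (simp add: q_eq)
      show ?thesis
        apply (subst runs_Seq, rule runs_Assign_val[where v = "int N"])
          apply (use P r in \<open>simp add: wd_rules\<close>)
         apply (use P r N in simp)
        apply (subst runs_Seq, rule runs_Assign_val[where v = "int q"])
          apply (use P r in \<open>simp add: wd_rules\<close>)
         apply (use P r qv in simp)
        apply (subst runs_Seq, rule runs_Assign_val[where v = "int S"])
          apply (use wS in \<open>simp add: wd_rules q2\<close>)
         apply (simp add: q2 S_def)
        apply (rule runs_Assign_val[where v = Q])
          apply (use wq wQ in \<open>simp add: wd_rules n16\<close>)
         apply (simp add: n16 Q_def)
        using prems(1) P r by (simp add: env_def)
    qed
    done
qed

text \<open>The group records are reset, but the output arrays are not: the second pass goes on
  lowering what the first one has produced.\<close>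

definition copy_prog :: "string \<Rightarrow> string \<Rightarrow> string \<Rightarrow> string \<Rightarrow> com" where
  "copy_prog am ae bm be =
     For ''i'' ''n''
       (Store ''xm'' (Reg ''i'') (Arr am (Reg ''i'')) ;; Store ''xe'' (Reg ''i'') (Arr ae (Reg ''i'')) ;;
        Store ''ym'' (Reg ''i'') (Arr bm (Reg ''i'')) ;; Store ''ye'' (Reg ''i'') (Arr be (Reg ''i'')) ;;
        Store ''Fl'' (Reg ''i'') (Const 0) ;; Store ''Fe'' (Reg ''i'') (Const 0) ;;
        Store ''G'' (Const 3 \<otimes> Reg ''i'') (Const 0) ;; Store ''G'' (Const 3 \<otimes> Reg ''i'' \<oplus> Const 1) (Const 0) ;;
        Store ''G'' (Const 3 \<otimes> Reg ''i'' \<oplus> Const 2) (Const 0))"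

lemma written_copy [simp]:
  "written_regs (copy_prog am ae bm be) = {''i''}"
  "written_arrs (copy_prog am ae bm be) = {''xm'', ''xe'', ''ym'', ''ye'', ''Fl'', ''Fe'', ''G''}"
  by (auto simp: copy_prog_def)

lemma copy_prog:
  assumes env: "env s" and names: "\<forall>a\<in>{am, ae, bm, be}. a \<notin> {''xm'', ''xe'', ''ym'', ''ye'', ''Fl'', ''Fe'', ''G''}"
    and wds: "\<And>i. i < n \<Longrightarrow> wd 0 (arr s am i) \<and> wd 0 (arr s ae i) \<and> wd 0 (arr s bm i) \<and> wd 0 (arr s be i)"
  shows "runs L (copy_prog am ae bm be) s (\<lambda>t s'. t \<le> n * 60 + 6 \<and>
     (\<forall>i<n. arr s' ''xm'' i = arr s am i \<and> arr s' ''xe'' i = arr s ae i \<and> arr s' ''ym'' i = arr s bm i \<and>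
        arr s' ''ye'' i = arr s be i \<and> arr s' ''Fl'' i = 0 \<and> arr s' ''Fe'' i = 0 \<and>
        (\<forall>r<3. arr s' ''G'' (3 * i + r) = 0)))"
  unfolding copy_prog_def
proof (rule runs_For[where m = n and T = 52 and I = "\<lambda>m s'. \<forall>i<m. arr s' ''xm'' i = arr s am i \<and> arr s' ''xe'' i = arr s ae i \<and> arr s' ''ym'' i = arr s bm i \<and>
        arr s' ''ye'' i = arr s be i \<and> arr s' ''Fl'' i = 0 \<and> arr s' ''Fe'' i = 0 \<and>
        (\<forall>r<3. arr s' ''G'' (3 * i + r) = 0)"], goal_cases)
  case (9 m s')
  have src: "arr s' am = arr s am" "arr s' ae = arr s ae" "arr s' bm = arr s bm" "arr s' be = arr s be"
    by (rule unchanged_arr[OF 9(4)]; use names in simp)+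
  have w: "wd a (arr s am m)" "wd a (arr s ae m)" "wd a (arr s bm m)" "wd a (arr s be m)" for a
    using wds[OF 9(1)] wd_mono by blast+
  have wm: "wd a (int m)" if "3 \<le> a" for a using that 9(1) le_N(1) by (intro wd_nat) auto
  have ix: "nat (3 * int m) = 3 * m" "nat (3 * int m + 1) = 3 * m + 1" "nat (3 * int m + 2) = 3 * m + 2" by simp_all
  let ?body = "(Store ''xm'' (Reg ''i'') (Arr am (Reg ''i'')) ;; Store ''xe'' (Reg ''i'') (Arr ae (Reg ''i'')) ;;
        Store ''ym'' (Reg ''i'') (Arr bm (Reg ''i'')) ;; Store ''ye'' (Reg ''i'') (Arr be (Reg ''i'')) ;;
        Store ''Fl'' (Reg ''i'') (Const 0) ;; Store ''Fe'' (Reg ''i'') (Const 0) ;;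
        Store ''G'' (Const 3 \<otimes> Reg ''i'') (Const 0) ;; Store ''G'' (Const 3 \<otimes> Reg ''i'' \<oplus> Const 1) (Const 0) ;;
        Store ''G'' (Const 3 \<otimes> Reg ''i'' \<oplus> Const 2) (Const 0))"
  have run: "runs L ?body s' (\<lambda>t s''. t \<le> 52 \<and> arr s'' ''xm'' = (arr s' ''xm'')(m := arr s am m) \<and>
      arr s'' ''xe'' = (arr s' ''xe'')(m := arr s ae m) \<and> arr s'' ''ym'' = (arr s' ''ym'')(m := arr s bm m) \<and>
      arr s'' ''ye'' = (arr s' ''ye'')(m := arr s be m) \<and> arr s'' ''Fl'' = (arr s' ''Fl'')(m := 0) \<and>
      arr s'' ''Fe'' = (arr s' ''Fe'')(m := 0) \<and> arr s'' ''G'' = (arr s' ''G'')(3 * m := 0, 3 * m + 1 := 0, 3 * m + 2 := 0))"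
    using 9(2) names by (simp add: src w wm wd_rules ix)
  show ?case
  proof (rule runs_conseq[OF run], goal_cases)
    case (1 t s'')
    have "arr s'' ''xm'' i = arr s am i \<and> arr s'' ''xe'' i = arr s ae i \<and> arr s'' ''ym'' i = arr s bm i \<and>
        arr s'' ''ye'' i = arr s be i \<and> arr s'' ''Fl'' i = 0 \<and> arr s'' ''Fe'' i = 0 \<and>
        (\<forall>r<3. arr s'' ''G'' (3 * i + r) = 0)" if i: "i < Suc m" for i
    proof (cases "i = m")
      case True
      have "arr s'' ''G'' (3 * m + r) = 0" if r: "r < 3" for r
      proof -
        consider "r = 0" | "r = 1" | "r = 2" using r by linarith
        then show ?thesis using 1(1) by cases simp_all
      qed
      then show ?thesis using 1(1) True by simp
    next
      case False
      then have im: "i < m" using i by simp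
      have "arr s'' ''G'' (3 * i + r) = arr s' ''G'' (3 * i + r)" if "r < 3" for r
      proof -
        have "3 * i + r < 3 * m" using im that by linarith
        then show ?thesis using 1(1) by simp
      qed
      then show ?thesis using 1(1) 9(3) im by simp
    qed
    then show ?case using 1(1) by blast
  qed
qed (use env in \<open>auto simp: env_def wd_rules\<close>)

text \<open>The root table takes time proportional to \<open>N\<close>, which is affordable only for
  \<open>S < n\<close>, where \<open>N \<le> 2 * (S * S) \<le> 2 * (n * S)\<close>. Otherwise at
  most \<open>S\<close> entries are finite and no transform is ever executed, so the table can be
  omitted.\<close>

definition main_prog :: com where
  "main_prog =
     setup_prog ;;
     Cond (Reg ''S'' \<prec> Reg ''n'') (first_root_prog ;; root_table_prog) Skip ;;
     copy_prog ''A_man'' ''A_exp'' ''B_man'' ''B_exp'' ;; pair_inst.body_prog ;;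
     copy_prog ''B_man'' ''B_exp'' ''A_man'' ''A_exp'' ;; pair_inst.body_prog"

end

lemma (in pair_inst) written_body [simp]:
  "written_regs body_prog = written_regs sort_prog \<union> written_regs groups_prog \<union> written_regs brute_prog"
  "written_arrs body_prog = written_arrs sort_prog \<union> written_arrs groups_prog \<union> written_arrs brute_prog"
  by (auto simp: body_prog_def)

text \<open>The first run handles the pairs whose summand from \<open>A\<close> has the larger exponent, the second run,
  with the roles exchanged, the others.\<close>

lemma (in params) main_prog:
  assumes p1: "1 \<le> p" and regs: "reg s ''n'' = int n" "reg s ''p'' = int p" "3 - (int p + reg s ''eps_exp'') = int K"
    and eps: "wd 0 (reg s ''eps_exp'')" and qP: "qP = (LEAST d. n \<le> 2 ^ d)" and P2: "P \<le> 2 * n"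
    and wds: "\<And>a i. wd 0 (arr s a i)"
    and A: "\<And>i. i < n \<Longrightarrow> arr s ''A_man'' i = 0 \<or> normalized p (arr s ''A_man'' i)"
      "\<And>i. i < n \<Longrightarrow> float_val (arr s ''A_man'' i) (arr s ''A_exp'' i) = A i"
    and B: "\<And>i. i < n \<Longrightarrow> arr s ''B_man'' i = 0 \<or> normalized p (arr s ''B_man'' i)"
      "\<And>i. i < n \<Longrightarrow> float_val (arr s ''B_man'' i) (arr s ''B_exp'' i) = B i"
    and C: "\<And>i. arr s ''C_man'' i = 0"
  shows "runs L main_prog s (\<lambda>t s'. t \<le> 10000 * (q * q * (n * S)) \<and>
    (\<forall>k<n. min_plus_conv A B k \<le> output_seq s' k \<and> output_seq s' k \<le> ereal (1 + 4 / 2 ^ K) * min_plus_conv A B k))"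
proof -
  let ?lb = "min_plus_conv A B"
  let ?am = "arr s ''A_man''" and ?ae = "arr s ''A_exp''" and ?bm = "arr s ''B_man''" and ?be = "arr s ''B_exp''"
  note le = min_plus_conv_le[of A B]
  have Av: "A i = ereal (fval (?am i) (?ae i))" if "i < n" "?am i \<noteq> 0" for i
    using A(2)[OF that(1)] float_val_fval[OF that(2)] by simp
  have Bv: "B i = ereal (fval (?bm i) (?be i))" if "i < n" "?bm i \<noteq> 0" for i
    using B(2)[OF that(1)] float_val_fval[OF that(2)] by simp
  have nA: "?am i = 0 \<or> 2 ^ (p - 1) \<le> ?am i \<and> ?am i < 2 ^ p" if "i < n" for i
    using A(1)[OF that] by (auto simp: normalized_def)
  have nB: "?bm i = 0 \<or> 2 ^ (p - 1) \<le> ?bm i \<and> ?bm i < 2 ^ p" if "i < n" for i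
    using B(1)[OF that] by (auto simp: normalized_def)
  interpret I1: pair_inst w L n p K q qP ?am ?ae ?bm ?be ?lb
  proof
    fix i j assume ij: "i + j < n" "?am i \<noteq> 0" "?bm j \<noteq> 0"
    then show "?lb (i + j) \<le> ereal (fval (?am i) (?ae i) + fval (?bm j) (?be j))"
      using le[of i j] Av[of i] Bv[of j] by simp
  qed (fact p1 | (rule nA nB; assumption) | rule wds)+
  interpret I2: pair_inst w L n p K q qP ?bm ?be ?am ?ae ?lb
  proof
    fix i j assume ij: "i + j < n" "?bm i \<noteq> 0" "?am j \<noteq> 0"
    then show "?lb (i + j) \<le> ereal (fval (?bm i) (?be i) + fval (?am j) (?ae j))"
      using le[of j i] Av[of j] Bv[of i] by (simp add: add.commute)
  qed (fact p1 | (rule nA nB; assumption) | rule wds)+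
  define inputs where "inputs s' \<longleftrightarrow> arr s' ''A_man'' = ?am \<and> arr s' ''A_exp'' = ?ae \<and> arr s' ''B_man'' = ?bm \<and> arr s' ''B_exp'' = ?be"
    for s' :: state
  have inputs_un: "inputs s''" if i: "inputs s'" and un: "unchanged X Y s' s''"
    and Y: "Y \<inter> {''A_man'', ''A_exp'', ''B_man'', ''B_exp''} = {}" for X Y s' s''
  proof -
    have "''A_man'' \<notin> Y" "''A_exp'' \<notin> Y" "''B_man'' \<notin> Y" "''B_exp'' \<notin> Y" using Y by auto
    then show ?thesis using i by (simp add: inputs_def unchanged_arr[OF un])
  qed
  have out_un: "output_seq s'' = output_seq s' \<and> C_words s'' = C_words s'"
    if "unchanged X Y s' s''" "Y \<inter> {''C_man'', ''C_exp''} = {}" for X Y s' s''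
  proof -
    have "''C_man'' \<notin> Y" "''C_exp'' \<notin> Y" using that(2) by auto
    then have "arr s'' ''C_man'' = arr s' ''C_man''" "arr s'' ''C_exp'' = arr s' ''C_exp''"
      by (simp_all add: unchanged_arr[OF that(1)])
    then show ?thesis by (auto simp: output_seq_def C_words_def fun_eq_iff)
  qed
  have C0: "C_words s" "output_seq s k = \<infinity>" for k
    using C wds by (auto simp: C_words_def output_seq_def float_val_def intro: wd_mono)
  have S1: "1 \<le> S" using pos(4) by linarith
  have nS: "n * 1 \<le> n * S" using S1 by (rule mult_le_mono2)
  have root_phase: "runs L (Cond (Reg ''S'' \<prec> Reg ''n'') (first_root_prog ;; root_table_prog) Skip) s1
      (\<lambda>t s'. t \<le> 10 + (q * (400 * q + 78) + 40 + (84 * (n * S) + 20)) \<and> (S < n \<longrightarrow> roots s'))" if env: "env s1" for s1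
  proof (cases "S < n")
    case True
    have N2: "N * 42 \<le> 84 * (n * S)"
    proof -
      have "q \<le> Suc (q div 2 + q div 2)" by simp
      then have "(2::nat) ^ q \<le> 2 ^ Suc (q div 2 + q div 2)" by (intro power_increasing) auto
      then have "N \<le> 2 * (S * S)" unfolding N_def S_def by (simp add: power_add)
      moreover have "S * S \<le> n * S" using True by (intro mult_le_mono1) simp
      ultimately show ?thesis by linarith
    qed
    have both: "runs L (first_root_prog ;; root_table_prog) s1 (\<lambda>t s'. t \<le> q * (400 * q + 78) + 40 + (84 * (n * S) + 20) \<and> roots s')"
    proof (subst runs_Seq, rule runs_conseq[OF first_root_prog[OF env]], goal_cases)
      case (1 t2 s2)
      have env2: "env s2" by (rule env_unchanged[OF env 1(2)]) (auto simp: env_regs_def)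
      show ?case
        by (rule runs_conseq[OF root_table_prog[OF env2 conjunct2[OF 1(1)]]]) (use 1(1) N2 in linarith)
    qed
    have r: "reg s1 ''S'' = int S" "reg s1 ''n'' = int n" using env by (auto simp: env_def)
    show ?thesis
      apply (subst runs_Cond)
      using True r apply (simp add: wd_rules del: runs_Seq)
      apply (rule runs_conseq[OF both])
      by simp
  next
    case False
    have r: "reg s1 ''S'' = int S" "reg s1 ''n'' = int n" using env by (auto simp: env_def)
    show ?thesis using False r by (simp add: wd_rules)
  qed
  \<comment> \<open>The second factor \<open>q\<close> is due to the first root alone, whose square
    roots number about \<open>q\<close> and take about \<open>q\<close> steps each; all other
    contributions need at most one factor \<open>q\<close>.\<close>
  have time: "(n * 30 + 70) + ((10 + (q * (400 * q + 78) + 40 + (84 * (n * S) + 20))) + ((n * 60 + 6) + (3000 * (q * (n * S)) +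
      ((n * 60 + 6) + 3000 * (q * (n * S)))))) \<le> 10000 * (q * q * (n * S))"
  proof -
    define Z where "Z = n * S"
    have Z: "n \<le> Z" "1 \<le> Z" using nS n1 by (simp_all add: Z_def)
    have a: "8 * Z \<le> q * Z" using q8 by (rule mult_le_mono1)
    have b: "8 * (q * Z) \<le> q * (q * Z)" using q8 by (rule mult_le_mono1)
    have c: "q * q * 1 \<le> q * q * Z" using Z(2) by (rule mult_le_mono2)
    have d: "8 * q \<le> q * q" using q8 by (rule mult_le_mono1)
    have e: "q * (400 * q + 78) = 400 * (q * q) + 78 * q" by (simp add: algebra_simps)
    have f: "q * q * Z = q * (q * Z)" by simp
    show ?thesis unfolding Z_def[symmetric] e using Z a b c d f by linarith
  qed
  have names: "\<forall>a\<in>{''A_man'', ''A_exp'', ''B_man'', ''B_exp''}. a \<notin> {''xm'', ''xe'', ''ym'', ''ye'', ''Fl'', ''Fe'', ''G''}"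
    "\<forall>a\<in>{''B_man'', ''B_exp'', ''A_man'', ''A_exp''}. a \<notin> {''xm'', ''xe'', ''ym'', ''ye'', ''Fl'', ''Fe'', ''G''}" by simp_all
  have body_regs: "written_regs I1.body_prog \<inter> env_regs = {}"
    "written_arrs I1.body_prog \<inter> {''A_man'', ''A_exp'', ''B_man'', ''B_exp''} = {}"
    "written_arrs I1.body_prog \<inter> {''Wr'', ''Wi''} = {}"
    by (auto simp: env_regs_def fft_regs_def)
  have sum_swap: "I2.sum j i = I1.sum i j" for i j by (simp add: I1.sum_def I2.sum_def)
  have final: "?lb k \<le> output_seq s' k \<and> output_seq s' k \<le> ereal (1 + 4 / 2 ^ K) * ?lb k"
    if k: "k < n" and lb: "?lb k \<le> output_seq s' k"
      and all: "\<And>i j. i + j = k \<Longrightarrow> ?am i \<noteq> 0 \<Longrightarrow> ?bm j \<noteq> 0 \<Longrightarrow> output_seq s' k \<le> ereal ((1 + 4 / 2 ^ K) * I1.sum i j)" for k s'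
  proof -
    obtain i j where ij: "i + j = k" "?lb k = A i + B j" by (rule min_plus_conv_attained)
    then have n: "i < n" "j < n" using k by auto
    show ?thesis
    proof (cases "?am i \<noteq> 0 \<and> ?bm j \<noteq> 0")
      case True
      have "?lb k = ereal (I1.sum i j)" using ij Av[OF n(1)] Bv[OF n(2)] True by (simp add: I1.sum_def)
      then show ?thesis using all[OF ij(1)] True lb by simp
    next
      case False
      \<comment> \<open>If the minimising pair involves an infinite entry, the minimum itself is
        infinite, so the lower bound already forces an infinite output and nothing has to be
        approximated.\<close>
      have "A i = \<infinity> \<or> B j = \<infinity>" using False A(2)[OF n(1)] B(2)[OF n(2)] by (auto simp: float_val_def)
      moreover have "A i \<noteq> - \<infinity>" "B j \<noteq> - \<infinity>" using A(2)[OF n(1)] B(2)[OF n(2)] by (auto simp: float_val_def split: if_splits)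
      ultimately have inf: "?lb k = \<infinity>" using ij(2) by auto
      have "0 < (1 + 4 / 2 ^ K :: real)" by (simp add: add_pos_pos)
      then show ?thesis using lb inf by simp
    qed
  qed
  show ?thesis
    unfolding main_prog_def
  proof (subst runs_Seq, rule runs_conseq[OF setup_prog[OF regs eps qP]], goal_cases)
    case (1 t1 s1)
    note u1 = 1(2) and q1 = 1(1)
    have env1: "env s1" using q1 by blast
    have in1: "inputs s1" by (rule inputs_un[OF _ u1]) (auto simp: inputs_def)
    have o1: "output_seq s1 = output_seq s" "C_words s1" using out_un[OF u1] C0 by auto
    show ?case
    proof (subst runs_Seq, rule runs_conseq[OF root_phase[OF env1]], goal_cases)
      case (1 t2 s2)
      note u2 = 1(2) and q2 = 1(1)
      have env2: "env s2" by (rule env_unchanged[OF env1 u2]) (auto simp: env_regs_def)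
      have in2: "inputs s2" by (rule inputs_un[OF in1 u2]) auto
      have o2: "output_seq s2 = output_seq s" "C_words s2" using out_un[OF u2] o1 by auto
      have w2: "\<And>i. i < n \<Longrightarrow> wd 0 (arr s2 ''A_man'' i) \<and> wd 0 (arr s2 ''A_exp'' i) \<and> wd 0 (arr s2 ''B_man'' i) \<and> wd 0 (arr s2 ''B_exp'' i)"
        using in2 wds by (simp add: inputs_def)
      show ?case
      proof (subst runs_Seq, rule runs_conseq[OF copy_prog[OF env2 names(1) w2]], assumption, goal_cases)
        case (1 t3 s3)
        note u3 = 1(2) and q3 = 1(1)
        have env3: "env s3" by (rule env_unchanged[OF env2 u3]) (auto simp: env_regs_def)
        have in3: "inputs s3" by (rule inputs_un[OF in2 u3]) auto
        have o3: "output_seq s3 = output_seq s" "C_words s3" using out_un[OF u3] o2 by auto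
        have r3: "roots s3" if "S < n" by (rule I1.roots_unchanged[OF _ u3]) (use q2 that in auto)
        have inp3: "I1.inp s3" using q3 in2 by (simp add: I1.inp_def inputs_def)
        have b3: "runs L I1.body_prog s3 (\<lambda>t s'. t \<le> 3000 * (q * (n * S)) \<and> I1.valid_out s' \<and> (\<forall>k<n. output_seq s' k \<le> output_seq s3 k) \<and>
           (\<forall>i j. i + j < n \<and> ?am i \<noteq> 0 \<and> ?bm j \<noteq> 0 \<and> ?be j \<le> ?ae i \<longrightarrow> output_seq s' (i + j) \<le> ereal (I1.approx * I1.sum i j)))"
          by (rule I1.body_prog[OF env3 inp3 r3 o3(2) _ _ _ P2]) (use q3 o3 C0 in auto)
        show ?case
        proof (subst runs_Seq, rule runs_conseq[OF b3], goal_cases)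
          case (1 t4 s4)
          note u4 = 1(2) and q4 = 1(1)
          have env4: "env s4" by (rule env_unchanged[OF env3 u4 body_regs(1)])
          have in4: "inputs s4" by (rule inputs_un[OF in3 u4 body_regs(2)])
          have r4: "roots s4" if "S < n" by (rule I1.roots_unchanged[OF r3[OF that] u4 body_regs(3)])
          have w4: "\<And>i. i < n \<Longrightarrow> wd 0 (arr s4 ''B_man'' i) \<and> wd 0 (arr s4 ''B_exp'' i) \<and> wd 0 (arr s4 ''A_man'' i) \<and> wd 0 (arr s4 ''A_exp'' i)"
            using in4 wds by (simp add: inputs_def)
          have v4: "C_words s4" "\<And>k. k < n \<Longrightarrow> ?lb k \<le> output_seq s4 k" using q4 by (auto simp: I1.valid_out_def)
          show ?case
          proof (subst runs_Seq, rule runs_conseq[OF copy_prog[OF env4 names(2) w4]], assumption, goal_cases)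
            case (1 t5 s5)
            note u5 = 1(2) and q5 = 1(1)
            have env5: "env s5" by (rule env_unchanged[OF env4 u5]) (auto simp: env_regs_def)
            have o5: "output_seq s5 = output_seq s4" "C_words s5" using out_un[OF u5] v4 by auto
            have r5: "roots s5" if "S < n" by (rule I1.roots_unchanged[OF r4[OF that] u5]) auto
            have inp5: "I2.inp s5" using q5 in4 by (simp add: I2.inp_def inputs_def)
            have b5: "runs L I2.body_prog s5 (\<lambda>t s'. t \<le> 3000 * (q * (n * S)) \<and> I2.valid_out s' \<and> (\<forall>k<n. output_seq s' k \<le> output_seq s5 k) \<and>
               (\<forall>i j. i + j < n \<and> ?bm i \<noteq> 0 \<and> ?am j \<noteq> 0 \<and> ?ae j \<le> ?be i \<longrightarrow> output_seq s' (i + j) \<le> ereal (I2.approx * I2.sum i j)))"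
              by (rule I2.body_prog[OF env5 inp5 r5 o5(2) _ _ _ P2]) (use q5 o5 v4 in auto)
            show ?case
            proof (rule runs_conseq[OF b5], goal_cases)
              case (1 t6 s6)
              have t: "t1 + (t2 + (t3 + (t4 + (t5 + t6)))) \<le> 10000 * (q * q * (n * S))"
                using q1 q2 q3 q4 q5 1(1) time by linarith
              have "?lb k \<le> output_seq s6 k \<and> output_seq s6 k \<le> ereal (1 + 4 / 2 ^ K) * ?lb k" if k: "k < n" for k
              proof (rule final[OF k])
                show "?lb k \<le> output_seq s6 k" using 1(1) k by (simp add: I2.valid_out_def)
                fix i j assume ij: "i + j = k" "?am i \<noteq> 0" "?bm j \<noteq> 0"
                show "output_seq s6 k \<le> ereal ((1 + 4 / 2 ^ K) * I1.sum i j)"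
                proof (cases "?be j \<le> ?ae i")
                  case True
                  have "output_seq s6 k \<le> output_seq s4 k" using 1(1) k o5 by simp
                  also have "\<dots> \<le> ereal ((1 + 4 / 2 ^ K) * I1.sum i j)" using q4 ij True k by blast
                  finally show ?thesis .
                next
                  case False
                  have "j + i < n" "?ae i \<le> ?be j" using ij k False by auto
                  then have "output_seq s6 (j + i) \<le> ereal (I2.approx * I2.sum j i)"
                    using 1(1) ij by blast
                  then show ?thesis using ij(1) by (simp add: sum_swap add.commute)
                qed
              qed
              then show ?case using t by blast
            qed
          qed
        qed
      qed
    qed
  qed
qed

section \<open>Running time\<close>

text \<open>From \<open>2 ^ q = 4 * 2 ^ qP * 2 ^ K\<close> one gets at most
  \<open>4 * 2 * 16 = 128\<close> times \<open>n / \<epsilon>\<close>. Hence \<open>q\<close> is at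
  most 6 times the logarithm, and the group size at most \<open>12 * sqrt (n / \<epsilon>)\<close>,
  because \<open>128 \<le> 12 * 12\<close>. The constant is
  \<open>10000 * 6 * 6 * 12\<close>.\<close>

lemma time_bound:
  fixes \<epsilon> :: real and n K q qP :: nat
  assumes n: "1 \<le> n" and \<epsilon>: "0 < \<epsilon>" "\<epsilon> < 1 / 10" and q: "q = qP + K + 2" and P: "2 ^ qP \<le> 2 * n" and K: "2 ^ K \<le> 16 / \<epsilon>"
    and t: "t \<le> 10000 * (q * q * (n * 2 ^ (q div 2)))"
  shows "real t \<le> 4320000 * (real n powr (3 / 2) / sqrt \<epsilon>) * ln (real n / \<epsilon>) ^ 2"
proof -
  define x where "x = ln (real n / \<epsilon>)"
  have ne: "10 \<le> real n / \<epsilon>"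
  proof -
    have "10 \<le> 1 / \<epsilon>" using \<epsilon> by (simp add: field_simps)
    also have "\<dots> \<le> real n / \<epsilon>" using n \<epsilon> by (intro divide_right_mono) auto
    finally show ?thesis .
  qed
  have "exp (1::real) \<le> 3" by (rule exp_le)
  then have "exp (1::real) * exp 1 \<le> 3 * 3" by (intro mult_mono) auto
  then have "exp (2::real) \<le> 9" by (simp flip: exp_add)
  then have x2: "2 \<le> x" unfolding x_def using ne by (subst ln_ge_iff) auto
  have ln2: "1 / 2 \<le> ln (2::real)"
  proof (subst ln_ge_iff)
    have "exp (1/2 :: real) * exp (1/2) \<le> 2 * 2" using \<open>exp (1::real) \<le> 3\<close> by (simp flip: exp_add)
    then show "exp (1 / 2 :: real) \<le> 2" by (metis exp_ge_zero abs_le_square_iff abs_of_nonneg power2_eq_square zero_le_numeral)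
  qed simp
  have N: "(2::real) ^ q \<le> 128 * (real n / \<epsilon>)"
  proof -
    have "(2::real) ^ q = 4 * (2 ^ qP * 2 ^ K)" unfolding q by (simp add: power_add)
    moreover have "(2::real) ^ qP \<le> 2 * real n" using P by (metis of_nat_le_iff of_nat_mult of_nat_numeral of_nat_power)
    then have "(2::real) ^ qP * 2 ^ K \<le> (2 * real n) * (16 / \<epsilon>)" using K by (intro mult_mono) auto
    ultimately show ?thesis by simp
  qed
  have q6: "real q \<le> 6 * x"
  proof -
    have "real q * ln 2 = ln (2 ^ q)" by (simp add: ln_realpow)
    also have "\<dots> \<le> ln (128 * (real n / \<epsilon>))" using N ne by (subst ln_le_cancel_iff) auto
    also have "\<dots> = ln (2 ^ 7) + x" unfolding x_def using n \<epsilon> by (subst ln_mult) auto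
    also have "ln (2 ^ 7 :: real) = 7 * ln 2" by (subst ln_realpow) auto
    finally have h: "(real q - 7) * ln 2 \<le> x" by (simp add: algebra_simps)
    \<comment> \<open>In the case \<open>q > 7\<close>, \<open>ln 2 \<ge> 1 / 2\<close> gives
      \<open>q \<le> 2 * x + 7\<close>, and \<open>2 \<le> x\<close> absorbs the 7 into
      \<open>4 * x\<close>.\<close>
    show ?thesis
    proof (cases "real q \<le> 7")
      case True
      then show ?thesis using x2 by linarith
    next
      case False
      then have "(real q - 7) * (1 / 2) \<le> (real q - 7) * ln 2" using ln2 by (intro mult_left_mono) auto
      then show ?thesis using h x2 by simp
    qed
  qed
  have S: "(2::real) ^ (q div 2) \<le> 12 * sqrt (real n / \<epsilon>)"
  proof -
    have "((2::real) ^ (q div 2))\<^sup>2 = 2 ^ (q div 2 + q div 2)" by (simp add: power2_eq_square power_add)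
    also have "\<dots> \<le> 2 ^ q" by (intro power_increasing) auto
    also have "\<dots> \<le> 144 * (real n / \<epsilon>)" using N ne by linarith
    also have "\<dots> = (12 * sqrt (real n / \<epsilon>))\<^sup>2" using n \<epsilon> by (simp add: power_mult_distrib)
    finally show ?thesis by (rule power2_le_imp_le) (use n \<epsilon> in simp)
  qed
  have pw: "real n powr (3 / 2) / sqrt \<epsilon> = real n * sqrt (real n / \<epsilon>)"
  proof -
    have "real n powr (3 / 2) = real n powr (1 + 1 / 2)" by simp
    also have "\<dots> = real n * sqrt (real n)" using n by (simp only: powr_add powr_half_sqrt) simp
    finally show ?thesis by (simp add: real_sqrt_divide)
  qed
  have "real t \<le> real (10000 * (q * q * (n * 2 ^ (q div 2))))" using t by (simp only: of_nat_le_iff)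
  also have "\<dots> = 10000 * ((real q * real q) * (real n * 2 ^ (q div 2)))" by simp
  also have "\<dots> \<le> 10000 * (((6 * x) * (6 * x)) * (real n * (12 * sqrt (real n / \<epsilon>))))"
    using q6 S x2 n \<epsilon> by (intro mult_left_mono mult_mono) auto
  also have "\<dots> = 4320000 * (real n * sqrt (real n / \<epsilon>)) * x ^ 2" by (simp add: power2_eq_square)
  finally show ?thesis unfolding pw x_def .
qed

theorem mainTheorem13:
  "\<exists>T \<in> soft_O (\<lambda>n \<epsilon>. real n powr (3 / 2) / sqrt \<epsilon>).
     approx_min_plus_conv_strongly_poly_time T"
proof (rule bexI)
  let ?T = "\<lambda>n \<epsilon>. 4320000 * (real n powr (3 / 2) / sqrt \<epsilon>) * ln (real n / \<epsilon>) ^ 2"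
  show "?T \<in> soft_O (\<lambda>n \<epsilon>. real n powr (3 / 2) / sqrt \<epsilon>)"
    unfolding soft_O_def by blast
  show "approx_min_plus_conv_strongly_poly_time ?T"
    unfolding approx_min_plus_conv_strongly_poly_time_def
  \<comment> \<open>Program and word factor are fixed before the instance is chosen. This is
    possible because the program text mentions none of the locale parameters; it recomputes them in
    registers. The factor is that of level 10, \<open>2 ^ 10\<close>.\<close>
  proof (rule exI[of _ params.main_prog], rule exI[of _ 1024], intro allI impI, elim conjE)
    fix n w p :: nat and \<epsilon> :: real and A B :: "nat \<Rightarrow> ereal" and s :: state
    assume n1: "1 \<le> n" and \<epsilon>: "0 < \<epsilon>" "\<epsilon> < 1 / 10" and inp: "input_state w p n \<epsilon> A B s"
    let ?m = "reg s ''eps_man''" and ?e = "reg s ''eps_exp''"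
    have w\<epsilon>: "1 / \<epsilon> \<le> 2 ^ w" and wr: "\<And>x. is_word w (reg s x)" and wa: "\<And>a i. is_word w (arr s a i)"
      and rn: "reg s ''n'' = int n" and rp: "reg s ''p'' = int p" and nm: "normalized p ?m"
      and fe: "ereal (\<epsilon> / 2) \<le> float_val ?m ?e" "float_val ?m ?e \<le> ereal \<epsilon>"
      and A: "\<And>i. i < n \<Longrightarrow> arr s ''A_man'' i = 0 \<or> normalized p (arr s ''A_man'' i)"
        "\<And>i. i < n \<Longrightarrow> float_val (arr s ''A_man'' i) (arr s ''A_exp'' i) = A i"
      and B: "\<And>i. i < n \<Longrightarrow> arr s ''B_man'' i = 0 \<or> normalized p (arr s ''B_man'' i)"
        "\<And>i. i < n \<Longrightarrow> float_val (arr s ''B_man'' i) (arr s ''B_exp'' i) = B i"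
      and C: "\<And>i. arr s ''C_man'' i = 0"
      using inp unfolding input_state_def by auto
    have w4: "4 \<le> w"
    proof (rule ccontr)
      assume "\<not> 4 \<le> w"
      then have "(2::real) ^ w \<le> 2 ^ 3" by (intro power_increasing) auto
      moreover have "10 < 1 / \<epsilon>" using \<epsilon> by (simp add: field_simps)
      ultimately show False using w\<epsilon> by simp
    qed
    have p1: "1 \<le> p" and m: "2 ^ (p - 1) \<le> ?m" "?m < 2 ^ p" using nm by (auto simp: normalized_def)
    have "0 < ?m" using m(1) by (smt (verit) zero_less_power)
    then have v: "\<epsilon> / 2 \<le> fval ?m ?e" "fval ?m ?e \<le> \<epsilon>" using fe float_val_fval[of ?m ?e] by auto
    have pe: "2 powi (int p + ?e - 1) \<le> fval ?m ?e" "fval ?m ?e < 2 powi (int p + ?e)"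
    proof -
      have "real_of_int (2 ^ (p - 1)) \<le> real_of_int ?m" using m(1) by (simp only: of_int_le_iff)
      then have "2 ^ (p - 1) * 2 powi ?e \<le> fval ?m ?e" unfolding fval_def by (intro mult_right_mono) auto
      moreover have "?e + int (p - 1) = int p + ?e - 1" using p1 by simp
      ultimately show "2 powi (int p + ?e - 1) \<le> fval ?m ?e" using powi_add_nat[of ?e "p - 1"] by (simp only:)
      have "real_of_int ?m < real_of_int (2 ^ p)" using m(2) by (simp only: of_int_less_iff)
      then have "fval ?m ?e < 2 ^ p * 2 powi ?e" unfolding fval_def by (intro mult_strict_right_mono) auto
      then show "fval ?m ?e < 2 powi (int p + ?e)" using powi_add_nat[of ?e p] by (simp add: add.commute)
    qed
    \<comment> \<open>The approximation is at least \<open>2 powi (p + e - 1)\<close> and at most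
      \<open>\<epsilon>\<close>, which is below \<open>1 / 8 = 2 powi (- 3)\<close>; this yields
      \<open>6 \<le> K\<close>.\<close>
    have small: "int p + ?e \<le> - 3"
    proof (rule ccontr)
      assume "\<not> int p + ?e \<le> - 3"
      then have "(2::real) powi (- 3) \<le> 2 powi (int p + ?e - 1)" by (intro power_int_increasing) auto
      moreover have "(2::real) powi (- 3) = 1 / 8" by (simp add: power_int_minus)
      ultimately show False using pe(1) v(2) \<epsilon>(2) by linarith
    qed
    define K where "K = nat (3 - (int p + ?e))"
    have K: "3 - (int p + ?e) = int K" "6 \<le> K" using small by (simp_all add: K_def)
    have pK: "(2::real) powi (int p + ?e) * 2 ^ K = 8"
    proof -
      have "(2::real) powi (int p + ?e + int K) = 2 powi 3" by (simp flip: K(1))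
      then show ?thesis unfolding powi_add_nat by (simp add: mult.commute)
    qed
    have eps4: "4 / 2 ^ K \<le> \<epsilon>"
    proof -
      define y where "y = (2::real) powi (int p + ?e - 1)"
      have "(2::real) powi (int p + ?e) = 2 * y" using powi_add_nat[of "int p + ?e - 1" 1] by (simp add: y_def)
      then have "y * 2 ^ K = 4" using pK by simp
      then have "4 / 2 ^ K = y" by (simp add: divide_eq_eq)
      then have "4 / 2 ^ K = (2::real) powi (int p + ?e - 1)" by (simp only: y_def)
      then show ?thesis using pe(1) v(2) by linarith
    qed
    have K16: "2 ^ K \<le> 16 / \<epsilon>"
    proof -
      have "\<epsilon> / 2 * 2 ^ K \<le> 2 powi (int p + ?e) * 2 ^ K" using v(1) pe(2) by (intro mult_right_mono) auto
      then have "\<epsilon> / 2 * 2 ^ K \<le> 8" unfolding pK .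
      then have "2 ^ K * \<epsilon> \<le> 16" by (simp add: mult.commute)
      then show ?thesis using \<epsilon>(1) by (simp only: pos_le_divide_eq)
    qed
    define qP where "qP = (LEAST d. n \<le> 2 ^ d)"
    have nP: "n \<le> 2 ^ qP" unfolding qP_def by (rule LeastI[of _ n]) (simp add: less_imp_le)
    have P2: "2 ^ qP \<le> 2 * n"
    proof (cases qP)
      case 0
      then show ?thesis using n1 by simp
    next
      case (Suc d)
      then have "\<not> n \<le> 2 ^ d" using not_less_Least[of d "\<lambda>d. n \<le> 2 ^ d"] by (simp add: qP_def)
      then show ?thesis using Suc by simp
    qed
    have nw: "n < 2 ^ w" and pw: "p < 2 ^ w"
      using wr[of "''n''"] wr[of "''p''"] unfolding rn rp is_word_def by simp_all
    define q where "q = qP + K + 2"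
    \<comment> \<open>\<open>n < 2 ^ w\<close> gives \<open>qP \<le> w\<close>, and
      \<open>1 / \<epsilon> \<le> 2 ^ w\<close> gives \<open>K \<le> w + 4\<close>; so
      \<open>q \<le> 2 * w + 6\<close>, and \<open>6 \<le> 2 * w\<close>.\<close>
    have q4: "q \<le> 4 * w"
    proof -
      have "(2::nat) ^ qP < 2 ^ (w + 1)" using P2 nw by simp
      then have "qP < w + 1" by (rule power_less_imp_less_exp[rotated]) simp
      moreover have "16 / \<epsilon> = 16 * (1 / \<epsilon>)" by simp
      then have "(2::real) ^ K \<le> 16 * 2 ^ w" using K16 w\<epsilon> by linarith
      then have "(2::real) ^ K \<le> 2 ^ (w + 4)" by (simp add: power_add)
      then have "K \<le> w + 4" by (rule power_le_imp_le_exp[rotated]) simp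
      ultimately show ?thesis using w4 by (simp add: q_def)
    qed
    interpret params w "1024 * w" n p K q qP
      by unfold_locales (use w4 n1 nw pw K q4 nP in \<open>auto simp: q_def\<close>)
    have wd0: "wd 0 x" if "is_word w x" for x using that by (simp add: wd_def)
    have run: "runs (1024 * w) main_prog s (\<lambda>t s'. t \<le> 10000 * (q * q * (n * S)) \<and>
      (\<forall>k<n. min_plus_conv A B k \<le> output_seq s' k \<and> output_seq s' k \<le> ereal (1 + 4 / 2 ^ K) * min_plus_conv A B k))"
      by (rule main_prog[OF p1 rn rp K(1) wd0[OF wr] qP_def _ wd0[OF wa] A B C]) (use P2 in \<open>auto simp: P_def\<close>)
    then obtain t s' where ex: "exec (1024 * w) main_prog s t s'" and t: "t \<le> 10000 * (q * q * (n * S))"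
      and out: "\<forall>k<n. min_plus_conv A B k \<le> output_seq s' k \<and> output_seq s' k \<le> ereal (1 + 4 / 2 ^ K) * min_plus_conv A B k"
      unfolding runs_def by blast
    have "approx_min_plus_conv n \<epsilon> A B (output_seq s')"
      unfolding approx_min_plus_conv_def
    proof (intro allI impI conjI)
      fix k assume k: "k < n"
      show "min_plus_conv A B k \<le> output_seq s' k" using out k by blast
      \<comment> \<open>Replacing \<open>4 / 2 ^ K\<close> by \<open>\<epsilon>\<close> in the
        factor is monotone only for a nonnegative extended real.\<close>
      have nonneg: "0 \<le> min_plus_conv A B k"
      proof -
        have pos: "0 \<le> float_val x y" if "x = 0 \<or> normalized p x" for x y
        proof -
          have "0 \<le> x" using that unfolding normalized_def by (smt (verit) zero_less_power)
          then show ?thesis by (simp add: float_val_def)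
        qed
        obtain i j where ij: "i + j = k" "min_plus_conv A B k = A i + B j" by (rule min_plus_conv_attained)
        then have n: "i < n" "j < n" using k by auto
        show ?thesis unfolding ij(2) using pos[OF A(1)[OF n(1)]] pos[OF B(1)[OF n(2)]] A(2)[OF n(1)] B(2)[OF n(2)]
          by (metis add_nonneg_nonneg)
      qed
      have "output_seq s' k \<le> ereal (1 + 4 / 2 ^ K) * min_plus_conv A B k" using out k by blast
      also have "\<dots> \<le> ereal (1 + \<epsilon>) * min_plus_conv A B k"
        using eps4 nonneg by (intro ereal_mult_right_mono) auto
      finally show "output_seq s' k \<le> ereal (1 + \<epsilon>) * min_plus_conv A B k" .
    qed
    moreover have "real t \<le> ?T n \<epsilon>"
      by (rule time_bound[OF n1 \<epsilon> q_def P2 K16]) (use t in \<open>simp add: S_def\<close>)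
    ultimately show "\<exists>t s'. exec (1024 * w) params.main_prog s t s' \<and> real t \<le> ?T n \<epsilon> \<and>
        approx_min_plus_conv n \<epsilon> A B (output_seq s')"
      using ex by blast
  qed
qed

end
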